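(* Let $K\in\mathcal K_{\mathrm{uncond}}$. Then for all $u\in\mathcal S_0(K)$ such that $u_i\equiv0$ on $K\cap\{x_i=0\}$ for all $i=1,\dots,n$, one has $$\int_{\partial K}\frac{u_\nu^2}{\langle x,\nu\rangle}\,dx\ \le\ \int_K\sum_{i=1}^nu_{ii}^2\,dx\ \le\ \int_K\|\nabla^2u\|^2dx.$$ In particular, this holds for all $u\in\mathcal S_{0,\mathrm{uncond}}(K)$, and therefore $B_{\mathrm{uncond}}(K)=1$.
   Context: $\mathcal K_{\mathrm{uncond}}$ is the class of unconditional convex bodies in $\mathbb R^n$ (with the origin in their interior), i.e. invariant under reflections with respect to the coordinate hyperplanes $\{x_i=0\}$, $i=1,\dots,n$. $\mathcal S_0(K)=C^2(\mathrm{int}(K))\cap C^1(K)$, and $\mathcal S_{0,\mathrm{uncond}}(K)$ is the subset of functions invariant under these reflections. $u_i$, $u_{ii}$ denote first and second partial derivatives, $\nu=\nu_{\partial K}$ is the ($\mathcal H^{n-1}$-a.e. defined) unit outer normal, $u_\nu=\langle\nabla u,\nu\rangle$, $dx$ on $\partial K$ is $(n-1)$-dimensional Hausdorff measure, and $\|\cdot\|$ is the Hilbert--Schmidt norm. $B_{\mathrm{uncond}}(K)$ denotes the best constant $B$ in the inequality $\int_{\partial K}\frac{u_\nu^2}{\langle x,\nu\rangle}dx\le B\int_K\|\nabla^2u\|^2dx$ for all $u\in\mathcal S_{0,\mathrm{uncond}}(K)$. *)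

theory Defs
  imports "HOL-Analysis.Analysis"
begin

section \<open>Hausdorff measure\<close>

text \<open>
  The normalising factor is the volume of the \<open>k\<close>-dimensional ball of the given diameter, so that
  the \<open>n\<close>-dimensional Hausdorff measure on an \<open>n\<close>-dimensional Euclidean space is Lebesgue measure
  and the \<open>0\<close>-dimensional one is counting measure. The empty set is singled out because
  \<open>0 ^ 0 = 1\<close>.
\<close>

definition hausdorff_gauge :: "nat \<Rightarrow> 'a::metric_space set \<Rightarrow> ennreal" where
  "hausdorff_gauge k A =
     (if A = {} then 0 else ennreal (unit_ball_vol (real k) * (diameter A / 2) ^ k))"

text \<open>Boundedness is required explicitly since \<^const>\<open>diameter\<close> is unspecified on unbounded sets.\<close>

definition hausdorff_pre :: "nat \<Rightarrow> real \<Rightarrow> 'a::metric_space set \<Rightarrow> ennreal" where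
  "hausdorff_pre k \<delta> A =
     (INF C\<in>{C :: nat \<Rightarrow> 'a set. A \<subseteq> (\<Union>i. C i) \<and> (\<forall>i. bounded (C i) \<and> diameter (C i) \<le> \<delta>)}.
        \<Sum>i. hausdorff_gauge k (C i))"

definition hausdorff_outer :: "nat \<Rightarrow> 'a::metric_space set \<Rightarrow> ennreal" where
  "hausdorff_outer k A = (SUP \<delta>\<in>{0<..}. hausdorff_pre k \<delta> A)"

definition hausdorff_measure :: "nat \<Rightarrow> 'a::metric_space measure" where
  "hausdorff_measure k = measure_of UNIV (sets borel) (hausdorff_outer k)"

text \<open>
  \<^const>\<open>measure_of\<close> yields the zero measure when its argument is not countably additive. We
  verify that this does not happen here: the outer measure is a metric outer measure, hence all
  Borel sets are measurable in the sense of Caratheodory (\<open>emeasure_hausdorff_measure\<close> below).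
\<close>

lemma hausdorff_pre_empty: "\<delta> > 0 \<Longrightarrow> hausdorff_pre k \<delta> {} = 0"
  unfolding hausdorff_pre_def
  by (intro antisym INF_lower2[of "\<lambda>_. {}"]) (auto simp: hausdorff_gauge_def)

lemma hausdorff_pre_mono: "A \<subseteq> B \<Longrightarrow> hausdorff_pre k \<delta> A \<le> hausdorff_pre k \<delta> B"
  unfolding hausdorff_pre_def by (rule INF_superset_mono) auto

lemma hausdorff_pre_antimono: "\<delta> \<le> \<epsilon> \<Longrightarrow> hausdorff_pre k \<epsilon> A \<le> hausdorff_pre k \<delta> A"
  unfolding hausdorff_pre_def by (rule INF_superset_mono) (auto intro: order_trans)

lemma hausdorff_pre_le:
  assumes "A \<subseteq> (\<Union>i. C i)" "\<And>i::nat. bounded (C i)" "\<And>i. diameter (C i) \<le> \<delta>"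
  shows "hausdorff_pre k \<delta> A \<le> (\<Sum>i. hausdorff_gauge k (C i))"
  unfolding hausdorff_pre_def using assms by (intro INF_lower) auto

lemma hausdorff_pre_subadditive:
  fixes A :: "nat \<Rightarrow> 'a::metric_space set"
  shows "hausdorff_pre k \<delta> (\<Union>i. A i) \<le> (\<Sum>i. hausdorff_pre k \<delta> (A i))"
proof (rule ennreal_le_epsilon)
  fix e :: real assume "0 < e" "(\<Sum>n. hausdorff_pre k \<delta> (A n)) < top"
  then have *: "hausdorff_pre k \<delta> (A n) < hausdorff_pre k \<delta> (A n) + e * (1/2)^Suc n" for n
    by (auto simp add: less_top dest!: ennreal_suminf_lessD)
  have "\<exists>C. A n \<subseteq> (\<Union>i. C i) \<and> (\<forall>i::nat. bounded (C i) \<and> diameter (C i) \<le> \<delta>) \<and>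
      (\<Sum>i. hausdorff_gauge k (C i)) \<le> hausdorff_pre k \<delta> (A n) + e * (1/2)^Suc n" for n
    using *[of n] unfolding hausdorff_pre_def INF_less_iff by (auto intro: less_imp_le)
  then obtain B where B: "\<And>n. A n \<subseteq> (\<Union>i. B n i)"
      "\<And>n (i::nat). bounded (B n i)" "\<And>n i. diameter (B n i) \<le> \<delta>"
      and Ble: "\<And>n. (\<Sum>i. hausdorff_gauge k (B n i))
                  \<le> hausdorff_pre k \<delta> (A n) + e * (1/2)^Suc n"
    by metis
  define C where "C = case_prod B o prod_decode"
  have "(\<Union>i. A i) \<subseteq> (\<Union>i. C i)"
    using B(1) by (auto simp: C_def subset_eq) (metis prod.case prod_encode_inverse)
  then have "hausdorff_pre k \<delta> (\<Union>i. A i) \<le> (\<Sum>i. hausdorff_gauge k (C i))"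
    by (intro hausdorff_pre_le) (auto simp: C_def split_def B)
  also have "\<dots> = (\<Sum>n. \<Sum>i. hausdorff_gauge k (B n i))"
    unfolding C_def comp_def
    using suminf_ennreal_2dimen[of "\<lambda>n. \<Sum>i. hausdorff_gauge k (B n i)"
        "\<lambda>(n,i). hausdorff_gauge k (B n i)"]
    by (simp add: split_def)
  also have "\<dots> \<le> (\<Sum>n. hausdorff_pre k \<delta> (A n) + e * (1/2) ^ Suc n)"
    by (intro suminf_le Ble) auto
  also have "\<dots> = (\<Sum>n. hausdorff_pre k \<delta> (A n)) + (\<Sum>n. ennreal e * ennreal ((1/2) ^ Suc n))"
    using \<open>0 < e\<close> by (subst suminf_add[symmetric])
                     (auto simp del: ennreal_suminf_cmult simp add: ennreal_mult[symmetric])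
  also have "\<dots> = (\<Sum>n. hausdorff_pre k \<delta> (A n)) + e"
    unfolding ennreal_suminf_cmult
    by (subst suminf_ennreal_eq[OF zero_le_power power_half_series]) auto
  finally show "hausdorff_pre k \<delta> (\<Union>i. A i) \<le> (\<Sum>n. hausdorff_pre k \<delta> (A n)) + e" .
qed

lemma hausdorff_pre_separated:
  fixes A B :: "'a::metric_space set"
  assumes "\<delta> < e" and sep: "\<And>x y. x \<in> A \<Longrightarrow> y \<in> B \<Longrightarrow> e \<le> dist x y" and "\<delta> > 0"
  shows "hausdorff_pre k \<delta> A + hausdorff_pre k \<delta> B \<le> hausdorff_pre k \<delta> (A \<union> B)"
  unfolding hausdorff_pre_def[of k \<delta> "A \<union> B"]
proof (rule INF_greatest, clarify)
  fix C :: "nat \<Rightarrow> 'a set"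
  assume C: "A \<union> B \<subseteq> (\<Union>i. C i)" "\<forall>i. bounded (C i) \<and> diameter (C i) \<le> \<delta>"
  define D where "D S i = (if C i \<inter> S = {} then {} else C i)" for S i
  have D: "hausdorff_pre k \<delta> S \<le> (\<Sum>i. hausdorff_gauge k (D S i))" if S: "S \<subseteq> A \<union> B" for S
  proof (rule hausdorff_pre_le)
    show "S \<subseteq> (\<Union>i. D S i)"
    proof
      fix x assume "x \<in> S"
      then obtain i where "x \<in> C i" using S C(1) by blast
      then have "x \<in> D S i" using \<open>x \<in> S\<close> by (auto simp: D_def)
      then show "x \<in> (\<Union>i. D S i)" by blast
    qed
  qed (use C(2) \<open>\<delta> > 0\<close> in \<open>auto simp: D_def\<close>)
  have "C i \<inter> A = {} \<or> C i \<inter> B = {}" for i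
  proof (rule ccontr)
    assume "\<not> ?thesis"
    then obtain x y where "x \<in> C i" "x \<in> A" "y \<in> C i" "y \<in> B" by blast
    then have "e \<le> dist x y" "dist x y \<le> diameter (C i)" "diameter (C i) \<le> \<delta>"
      using C(2) sep diameter_bounded_bound[of "C i" x y] by blast+
    then show False using \<open>\<delta> < e\<close> by linarith
  qed
  then have le: "hausdorff_gauge k (D A i) + hausdorff_gauge k (D B i) \<le> hausdorff_gauge k (C i)" for i
    by (auto simp: D_def hausdorff_gauge_def)
  have "hausdorff_pre k \<delta> A + hausdorff_pre k \<delta> B
          \<le> (\<Sum>i. hausdorff_gauge k (D A i)) + (\<Sum>i. hausdorff_gauge k (D B i))"
    by (intro add_mono D) auto
  also have "\<dots> = (\<Sum>i. hausdorff_gauge k (D A i) + hausdorff_gauge k (D B i))"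
    by (intro suminf_add) auto
  also have "\<dots> \<le> (\<Sum>i. hausdorff_gauge k (C i))"
    by (intro suminf_le le) auto
  finally show "hausdorff_pre k \<delta> A + hausdorff_pre k \<delta> B \<le> (\<Sum>i. hausdorff_gauge k (C i))" .
qed

lemma hausdorff_pre_le_outer: "\<delta> > 0 \<Longrightarrow> hausdorff_pre k \<delta> A \<le> hausdorff_outer k A"
  unfolding hausdorff_outer_def by (rule SUP_upper) simp

lemma hausdorff_outer_separated:
  fixes A B :: "'a::metric_space set"
  assumes "e > 0" and sep: "\<And>x y. x \<in> A \<Longrightarrow> y \<in> B \<Longrightarrow> e \<le> dist x y"
  shows "hausdorff_outer k A + hausdorff_outer k B \<le> hausdorff_outer k (A \<union> B)"
proof -
  have "hausdorff_outer k A + hausdorff_outer k B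
      = (SUP \<delta>\<in>{0<..}. hausdorff_pre k \<delta> A + hausdorff_pre k \<delta> B)"
    unfolding hausdorff_outer_def
  proof (rule SUP_add_directed_ennreal[symmetric])
    fix i j :: real assume "i \<in> {0<..}" "j \<in> {0<..}"
    then show "\<exists>l\<in>{0<..}. hausdorff_pre k i A + hausdorff_pre k j B
        \<le> hausdorff_pre k l A + hausdorff_pre k l B"
      by (intro bexI[of _ "min i j"] add_mono hausdorff_pre_antimono) auto
  qed
  also have "\<dots> \<le> hausdorff_outer k (A \<union> B)"
  proof (rule SUP_least)
    fix \<delta> :: real assume "\<delta> \<in> {0<..}"
    define \<gamma> where "\<gamma> = min \<delta> (e/2)"
    have \<gamma>: "\<gamma> > 0" "\<gamma> < e" "\<gamma> \<le> \<delta>" using \<open>\<delta> \<in> _\<close> \<open>e > 0\<close> by (auto simp: \<gamma>_def)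
    have "hausdorff_pre k \<delta> A + hausdorff_pre k \<delta> B \<le> hausdorff_pre k \<gamma> A + hausdorff_pre k \<gamma> B"
      by (intro add_mono hausdorff_pre_antimono \<gamma>)
    also have "\<dots> \<le> hausdorff_pre k \<gamma> (A \<union> B)"
      by (rule hausdorff_pre_separated[OF \<gamma>(2) sep \<gamma>(1)])
    also have "\<dots> \<le> hausdorff_outer k (A \<union> B)"
      by (rule hausdorff_pre_le_outer[OF \<gamma>(1)])
    finally show "hausdorff_pre k \<delta> A + hausdorff_pre k \<delta> B \<le> hausdorff_outer k (A \<union> B)" .
  qed
  finally show ?thesis .
qed

lemma outer_measure_space_hausdorff: "outer_measure_space UNIV (hausdorff_outer k :: 'a::metric_space set \<Rightarrow> ennreal)"
    (is "outer_measure_space _ ?\<mu>")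
  unfolding outer_measure_space_def
proof (intro conjI)
  show "positive UNIV ?\<mu>"
    by (auto simp: positive_def hausdorff_outer_def hausdorff_pre_empty intro!: SUP_eq_const)
  show "increasing UNIV ?\<mu>"
    by (auto simp: increasing_def hausdorff_outer_def intro!: SUP_mono hausdorff_pre_mono)
  show "countably_subadditive UNIV ?\<mu>"
    unfolding countably_subadditive_def
  proof (intro allI impI)
    fix A :: "nat \<Rightarrow> 'a set"
    show "hausdorff_outer k (\<Union>i. A i) \<le> (\<Sum>i. hausdorff_outer k (A i))"
      unfolding hausdorff_outer_def[of k "\<Union>i. A i"]
    proof (rule SUP_least)
      fix \<delta> :: real assume "\<delta> \<in> {0<..}"
      have "hausdorff_pre k \<delta> (\<Union>i. A i) \<le> (\<Sum>i. hausdorff_pre k \<delta> (A i))"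
        by (rule hausdorff_pre_subadditive)
      also have "\<dots> \<le> (\<Sum>i. hausdorff_outer k (A i))"
        using \<open>\<delta> \<in> _\<close> by (intro suminf_le hausdorff_pre_le_outer) auto
      finally show "hausdorff_pre k \<delta> (\<Union>i. A i) \<le> (\<Sum>i. hausdorff_outer k (A i))" .
    qed
  qed
qed

lemma outer_measure_space_subadditiveD:
  assumes "outer_measure_space UNIV \<mu>"
  shows "\<mu> (\<Union>i::nat. A i) \<le> (\<Sum>i. \<mu> (A i))"
proof -
  have sub: "disjoint_family B \<Longrightarrow> \<mu> (\<Union>i. B i) \<le> (\<Sum>i. \<mu> (B i))" for B :: "nat \<Rightarrow> _"
    using assms by (auto simp: outer_measure_space_def countably_subadditive_def)
  have mono: "S \<subseteq> T \<Longrightarrow> \<mu> S \<le> \<mu> T" for S T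
    using assms by (auto simp: outer_measure_space_def increasing_def)
  have "\<mu> (\<Union>i. A i) = \<mu> (\<Union>i. disjointed A i)" by (simp add: UN_disjointed_eq)
  also have "\<dots> \<le> (\<Sum>i. \<mu> (disjointed A i))" by (rule sub[OF disjoint_family_disjointed])
  also have "\<dots> \<le> (\<Sum>i. \<mu> (A i))" by (intro suminf_le mono disjointed_subset) auto
  finally show ?thesis .
qed

lemma closed_in_lambda_system_metric:
  fixes \<mu> :: "'a::metric_space set \<Rightarrow> ennreal"
  assumes oms: "outer_measure_space UNIV \<mu>"
    and sep: "\<And>A B e. e > 0 \<Longrightarrow> (\<And>x y. x \<in> A \<Longrightarrow> y \<in> B \<Longrightarrow> e \<le> dist x y) \<Longrightarrow> \<mu> A + \<mu> B \<le> \<mu> (A \<union> B)"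
    and F: "closed F" "F \<noteq> {}"
  shows "\<mu> (X \<inter> F) + \<mu> (X - F) \<le> \<mu> X"
proof (cases "\<mu> X = top")
  case False
  have mono: "S \<subseteq> T \<Longrightarrow> \<mu> S \<le> \<mu> T" for S T
    using oms by (auto simp: outer_measure_space_def increasing_def)
  have emp: "\<mu> {} = 0"
    using oms by (auto simp: outer_measure_space_def positive_def)
  note sub = outer_measure_space_subadditiveD[OF oms]
  have sub2: "\<mu> (S \<union> T) \<le> \<mu> S + \<mu> T" for S T
  proof -
    have "\<mu> (S \<union> T) = \<mu> (\<Union>i. binaryset S T i)" by (simp add: UN_binaryset_eq)
    also have "\<dots> \<le> (\<Sum>i. \<mu> (binaryset S T i))" by (rule sub)
    also have "\<dots> = \<mu> S + \<mu> T" by (rule suminf_binaryset_eq) (rule emp)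
    finally show ?thesis .
  qed
  define R where "R n = {x\<in>X. 1 / (real n + 2) \<le> infdist x F \<and> infdist x F < 1 / (real n + 1)}" for n
  define Y where "Y n = {x\<in>X. 1 / (real n + 1) \<le> infdist x F}" for n
  have dist: "a - b \<le> dist x y" if "a \<le> infdist x F" "infdist y F \<le> b" for a b x y
    using infdist_triangle[of x F y] that by linarith
  have part: "(\<Sum>k<n. \<mu> (R (2*k+p))) \<le> \<mu> (\<Union>k<n. R (2*k+p))" for n p
  proof (induction n)
    case (Suc n)
    define e where "e = (if n = 0 then 1 else 1 / real (2*n+p) - 1 / (real (2*n+p) + 1))"
    have "e > 0" by (auto simp: e_def intro!: divide_strict_left_mono)
    have "(\<Sum>k<Suc n. \<mu> (R (2*k+p))) \<le> \<mu> (\<Union>k<n. R (2*k+p)) + \<mu> (R (2*n+p))"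
      using Suc by (simp add: add_mono)
    also have "\<dots> \<le> \<mu> ((\<Union>k<n. R (2*k+p)) \<union> R (2*n+p))"
    proof (rule sep[OF \<open>e > 0\<close>])
      fix x y assume x: "x \<in> (\<Union>k<n. R (2*k+p))" and y: "y \<in> R (2*n+p)"
      then obtain k where k: "k < n" "1 / (real (2*k+p) + 2) \<le> infdist x F" by (auto simp: R_def)
      have "1 / real (2*n+p) \<le> 1 / (real (2*k+p) + 2)"
        using k(1) by (intro divide_left_mono) auto
      moreover have "infdist y F \<le> 1 / (real (2*n+p) + 1)" using y by (simp add: R_def)
      moreover have "n \<noteq> 0" using k(1) by simp
      ultimately show "e \<le> dist x y" using k(2) by (auto simp: e_def intro!: dist)
    qed
    also have "(\<Union>k<n. R (2*k+p)) \<union> R (2*n+p) = (\<Union>k<Suc n. R (2*k+p))"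
      by (auto simp: lessThan_Suc)
    finally show ?case .
  qed simp
  have part': "(\<Sum>k<n. \<mu> (R (2*k+p))) \<le> \<mu> X" for n p
    by (rule order_trans[OF part mono]) (auto simp: R_def)
  have fin: "(\<Sum>k. \<mu> (R k)) \<le> \<mu> X + \<mu> X"
    unfolding suminf_eq_SUP
  proof (rule SUP_least)
    fix n :: nat
    have "(\<Sum>k<n. \<mu> (R k)) \<le> (\<Sum>k<2*n. \<mu> (R k))" by (intro sum_mono2) auto
    also have "\<dots> = (\<Sum>k<n. \<mu> (R (2*k+0))) + (\<Sum>k<n. \<mu> (R (2*k+1)))"
      by (induction n) (auto simp: algebra_simps)
    also have "\<dots> \<le> \<mu> X + \<mu> X" by (intro add_mono part')
    finally show "(\<Sum>k<n. \<mu> (R k)) \<le> \<mu> X + \<mu> X" .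
  qed
  have fin': "(\<Sum>k. \<mu> (R k)) \<noteq> top"
    using fin False by (auto simp: top_unique)
  have cover: "X - F \<subseteq> Y n \<union> (\<Union>k. R (k + n))" for n
  proof
    fix x assume x: "x \<in> X - F"
    define d where "d = infdist x F"
    have "d > 0" unfolding d_def using x F by (simp add: infdist_pos_not_in_closed)
    show "x \<in> Y n \<union> (\<Union>k. R (k + n))"
    proof (cases "1 / (real n + 1) \<le> d")
      case True then show ?thesis using x by (auto simp: Y_def d_def)
    next
      case False
      then have *: "1 / d > real n + 1" using \<open>d > 0\<close> by (simp add: field_simps)
      define m where "m = nat (\<lceil>1/d\<rceil> - 2)"
      have m: "real m + 1 < 1/d" "1/d \<le> real m + 2" "n \<le> m"
        using * unfolding m_def by linarith+
      have "d < 1 / (real m + 1)" "1 / (real m + 2) \<le> d"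
        using m \<open>d > 0\<close> by (auto simp: field_simps)
      then have "x \<in> R (m - n + n)" using x m(3) by (simp add: R_def d_def)
      then show ?thesis by blast
    qed
  qed
  have main: "\<mu> (X \<inter> F) + \<mu> (X - F) + (\<Sum>k<n. \<mu> (R k)) \<le> \<mu> X + (\<Sum>k. \<mu> (R k))" for n
  proof -
    have "\<mu> (X - F) \<le> \<mu> (Y n \<union> (\<Union>k. R (k + n)))" by (rule mono[OF cover])
    also have "\<dots> \<le> \<mu> (Y n) + (\<Sum>k. \<mu> (R (k + n)))"
      by (rule order_trans[OF sub2 add_left_mono[OF sub]])
    finally have 1: "\<mu> (X - F) \<le> \<mu> (Y n) + (\<Sum>k. \<mu> (R (k + n)))" .
    have "\<mu> (Y n) + \<mu> (X \<inter> F) \<le> \<mu> (Y n \<union> (X \<inter> F))"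
    proof (rule sep[of "1 / (real n + 1)"])
      fix x y assume "x \<in> Y n" "y \<in> X \<inter> F"
      then show "1 / (real n + 1) \<le> dist x y"
        using dist[of "1 / (real n + 1)" x y 0] by (auto simp: Y_def)
    qed simp
    also have "\<dots> \<le> \<mu> X" by (rule mono) (auto simp: Y_def)
    finally have 2: "\<mu> (Y n) + \<mu> (X \<inter> F) \<le> \<mu> X" .
    have 3: "(\<Sum>k. \<mu> (R k)) = (\<Sum>k. \<mu> (R (k + n))) + (\<Sum>k<n. \<mu> (R k))"
      by (rule suminf_offset) simp
    have "\<mu> (X \<inter> F) + \<mu> (X - F) + (\<Sum>k<n. \<mu> (R k))
        \<le> \<mu> (X \<inter> F) + (\<mu> (Y n) + (\<Sum>k. \<mu> (R (k + n)))) + (\<Sum>k<n. \<mu> (R k))"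
      by (intro add_mono 1) auto
    also have "\<dots> = (\<mu> (Y n) + \<mu> (X \<inter> F)) + (\<Sum>k. \<mu> (R k))"
      unfolding 3 by (simp add: ac_simps)
    also have "\<dots> \<le> \<mu> X + (\<Sum>k. \<mu> (R k))" by (intro add_mono 2) auto
    finally show ?thesis .
  qed
  have "\<mu> (X \<inter> F) + \<mu> (X - F) + (\<Sum>k. \<mu> (R k))
      = (SUP n. \<mu> (X \<inter> F) + \<mu> (X - F) + (\<Sum>k<n. \<mu> (R k)))"
    unfolding suminf_eq_SUP by (rule ennreal_SUP_add_right) simp
  also have "\<dots> \<le> \<mu> X + (\<Sum>k. \<mu> (R k))" by (rule SUP_least) (rule main)
  finally show ?thesis
    using fin' ennreal_add_left_cancel_le[of "\<Sum>k. \<mu> (R k)" "\<mu> (X \<inter> F) + \<mu> (X - F)" "\<mu> X"]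
    by (simp add: add.commute)
qed simp

lemma borel_subset_lambda_system_metric:
  fixes \<mu> :: "'a::metric_space set \<Rightarrow> ennreal"
  assumes oms: "outer_measure_space UNIV \<mu>"
    and sep: "\<And>A B e. e > 0 \<Longrightarrow> (\<And>x y. x \<in> A \<Longrightarrow> y \<in> B \<Longrightarrow> e \<le> dist x y) \<Longrightarrow> \<mu> A + \<mu> B \<le> \<mu> (A \<union> B)"
  shows "sets borel \<subseteq> lambda_system UNIV UNIV \<mu>"
proof -
  have SA: "sigma_algebra UNIV (UNIV :: 'a set set)"
    using sigma_algebra_Pow[of "UNIV::'a set"] by simp
  have sa: "sigma_algebra UNIV (lambda_system UNIV UNIV \<mu>)"
    using sigma_algebra.caratheodory_lemma[OF SA oms] by (simp add: measure_space_def)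
  have emp: "\<mu> {} = 0"
    using oms by (auto simp: outer_measure_space_def positive_def)
  have "F \<in> lambda_system UNIV UNIV \<mu>" if "closed F" for F
  proof -
    have "\<mu> (F \<inter> X) + \<mu> ((UNIV - F) \<inter> X) = \<mu> X" for X
    proof (rule antisym)
      have eq: "F \<inter> X = X \<inter> F" "(UNIV - F) \<inter> X = X - F" by auto
      show "\<mu> (F \<inter> X) + \<mu> ((UNIV - F) \<inter> X) \<le> \<mu> X"
      proof (cases "F = {}")
        case True then show ?thesis by (simp add: emp)
      next
        case False show ?thesis
          unfolding eq by (rule closed_in_lambda_system_metric[OF oms sep that False])
      qed
      have "\<mu> X = \<mu> (\<Union>i. binaryset (X \<inter> F) (X - F) i)"
        by (simp add: UN_binaryset_eq Int_Diff_Un)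
      also have "\<dots> \<le> (\<Sum>i. \<mu> (binaryset (X \<inter> F) (X - F) i))"
        by (rule outer_measure_space_subadditiveD[OF oms])
      also have "\<dots> = \<mu> (X \<inter> F) + \<mu> (X - F)" by (rule suminf_binaryset_eq) (rule emp)
      finally show "\<mu> X \<le> \<mu> (F \<inter> X) + \<mu> ((UNIV - F) \<inter> X)" unfolding eq .
    qed
    then show ?thesis by (simp add: lambda_system_def)
  qed
  then have "Collect closed \<subseteq> lambda_system UNIV UNIV \<mu>" by blast
  from sigma_algebra.sigma_sets_subset[OF sa this] show ?thesis
    unfolding borel_eq_closed by simp
qed

lemma measure_space_hausdorff:
  "measure_space UNIV (sets borel) (hausdorff_outer k :: 'a::metric_space set \<Rightarrow> ennreal)"
proof (rule measure_down)
  have SA: "sigma_algebra UNIV (UNIV :: 'a set set)"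
    using sigma_algebra_Pow[of "UNIV::'a set"] by simp
  show "measure_space UNIV (lambda_system UNIV UNIV (hausdorff_outer k))
      (hausdorff_outer k :: 'a set \<Rightarrow> ennreal)"
    by (rule sigma_algebra.caratheodory_lemma[OF SA outer_measure_space_hausdorff])
  show "sigma_algebra UNIV (sets (borel :: 'a measure))"
    using sets.sigma_algebra_axioms[of "borel :: 'a measure"] by simp
  show "sets borel \<subseteq> lambda_system UNIV UNIV (hausdorff_outer k :: 'a set \<Rightarrow> ennreal)"
    by (rule borel_subset_lambda_system_metric[OF outer_measure_space_hausdorff])
      (rule hausdorff_outer_separated)
qed

lemma sets_hausdorff_measure [simp, measurable_cong]: "sets (hausdorff_measure k) = sets borel"
  unfolding hausdorff_measure_def by (metis sets.sets_measure_of_eq space_borel)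

lemma space_hausdorff_measure [simp]: "space (hausdorff_measure k) = UNIV"
  by (simp add: hausdorff_measure_def space_measure_of_conv)

theorem emeasure_hausdorff_measure:
  fixes A :: "'a::metric_space set"
  assumes "A \<in> sets borel"
  shows "emeasure (hausdorff_measure k) A = hausdorff_outer k A"
  unfolding hausdorff_measure_def
proof (rule emeasure_measure_of_sigma)
  show "sigma_algebra UNIV (sets (borel :: 'a measure))"
    using sets.sigma_algebra_axioms[of "borel :: 'a measure"] by simp
  show "positive (sets borel) (hausdorff_outer k :: 'a set \<Rightarrow> ennreal)"
    "countably_additive (sets borel) (hausdorff_outer k :: 'a set \<Rightarrow> ennreal)"
    using measure_space_hausdorff[of k, where ?'a = 'a] by (auto simp: measure_space_def)
qed (rule assms)


section \<open>Unconditional convex bodies and functions\<close>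

definition coord_reflect :: "'n \<Rightarrow> real^'n \<Rightarrow> real^'n" where
  "coord_reflect i x = (\<chi> j. if j = i then - x $ j else x $ j)"

definition uncond_bodies :: "(real^'n::finite) set set" where
  "uncond_bodies = {K. compact K \<and> convex K \<and> 0 \<in> interior K \<and> (\<forall>i. coord_reflect i ` K = K)}"

text \<open>
  Derivatives are taken within \<open>S\<close>. On an open set this is the usual derivative. At a boundary
  point of a convex body \<open>K\<close> a derivative within \<open>K\<close> is still unique (the directions \<open>y - x\<close> with
  \<open>y \<in> K\<close> span), so that \<open>C1_on K u\<close> says that \<open>u\<close> is continuously differentiable up to the
  boundary; equivalently, \<open>u\<close> is continuous on \<open>K\<close>, \<open>C\<^sup>1\<close> on \<open>interior K\<close>, and its
  gradient extends continuously to \<open>K\<close>.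
\<close>

definition partial_within :: "(real^'n::finite) set \<Rightarrow> 'n \<Rightarrow> (real^'n \<Rightarrow> real) \<Rightarrow> real^'n \<Rightarrow> real" where
  "partial_within S i u x = frechet_derivative u (at x within S) (axis i 1)"

definition C1_on :: "(real^'n::finite) set \<Rightarrow> (real^'n \<Rightarrow> real) \<Rightarrow> bool" where
  "C1_on S u \<longleftrightarrow> u differentiable_on S \<and> (\<forall>i. continuous_on S (partial_within S i u))"

definition C2_on :: "(real^'n::finite) set \<Rightarrow> (real^'n \<Rightarrow> real) \<Rightarrow> bool" where
  "C2_on S u \<longleftrightarrow> C1_on S u \<and> (\<forall>i. C1_on S (partial_within S i u))"

text \<open>Functions on \<open>K\<close> are total functions of which only the values on \<open>K\<close> matter.\<close>

definition S0 :: "(real^'n::finite) set \<Rightarrow> (real^'n \<Rightarrow> real) set" where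
  "S0 K = {u. C2_on (interior K) u \<and> C1_on K u}"

definition S0_uncond :: "(real^'n::finite) set \<Rightarrow> (real^'n \<Rightarrow> real) set" where
  "S0_uncond K = {u \<in> S0 K. \<forall>i. \<forall>x\<in>K. u (coord_reflect i x) = u x}"

definition grad_within :: "(real^'n::finite) set \<Rightarrow> (real^'n \<Rightarrow> real) \<Rightarrow> real^'n \<Rightarrow> real^'n" where
  "grad_within S u x = (\<chi> i. partial_within S i u x)"

text \<open>
  The norm of \<^typ>\<open>real^'n^'n\<close> is the Euclidean norm of the vector of all entries, i.e. the
  Hilbert-Schmidt norm.
\<close>

definition hessian_within :: "(real^'n::finite) set \<Rightarrow> (real^'n \<Rightarrow> real) \<Rightarrow> real^'n \<Rightarrow> real^'n^'n" where
  "hessian_within S u x = (\<chi> i j. partial_within S i (partial_within S j u) x)"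

text \<open>
  The unit outer normal exists uniquely almost everywhere on the boundary; the value at the
  remaining points does not matter and is chosen so that the integrand below is Borel measurable.
\<close>

definition is_outer_unit_normal :: "'a::real_inner set \<Rightarrow> 'a \<Rightarrow> 'a \<Rightarrow> bool" where
  "is_outer_unit_normal K x v \<longleftrightarrow> norm v = 1 \<and> (\<forall>y\<in>K. inner (y - x) v \<le> 0)"

definition outer_unit_normal :: "'a::real_inner set \<Rightarrow> 'a \<Rightarrow> 'a" where
  "outer_unit_normal K x =
     (if \<exists>!v. is_outer_unit_normal K x v then THE v. is_outer_unit_normal K x v else 0)"

definition normal_deriv :: "(real^'n::finite) set \<Rightarrow> (real^'n \<Rightarrow> real) \<Rightarrow> real^'n \<Rightarrow> real" where
  "normal_deriv K u x = inner (grad_within K u x) (outer_unit_normal K x)"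

text \<open>
  All integrals are of nonnegative functions and take values in \<^typ>\<open>ennreal\<close>: those over the body
  may be infinite, since the second derivatives of \<open>u\<close> need not be bounded near the boundary. The
  integrals over \<open>K\<close> are written over \<open>interior K\<close>, where the second derivatives exist; the
  boundary of a convex body is a Lebesgue null set.
\<close>

definition boundary_integral :: "(real^'n::finite) set \<Rightarrow> (real^'n \<Rightarrow> real) \<Rightarrow> ennreal" where
  "boundary_integral K u =
     (\<integral>\<^sup>+ x \<in> frontier K.
        ennreal ((normal_deriv K u x)\<^sup>2 / inner x (outer_unit_normal K x))
      \<partial>hausdorff_measure (CARD('n) - 1))"

definition diag_hessian_integral :: "(real^'n::finite) set \<Rightarrow> (real^'n \<Rightarrow> real) \<Rightarrow> ennreal" where
  "diag_hessian_integral K u =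
     (\<integral>\<^sup>+ x \<in> interior K.
        ennreal (\<Sum>i\<in>UNIV. (hessian_within (interior K) u x $ i $ i)\<^sup>2) \<partial>lborel)"

definition hessian_integral :: "(real^'n::finite) set \<Rightarrow> (real^'n \<Rightarrow> real) \<Rightarrow> ennreal" where
  "hessian_integral K u =
     (\<integral>\<^sup>+ x \<in> interior K.
        ennreal ((norm (hessian_within (interior K) u x))\<^sup>2) \<partial>lborel)"

definition B_uncond :: "(real^'n::finite) set \<Rightarrow> ennreal" where
  "B_uncond K = Inf {B. \<forall>u\<in>S0_uncond K. boundary_integral K u \<le> B * hessian_integral K u}"

end

theory Submission
  imports Defs
begin

text \<open>
  Write \<open>n\<close> for the dimension, \<open>u\<^sub>i\<close> for the partial derivatives of \<open>u\<close>, \<open>\<nu>\<close> for the outer normal and \<open>H\<close> for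
  the Hausdorff measure of dimension \<open>n - 1\<close>.

  At a boundary point of an unconditional body every product \<open>x\<^sub>i \<nu>\<^sub>i\<close> is
  nonnegative, because the reflected point also lies in \<open>K\<close>, and these products add up to
  \<open>\<langle>x, \<nu>\<rangle>\<close>. As \<open>u\<^sub>i\<close> vanishes where \<open>x\<^sub>i\<close> does, the Cauchy-Schwarz inequality gives
  \<open>(\<Sum> u\<^sub>i \<nu>\<^sub>i)\<^sup>2 / \<langle>x, \<nu>\<rangle> \<le> \<Sum> (u\<^sub>i\<^sup>2 / \<bar>x\<^sub>i\<bar>) \<bar>\<nu>\<^sub>i\<bar>\<close> (\<open>normal_deriv_bound\<close>). The weight
  \<open>\<bar>\<nu>\<^sub>i\<bar>\<close> is the Jacobian of the projection of the boundary along the \<open>i\<close>-th axis, so the integral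
  of the \<open>i\<close>-th term is an integral over the projection of \<open>K\<close>, in which each line parallel to the axis
  contributes the values at the two points where it leaves \<open>K\<close> (\<open>boundary_projection_formula\<close>).
  On such a line \<open>u\<^sub>i\<close> vanishes in the middle, and \<open>\<phi> h\<^sup>2 / h\<close> is at most the integral of \<open>\<phi>'\<^sup>2\<close>
  over \<open>[0, h]\<close> if \<open>\<phi> 0 = 0\<close> (\<open>square_le_derivative_integral\<close>). Integrating over all lines
  gives the integral of \<open>u\<^sub>i\<^sub>i\<^sup>2\<close> (\<open>projected_partial_bound\<close>).

  The constant \<open>1\<close> is attained: for \<open>u = \<bar>x\<bar>\<^sup>2 / 2\<close> the first and the last integral are \<open>n\<close> times the volume of \<open>K\<close>, by the same
  projection formula.

  The projection formula is the geometric part. Let \<open>e\<close> be a direction, and compare the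
  Hausdorff measure of a piece \<open>C\<close> of the boundary with the volume of its sweep \<open>C + [0, 1] e\<close>. If every
  point of \<open>C\<close> has an outer normal within \<open>\<epsilon>\<close> of a unit vector \<open>v\<close>, then convexity alone forces
  \<open>\<bar>\<langle>x - y, v\<rangle>\<bar> \<le> \<epsilon> \<bar>x - y\<bar>\<close> on \<open>C\<close> (\<open>touching_flat\<close>). Hence the projection along \<open>e\<close> to the
  hyperplane orthogonal to \<open>v\<close> is nearly an isometry on \<open>C\<close>, and the volume of the sweep is
  \<open>\<langle>e, v\<rangle> H C\<close> up to a factor near \<open>1\<close> (\<open>sweep_flat_bounds\<close>). Two consequences follow.
  First, a piece whose points all have normals near two different vectors must be null, as the two
  estimates contradict each other for a suitable \<open>e\<close>; so the normal is unique almost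
  everywhere (\<open>top_measure_not_smooth\<close>). Second, cutting the boundary into countably many nearly flat
  pieces identifies \<open>\<nu>\<^sub>i H\<close> with the measure of the projection (\<open>facing_measure_eq_top_measure\<close>).

  The constants are right because \<open>H\<close> is exactly Lebesgue measure on a hyperplane
  (\<open>hausdorff_eq_hyperplane\<close>). One inequality is the isodiametric inequality, proved by Steiner
  symmetrisation. For the other, translation invariance makes \<open>H\<close> a multiple of Lebesgue measure,
  and the multiple is at most \<open>1\<close> because small balls, whose cost in the definition of \<open>H\<close> is just
  their Lebesgue measure, fill a fixed proportion of a cube.
\<close>

section \<open>Hausdorff measure under Lipschitz maps\<close>

lemma diameter_leI:
  fixes S :: "'a::metric_space set"
  assumes "0 \<le> d" "\<And>x y. x \<in> S \<Longrightarrow> y \<in> S \<Longrightarrow> dist x y \<le> d"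
  shows "diameter S \<le> d"
  using assms by (auto simp: diameter_def intro!: cSUP_least)

lemma hausdorff_gauge_le_pre:
  "bounded C \<Longrightarrow> diameter C \<le> \<delta> \<Longrightarrow> 0 < \<delta> \<Longrightarrow> hausdorff_pre k \<delta> C \<le> hausdorff_gauge k C"
proof -
  assume C: "bounded C" "diameter C \<le> \<delta>" "0 < \<delta>"
  have "hausdorff_pre k \<delta> C \<le> (\<Sum>i. hausdorff_gauge k (if i = (0::nat) then C else {}))"
    by (rule hausdorff_pre_le) (use C in auto)
  also have "\<dots> = hausdorff_gauge k C"
    by (subst suminf_finite[of "{0}"]) (auto simp: hausdorff_gauge_def)
  finally show ?thesis .
qed

lemma hausdorff_pre_Un: 
  assumes "0 < \<delta>"
  shows "hausdorff_pre k \<delta> (A \<union> B) \<le> hausdorff_pre k \<delta> A + hausdorff_pre k \<delta> B"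
proof -
  have "hausdorff_pre k \<delta> (A \<union> B) = hausdorff_pre k \<delta> (\<Union>i. binaryset A B i)"
    by (simp add: UN_binaryset_eq)
  also have "\<dots> \<le> (\<Sum>i. hausdorff_pre k \<delta> (binaryset A B i))" by (rule hausdorff_pre_subadditive)
  also have "\<dots> = hausdorff_pre k \<delta> A + hausdorff_pre k \<delta> B"
    by (rule suminf_binaryset_eq) (rule hausdorff_pre_empty[OF assms])
  finally show ?thesis .
qed

lemma hausdorff_pre_UN_finite:
  assumes "0 < \<delta>" "finite I"
  shows "hausdorff_pre k \<delta> (\<Union>i\<in>I. C i) \<le> (\<Sum>i\<in>I. hausdorff_pre k \<delta> (C i))"
  using assms(2)
proof (induction I)
  case (insert i I)
  have "hausdorff_pre k \<delta> (\<Union>i\<in>insert i I. C i)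
      \<le> hausdorff_pre k \<delta> (C i) + hausdorff_pre k \<delta> (\<Union>i\<in>I. C i)"
    using hausdorff_pre_Un[OF assms(1)] by simp
  also have "\<dots> \<le> hausdorff_pre k \<delta> (C i) + (\<Sum>i\<in>I. hausdorff_pre k \<delta> (C i))"
    by (intro add_left_mono insert.IH)
  finally show ?case using insert by simp
qed (simp add: hausdorff_pre_empty assms(1))

lemma hausdorff_outer_mono: "A \<subseteq> B \<Longrightarrow> hausdorff_outer k A \<le> hausdorff_outer k B"
  unfolding hausdorff_outer_def by (intro SUP_mono) (auto intro!: hausdorff_pre_mono)

lemma hausdorff_outer_leI:
  assumes "\<And>\<delta>. 0 < \<delta> \<Longrightarrow> hausdorff_pre k \<delta> A \<le> c"
  shows "hausdorff_outer k A \<le> c"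
  unfolding hausdorff_outer_def by (rule SUP_least) (use assms in auto)

lemma hausdorff_gauge_lipschitz:
  fixes f :: "'a::metric_space \<Rightarrow> 'b::metric_space"
  assumes "0 < L" and f: "\<And>x y. x \<in> C \<Longrightarrow> y \<in> C \<Longrightarrow> dist (f x) (f y) \<le> L * dist x y"
    and C: "C \<subseteq> D" "bounded D"
  shows "bounded (f ` C)" "diameter (f ` C) \<le> L * diameter D"
    "hausdorff_gauge k (f ` C) \<le> ennreal (L ^ k) * hausdorff_gauge k D"
proof -
  have le: "dist (f x) (f y) \<le> L * diameter D" if "x \<in> C" "y \<in> C" for x y
  proof -
    have "dist x y \<le> diameter D" using diameter_bounded_bound[OF C(2)] that C(1) by blast
    then show ?thesis using f[OF that] \<open>0 < L\<close> by (meson mult_left_mono less_imp_le order_trans)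
  qed
  show b: "bounded (f ` C)" unfolding bounded_two_points using le by blast
  have d0: "0 \<le> diameter D" by (simp add: C(2) diameter_ge_0)
  show d: "diameter (f ` C) \<le> L * diameter D"
    using le d0 \<open>0 < L\<close> by (intro diameter_leI) auto
  show "hausdorff_gauge k (f ` C) \<le> ennreal (L ^ k) * hausdorff_gauge k D"
  proof (cases "C = {}")
    case False
    have u: "0 \<le> unit_ball_vol (real k)" by (simp add: unit_ball_vol_nonneg)
    have "(diameter (f ` C) / 2) ^ k \<le> (L * diameter D / 2) ^ k"
      using d b by (intro power_mono) (auto simp: diameter_ge_0)
    then have "unit_ball_vol (real k) * (diameter (f ` C) / 2) ^ k
        \<le> unit_ball_vol (real k) * (L * diameter D / 2) ^ k"
      by (rule mult_left_mono[OF _ u])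
    also have "\<dots> = L ^ k * (unit_ball_vol (real k) * (diameter D / 2) ^ k)"
      by (simp add: power_mult_distrib power_divide)
    finally have "unit_ball_vol (real k) * (diameter (f ` C) / 2) ^ k
        \<le> L ^ k * (unit_ball_vol (real k) * (diameter D / 2) ^ k)" .
    moreover have "D \<noteq> {}" using False C by auto
    ultimately show ?thesis
      using False \<open>0 < L\<close> d0 u by (auto simp: hausdorff_gauge_def ennreal_mult'[symmetric] intro!: ennreal_leI)
  qed (auto simp: hausdorff_gauge_def)
qed

lemma hausdorff_outer_lipschitz_image:
  fixes f :: "'a::metric_space \<Rightarrow> 'b::metric_space"
  assumes "0 < L" and f: "\<And>x y. x \<in> A \<Longrightarrow> y \<in> A \<Longrightarrow> dist (f x) (f y) \<le> L * dist x y"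
  shows "hausdorff_outer k (f ` A) \<le> ennreal (L ^ k) * hausdorff_outer k A"
proof (rule hausdorff_outer_leI)
  fix \<delta> :: real assume "0 < \<delta>"
  have "hausdorff_pre k \<delta> (f ` A) / ennreal (L ^ k) \<le> hausdorff_pre k (\<delta> / L) A"
    unfolding hausdorff_pre_def[of k "\<delta> / L"]
  proof (rule INF_greatest, clarify)
    fix C :: "nat \<Rightarrow> 'a set"
    assume C: "A \<subseteq> (\<Union>i. C i)" "\<forall>i. bounded (C i) \<and> diameter (C i) \<le> \<delta> / L"
    have gauge: "bounded (f ` (C i \<inter> A))" "diameter (f ` (C i \<inter> A)) \<le> L * diameter (C i)"
      "hausdorff_gauge k (f ` (C i \<inter> A)) \<le> ennreal (L ^ k) * hausdorff_gauge k (C i)" for i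
      using \<open>0 < L\<close> f C(2)
      by (auto intro!: hausdorff_gauge_lipschitz[where f=f and L=L and D="C i" and C="C i \<inter> A"])
    have diam: "diameter (f ` (C i \<inter> A)) \<le> \<delta>" for i
    proof -
      have "L * diameter (C i) \<le> \<delta>" using C(2) \<open>0 < L\<close> by (simp add: field_simps)
      then show ?thesis using gauge(2)[of i] by linarith
    qed
    have "hausdorff_pre k \<delta> (f ` A) \<le> (\<Sum>i. hausdorff_gauge k (f ` (C i \<inter> A)))"
    proof (rule hausdorff_pre_le)
      show "f ` A \<subseteq> (\<Union>i. f ` (C i \<inter> A))" using C(1) by blast
    qed (use gauge(1) diam in auto)
    also have "\<dots> \<le> (\<Sum>i. ennreal (L ^ k) * hausdorff_gauge k (C i))"
      by (intro suminf_le gauge) auto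
    also have "\<dots> = ennreal (L ^ k) * (\<Sum>i. hausdorff_gauge k (C i))" by simp
    finally show "hausdorff_pre k \<delta> (f ` A) / ennreal (L ^ k) \<le> (\<Sum>i. hausdorff_gauge k (C i))"
      using \<open>0 < L\<close> by (auto intro!: divide_le_posI_ennreal simp: mult.commute)
  qed
  also have "\<dots> \<le> hausdorff_outer k A"
    by (rule hausdorff_pre_le_outer) (use \<open>0 < \<delta>\<close> \<open>0 < L\<close> in auto)
  finally have "hausdorff_pre k \<delta> (f ` A) / ennreal (L ^ k) * ennreal (L ^ k)
      \<le> hausdorff_outer k A * ennreal (L ^ k)" by (rule mult_right_mono) simp
  then show "hausdorff_pre k \<delta> (f ` A) \<le> ennreal (L ^ k) * hausdorff_outer k A"
    using \<open>0 < L\<close>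
    by (simp add: ennreal_divide_times mult.commute[of _ "hausdorff_outer k A"]
        ennreal_mult_divide_eq)
qed

lemma hausdorff_outer_isometry:
  fixes f :: "'a::metric_space \<Rightarrow> 'b::metric_space"
  assumes f: "\<And>x y. x \<in> A \<Longrightarrow> y \<in> A \<Longrightarrow> dist (f x) (f y) = dist x y"
  shows "hausdorff_outer k (f ` A) = hausdorff_outer k A"
proof (rule antisym)
  show "hausdorff_outer k (f ` A) \<le> hausdorff_outer k A"
    using hausdorff_outer_lipschitz_image[where L=1 and A=A and f=f and k=k] f by simp
  have inj: "inj_on f A" using f by (metis dist_eq_0_iff inj_onI)
  have lip: "dist (inv_into A f x) (inv_into A f y) \<le> dist x y" if "x \<in> f ` A" "y \<in> f ` A" for x y
    using that f inj by auto
  have "hausdorff_outer k (inv_into A f ` (f ` A)) \<le> hausdorff_outer k (f ` A)"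
    using hausdorff_outer_lipschitz_image[where L=1 and A="f ` A" and f="inv_into A f" and k=k]
    by (simp add: lip)
  then show "hausdorff_outer k A \<le> hausdorff_outer k (f ` A)"
    using inj by (simp add: image_image)
qed

section \<open>The isodiametric inequality\<close>

text \<open>
  Steiner symmetrisation in the \<open>j\<close>-th coordinate: each line in that direction keeps the length of
  its intersection with \<open>E\<close>, rearranged as an open interval centred at \<open>0\<close>. Openness leaves out the lines on
  which \<open>E\<close> has length \<open>0\<close>, so every remaining line meets \<open>E\<close>.
\<close>

definition steiner :: "'i \<Rightarrow> 'i set \<Rightarrow> ('i \<Rightarrow> real) set \<Rightarrow> ('i \<Rightarrow> real) set" where
  "steiner j J E = {f \<in> space (\<Pi>\<^sub>M _\<in>J. lborel).
     ennreal (2 * \<bar>f j\<bar>) < emeasure lborel {t. f(j := t) \<in> E}}"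

lemma emeasure_centred_interval: "emeasure lborel {t::real. ennreal (2 * \<bar>t\<bar>) < L} = L"
proof (cases L)
  case (real r)
  have "{t::real. ennreal (2 * \<bar>t\<bar>) < L} = {- r / 2 <..< r / 2}"
    using real by (auto simp: ennreal_less_iff)
  then show ?thesis using real by simp
next
  case top
  then show ?thesis by (simp add: emeasure_lborel_UNIV)
qed

lemma steiner_fibre_measurable:
  fixes E :: "('i \<Rightarrow> real) set"
  assumes "j \<in> J" "E \<in> sets (\<Pi>\<^sub>M _\<in>J. lborel)"
  shows "(\<lambda>f. emeasure lborel {t. f(j := t) \<in> E}) \<in> borel_measurable (\<Pi>\<^sub>M _\<in>J. lborel)"
proof -
  let ?P = "\<Pi>\<^sub>M _\<in>J. (lborel :: real measure)"
  have "insert j J = J" using assms(1) by auto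
  then have m: "(\<lambda>(f, t). f(j := t)) \<in> ?P \<Otimes>\<^sub>M lborel \<rightarrow>\<^sub>M ?P"
    using measurable_add_dim[of j J "\<lambda>_. lborel"] by simp
  have Q: "(\<lambda>(f, t). f(j := t)) -` E \<inter> space (?P \<Otimes>\<^sub>M (lborel :: real measure)) \<in> sets (?P \<Otimes>\<^sub>M lborel)" (is "?Q \<in> _")
    by (rule measurable_sets[OF m assms(2)])
  have "(\<lambda>f. emeasure lborel (Pair f -` ?Q)) \<in> borel_measurable ?P"
    by (rule lborel.measurable_emeasure_Pair[OF Q])
  then show ?thesis
    by (rule measurable_cong[THEN iffD1, rotated]) (auto simp: space_pair_measure intro!: arg_cong[where f="emeasure lborel"])
qed

lemma steiner_sets:
  assumes "j \<in> J" "E \<in> sets (\<Pi>\<^sub>M _\<in>J. lborel)"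
  shows "steiner j J E \<in> sets (\<Pi>\<^sub>M _\<in>J. lborel)"
proof -
  note [measurable] = steiner_fibre_measurable[OF assms]
  have [measurable]: "(\<lambda>f. f j) \<in> borel_measurable (\<Pi>\<^sub>M _\<in>J. lborel)"
    using measurable_component_singleton[OF assms(1), of "\<lambda>_. lborel"] by simp
  show ?thesis unfolding steiner_def by measurable
qed

lemma emeasure_PiM_fibres:
  fixes E :: "('a \<Rightarrow> real) set"
  assumes "finite J" "j \<in> J" "E \<in> sets (\<Pi>\<^sub>M _\<in>J. lborel)"
  shows "emeasure (\<Pi>\<^sub>M _\<in>J. lborel) E
    = (\<integral>\<^sup>+ x. emeasure lborel {t. x(j := t) \<in> E} \<partial>(\<Pi>\<^sub>M _\<in>J - {j}. lborel :: real measure))"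
proof -
  interpret product_sigma_finite "\<lambda>_::'a. lborel :: real measure" by standard
  have J: "insert j (J - {j}) = J" using assms(2) by auto
  have "emeasure (\<Pi>\<^sub>M _\<in>J. lborel) E = (\<integral>\<^sup>+ x. indicator E x \<partial>(\<Pi>\<^sub>M _\<in>insert j (J - {j}). lborel))"
    using assms J by simp
  also have "\<dots> = (\<integral>\<^sup>+ x. (\<integral>\<^sup>+ t. indicator E (x(j := t)) \<partial>lborel) \<partial>(\<Pi>\<^sub>M _\<in>J - {j}. lborel))"
    by (subst product_nn_integral_insert) (use assms J in auto)
  also have "\<dots> = (\<integral>\<^sup>+ x. emeasure lborel {t. x(j := t) \<in> E} \<partial>(\<Pi>\<^sub>M _\<in>J - {j}. lborel))"
  proof (rule nn_integral_cong)
    fix x :: "'a \<Rightarrow> real" assume "x \<in> space (\<Pi>\<^sub>M _\<in>J - {j}. lborel)"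
    then have "(\<lambda>t. x(j := t)) \<in> lborel \<rightarrow>\<^sub>M (\<Pi>\<^sub>M _\<in>J. lborel)"
      using measurable_component_update[of x "J - {j}" "\<lambda>_. lborel" j] J by simp
    then have "(\<lambda>t. x(j := t)) -` E \<inter> space lborel \<in> sets lborel"
      by (rule measurable_sets) (rule assms(3))
    then have "{t. x(j := t) \<in> E} \<in> sets lborel" by (simp add: vimage_def)
    then show "(\<integral>\<^sup>+ t. indicator E (x(j := t)) \<partial>lborel) = emeasure lborel {t. x(j := t) \<in> E}"
      by (subst nn_integral_indicator[symmetric]) (auto simp: indicator_def intro!: nn_integral_cong simp del: nn_integral_indicator)
  qed
  finally show ?thesis .
qed

lemma emeasure_steiner:
  assumes "finite J" "j \<in> J" "E \<in> sets (\<Pi>\<^sub>M _\<in>J. lborel)"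
  shows "emeasure (\<Pi>\<^sub>M _\<in>J. lborel) (steiner j J E) = emeasure (\<Pi>\<^sub>M _\<in>J. lborel) E"
proof -
  have J: "insert j (J - {j}) = J" using assms(2) by auto
  have "emeasure lborel {t. x(j := t) \<in> steiner j J E} = emeasure lborel {t. x(j := t) \<in> E}"
    if "x \<in> space (\<Pi>\<^sub>M _\<in>J - {j}. lborel)" for x :: "'a \<Rightarrow> real"
  proof -
    have "x(j := t) \<in> space (\<Pi>\<^sub>M _\<in>J. lborel)" for t :: real
      using that assms(2) by (auto simp: space_PiM PiE_def extensional_def)
    then have "{t. x(j := t) \<in> steiner j J E}
        = {t. ennreal (2 * \<bar>t\<bar>) < emeasure lborel {t. x(j := t) \<in> E}}"
      by (simp add: steiner_def)
    then show ?thesis by (simp add: emeasure_centred_interval)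
  qed
  then show ?thesis
    by (simp add: emeasure_PiM_fibres[OF assms] emeasure_PiM_fibres[OF assms(1,2) steiner_sets[OF assms(2,3)]]
        cong: nn_integral_cong)
qed

text \<open>
  The top of each set is at most \<open>D\<close> above the bottom of the other; adding the two estimates bounds
  the sum of the lengths of the enclosing intervals.
\<close>

lemma emeasure_sum_le_of_mutual_dist:
  fixes A B :: "real set"
  assumes ne: "A \<noteq> {}" "B \<noteq> {}" and D: "\<And>s t. s \<in> A \<Longrightarrow> t \<in> B \<Longrightarrow> \<bar>s - t\<bar> \<le> D"
  shows "emeasure lborel A + emeasure lborel B \<le> ennreal (2 * D)"
proof -
  obtain a b where ab: "a \<in> A" "b \<in> B" using ne by auto
  have bA: "bdd_above A" "bdd_below A"
    using D ab(2) by (force intro!: bdd_aboveI[of _ "b + D"] bdd_belowI[of _ "b - D"])+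
  have bB: "bdd_above B" "bdd_below B"
    using D ab(1) by (force intro!: bdd_aboveI[of _ "a + D"] bdd_belowI[of _ "a - D"])+
  have A: "A \<subseteq> {Inf A..Sup A}" using bA by (auto intro: cInf_lower cSup_upper)
  have B: "B \<subseteq> {Inf B..Sup B}" using bB by (auto intro: cInf_lower cSup_upper)
  have iA: "Inf A \<le> Sup A" and iB: "Inf B \<le> Sup B" using A B ab by force+
  have "Sup A \<le> Inf B + D"
  proof (rule cSup_least[OF ne(1)])
    fix s assume "s \<in> A"
    then have "s - D \<le> Inf B" by (intro cInf_greatest ne) (use D in force)
    then show "s \<le> Inf B + D" by simp
  qed
  moreover have "Sup B \<le> Inf A + D"
  proof (rule cSup_least[OF ne(2)])
    fix s assume "s \<in> B"
    then have "s - D \<le> Inf A" by (intro cInf_greatest ne) (use D in force)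
    then show "s \<le> Inf A + D" by simp
  qed
  ultimately have le: "(Sup A - Inf A) + (Sup B - Inf B) \<le> 2 * D" by linarith
  have "emeasure lborel A \<le> ennreal (Sup A - Inf A)"
    using emeasure_mono[OF A, of lborel] iA by simp
  moreover have "emeasure lborel B \<le> ennreal (Sup B - Inf B)"
    using emeasure_mono[OF B, of lborel] iB by simp
  ultimately have "emeasure lborel A + emeasure lborel B \<le> ennreal ((Sup A - Inf A) + (Sup B - Inf B))"
    using iA iB by (subst ennreal_plus) (auto intro: add_mono)
  also have "\<dots> \<le> ennreal (2 * D)" by (rule ennreal_leI[OF le])
  finally show ?thesis .
qed

text \<open>
  Two points of the symmetrised set are, in the \<open>j\<close>-th coordinate, at most half the sum of their fibre
  lengths apart. By the previous lemma some pair of points of the two original fibres is at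
  least as far apart, and the other coordinates are unchanged.
\<close>

lemma steiner_diameter:
  assumes J: "finite J" "j \<in> J" and "0 \<le> d"
    and d: "\<And>f g. f \<in> E \<Longrightarrow> g \<in> E \<Longrightarrow> (\<Sum>i\<in>J. (f i - g i)\<^sup>2) \<le> d\<^sup>2"
    and f: "f \<in> steiner j J E" and g: "g \<in> steiner j J E"
  shows "(\<Sum>i\<in>J. (f i - g i)\<^sup>2) \<le> d\<^sup>2"
proof -
  define A B where "A = {t. f(j := t) \<in> E}" and "B = {t. g(j := t) \<in> E}"
  have fA: "ennreal (2 * \<bar>f j\<bar>) < emeasure lborel A" and gB: "ennreal (2 * \<bar>g j\<bar>) < emeasure lborel B"
    using f g by (simp_all add: steiner_def A_def B_def)
  then have ne: "A \<noteq> {}" "B \<noteq> {}" by auto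
  define r where "r = (\<Sum>i\<in>J - {j}. (f i - g i)\<^sup>2)"
  have split: "(\<Sum>i\<in>J. (f i - g i)\<^sup>2) = (f j - g j)\<^sup>2 + r"
    unfolding r_def using J by (simp add: sum.remove)
  have st: "(s - t)\<^sup>2 + r \<le> d\<^sup>2" if "s \<in> A" "t \<in> B" for s t
  proof -
    have "(\<Sum>i\<in>J. ((f(j := s)) i - (g(j := t)) i)\<^sup>2) = (s - t)\<^sup>2 + r"
      unfolding r_def using J by (subst sum.remove[of J j]) auto
    then show ?thesis using d[of "f(j := s)" "g(j := t)"] that by (simp add: A_def B_def)
  qed
  obtain s t where "s \<in> A" "t \<in> B" using ne by auto
  then have "(s - t)\<^sup>2 + r \<le> d\<^sup>2" by (rule st)
  moreover have "0 \<le> (s - t)\<^sup>2" by simp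
  ultimately have "r \<le> d\<^sup>2" by linarith
  define D where "D = sqrt (d\<^sup>2 - r)"
  have "\<bar>s - t\<bar> \<le> D" if "s \<in> A" "t \<in> B" for s t
    using st[OF that] unfolding D_def by (intro real_le_rsqrt) (simp add: power2_abs)
  from emeasure_sum_le_of_mutual_dist[OF ne this]
  have le: "emeasure lborel A + emeasure lborel B \<le> ennreal (2 * D)" .
  have "ennreal (2 * \<bar>f j\<bar> + 2 * \<bar>g j\<bar>) = ennreal (2 * \<bar>f j\<bar>) + ennreal (2 * \<bar>g j\<bar>)"
    by (rule ennreal_plus) auto
  also have "\<dots> \<le> emeasure lborel A + emeasure lborel B"
    using fA gB by (intro add_mono less_imp_le)
  also note le
  finally have "2 * \<bar>f j\<bar> + 2 * \<bar>g j\<bar> \<le> 2 * D"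
    by (subst (asm) ennreal_le_iff) (auto simp: D_def \<open>r \<le> d\<^sup>2\<close>)
  then have "\<bar>f j - g j\<bar> \<le> D" by linarith
  then have "(f j - g j)\<^sup>2 \<le> D\<^sup>2" by (metis abs_ge_zero power2_abs power_mono)
  also have "D\<^sup>2 = d\<^sup>2 - r" using \<open>r \<le> d\<^sup>2\<close> by (simp add: D_def)
  finally show ?thesis using split by simp
qed

definition negate_on :: "'i set \<Rightarrow> ('i \<Rightarrow> real) \<Rightarrow> 'i \<Rightarrow> real" where
  "negate_on I f = (\<lambda>i. if i \<in> I then - f i else f i)"

text \<open>
  Symmetrising in one more coordinate preserves the symmetry already gained. Only the simultaneous
  change of all signs in \<open>I\<close> is tracked; for \<open>I\<close> the set of all coordinates this is central symmetry.
\<close>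

lemma steiner_negate_on:
  assumes "j \<in> J" "I \<subseteq> J" "j \<notin> I" and inv: "\<And>f. f \<in> E \<Longrightarrow> negate_on I f \<in> E"
    and f: "f \<in> steiner j J E"
  shows "negate_on (insert j I) f \<in> steiner j J E"
proof -
  have sp: "negate_on (insert j I) f \<in> space (\<Pi>\<^sub>M _\<in>J. lborel)"
    using f assms by (auto simp: steiner_def space_PiM PiE_def extensional_def negate_on_def)
  have inv': "negate_on I f \<in> E \<longleftrightarrow> f \<in> E" for f
  proof
    assume "negate_on I f \<in> E"
    then have "negate_on I (negate_on I f) \<in> E" by (rule inv)
    moreover have "negate_on I (negate_on I f) = f" by (auto simp: negate_on_def)
    ultimately show "f \<in> E" by simp
  qed (rule inv)
  have "(negate_on (insert j I) f)(j := t) = negate_on I (f(j := t))" for t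
    using assms(3) by (auto simp: negate_on_def)
  then have "{t. (negate_on (insert j I) f)(j := t) \<in> E} = {t. f(j := t) \<in> E}"
    using inv' by simp
  then show ?thesis using f sp by (simp add: steiner_def negate_on_def)
qed

lemma steiner_iterate:
  assumes J: "finite J" and "0 \<le> d" and E: "E \<in> sets (\<Pi>\<^sub>M _\<in>J. lborel)"
    and d: "\<And>f g. f \<in> E \<Longrightarrow> g \<in> E \<Longrightarrow> (\<Sum>i\<in>J. (f i - g i)\<^sup>2) \<le> d\<^sup>2"
    and I: "I \<subseteq> J"
  shows "\<exists>F \<in> sets (\<Pi>\<^sub>M _\<in>J. lborel). emeasure (\<Pi>\<^sub>M _\<in>J. lborel) F = emeasure (\<Pi>\<^sub>M _\<in>J. lborel) E \<and>
    (\<forall>f\<in>F. \<forall>g\<in>F. (\<Sum>i\<in>J. (f i - g i)\<^sup>2) \<le> d\<^sup>2) \<and> (\<forall>f\<in>F. negate_on I f \<in> F)"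
  using finite_subset[OF I J] I
proof (induction I)
  case empty
  then show ?case using E d by (intro bexI[of _ E]) (auto simp: negate_on_def)
next
  case (insert j I)
  then obtain F where F: "F \<in> sets (\<Pi>\<^sub>M _\<in>J. lborel)"
      "emeasure (\<Pi>\<^sub>M _\<in>J. lborel) F = emeasure (\<Pi>\<^sub>M _\<in>J. lborel) E"
      "\<And>f g. f \<in> F \<Longrightarrow> g \<in> F \<Longrightarrow> (\<Sum>i\<in>J. (f i - g i)\<^sup>2) \<le> d\<^sup>2" "\<And>f. f \<in> F \<Longrightarrow> negate_on I f \<in> F"
    by auto
  have j: "j \<in> J" using insert by auto
  show ?case
  proof (intro bexI[of _ "steiner j J F"] conjI ballI)
    show "steiner j J F \<in> sets (\<Pi>\<^sub>M _\<in>J. lborel)" by (rule steiner_sets[OF j F(1)])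
    show "emeasure (\<Pi>\<^sub>M _\<in>J. lborel) (steiner j J F) = emeasure (\<Pi>\<^sub>M _\<in>J. lborel) E"
      using emeasure_steiner[OF J j F(1)] F(2) by simp
    show "(\<Sum>i\<in>J. (f i - g i)\<^sup>2) \<le> d\<^sup>2" if "f \<in> steiner j J F" "g \<in> steiner j J F" for f g
      by (rule steiner_diameter[OF J j \<open>0 \<le> d\<close> F(3) that])
    show "negate_on (insert j I) f \<in> steiner j J F" if "f \<in> steiner j J F" for f
      by (rule steiner_negate_on[OF j _ _ F(4) that]) (use insert in auto)
  qed
qed

text \<open>
  After symmetrisation in all coordinates the set is centrally symmetric, so the distance of a point to
  its antipode shows that the set lies in the ball of radius \<open>d / 2\<close>. A slightly larger
  radius is used first because the volume formula for balls is for positive radii.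
\<close>

theorem isodiametric_PiM:
  assumes J: "finite J" and "0 \<le> d" and E: "E \<in> sets (\<Pi>\<^sub>M _\<in>J. lborel)"
    and d: "\<And>f g. f \<in> E \<Longrightarrow> g \<in> E \<Longrightarrow> (\<Sum>i\<in>J. (f i - g i)\<^sup>2) \<le> d\<^sup>2"
  shows "emeasure (\<Pi>\<^sub>M _\<in>J. lborel) E \<le> ennreal (unit_ball_vol (card J) * (d / 2) ^ card J)"
proof -
  let ?P = "\<Pi>\<^sub>M _\<in>J. (lborel :: real measure)"
  obtain F where F: "F \<in> sets ?P" "emeasure ?P F = emeasure ?P E"
      "\<And>f g. f \<in> F \<Longrightarrow> g \<in> F \<Longrightarrow> (\<Sum>i\<in>J. (f i - g i)\<^sup>2) \<le> d\<^sup>2" "\<And>f. f \<in> F \<Longrightarrow> negate_on J f \<in> F"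
    using steiner_iterate[OF assms subset_refl] by blast
  have le: "emeasure ?P E \<le> ennreal (unit_ball_vol (card J) * r ^ card J)" if "d / 2 < r" for r
  proof -
    have r: "0 < r" using that \<open>0 \<le> d\<close> by simp
    have "F \<subseteq> {f. sqrt (\<Sum>i\<in>J. (f i)\<^sup>2) \<le> r} \<inter> space ?P"
    proof
      fix f assume f: "f \<in> F"
      have "(\<Sum>i\<in>J. (f i - negate_on J f i)\<^sup>2) \<le> d\<^sup>2" by (rule F(3)[OF f F(4)[OF f]])
      also have "(\<Sum>i\<in>J. (f i - negate_on J f i)\<^sup>2) = (\<Sum>i\<in>J. 4 * (f i)\<^sup>2)"
        by (intro sum.cong) (auto simp: negate_on_def power2_eq_square)
      finally have "(\<Sum>i\<in>J. (f i)\<^sup>2) \<le> (d / 2)\<^sup>2"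
        by (simp add: sum_distrib_left[symmetric] power2_eq_square)
      then have "sqrt (\<Sum>i\<in>J. (f i)\<^sup>2) \<le> d / 2"
        using \<open>0 \<le> d\<close> by (intro real_le_lsqrt) (auto intro: sum_nonneg)
      moreover have "f \<in> space ?P" using sets.sets_into_space[OF F(1)] f by auto
      ultimately show "f \<in> {f. sqrt (\<Sum>i\<in>J. (f i)\<^sup>2) \<le> r} \<inter> space ?P" using that by auto
    qed
    moreover have "{f. sqrt (\<Sum>i\<in>J. (f i)\<^sup>2) \<le> r} \<inter> space ?P \<in> sets ?P" by measurable
    ultimately have "emeasure ?P F \<le> emeasure ?P ({f. sqrt (\<Sum>i\<in>J. (f i)\<^sup>2) \<le> r} \<inter> space ?P)"
      by (rule emeasure_mono)
    then show ?thesis using emeasure_cball_aux[OF J r] F(2) by simp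
  qed
  have "((\<lambda>r. ennreal (unit_ball_vol (card J) * r ^ card J)) \<longlongrightarrow>
      ennreal (unit_ball_vol (card J) * (d / 2) ^ card J)) (at_right (d / 2))"
    by (intro tendsto_intros)
  then show ?thesis
    by (rule tendsto_lowerbound) (auto simp: eventually_at_filter intro!: le always_eventually)
qed

section \<open>Lebesgue measure on a coordinate hyperplane\<close>

text \<open>
  Lebesgue measure on the hyperplane orthogonal to the basis vector \<open>b\<close>, regarded as a measure on the
  whole space, so that the dimension of the type stays the same.
\<close>

definition flat_lborel :: "'a::euclidean_space \<Rightarrow> 'a measure" where
  "flat_lborel b = distr (\<Pi>\<^sub>M _\<in>Basis - {b}. lborel) borel (\<lambda>f. \<Sum>c\<in>Basis - {b}. f c *\<^sub>R c)"

lemma sets_flat_lborel [simp, measurable_cong]: "sets (flat_lborel b) = sets borel"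
  and space_flat_lborel [simp]: "space (flat_lborel b) = UNIV"
  by (simp_all add: flat_lborel_def)

lemma measurable_coord_sum [measurable]:
  "B \<subseteq> Basis \<Longrightarrow> (\<lambda>f. \<Sum>c\<in>B. f c *\<^sub>R c) \<in> (\<Pi>\<^sub>M _\<in>B. lborel) \<rightarrow>\<^sub>M (borel :: 'a::euclidean_space measure)"
  by (intro borel_measurable_sum) auto

lemma hyperplane_fubini:
  fixes b :: "'a::euclidean_space"
  assumes b: "b \<in> Basis" and g [measurable]: "g \<in> borel_measurable borel"
  shows "(\<integral>\<^sup>+ x. g x \<partial>lborel) = (\<integral>\<^sup>+ y. (\<integral>\<^sup>+ t. g (y + t *\<^sub>R b) \<partial>lborel) \<partial>flat_lborel b)"
proof -
  interpret product_sigma_finite "\<lambda>_::'a. lborel :: real measure" by standard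
  let ?B = "Basis - {b}"
  have B: "insert b ?B = Basis" using b by auto
  have m: "(\<lambda>f. \<Sum>c\<in>Basis. f c *\<^sub>R c) \<in> (\<Pi>\<^sub>M _\<in>Basis. lborel) \<rightarrow>\<^sub>M (borel :: 'a measure)"
    by (rule measurable_coord_sum) simp
  have "(\<integral>\<^sup>+ x. g x \<partial>lborel) = (\<integral>\<^sup>+ f. g (\<Sum>c\<in>Basis. f c *\<^sub>R c) \<partial>(\<Pi>\<^sub>M _\<in>Basis. lborel))"
    by (subst lborel_eq) (subst nn_integral_distr; use m g in simp)
  also have "\<dots> = (\<integral>\<^sup>+ f. g (\<Sum>c\<in>Basis. f c *\<^sub>R c) \<partial>(\<Pi>\<^sub>M _\<in>insert b ?B. lborel))"
    by (simp only: B)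
  also have "\<dots> = (\<integral>\<^sup>+ f. (\<integral>\<^sup>+ t. g (\<Sum>c\<in>Basis. (f(b := t)) c *\<^sub>R c) \<partial>lborel) \<partial>(\<Pi>\<^sub>M _\<in>?B. lborel))"
    by (rule product_nn_integral_insert) (use measurable_compose[OF m g] B in auto)
  also have "\<dots> = (\<integral>\<^sup>+ f. (\<integral>\<^sup>+ t. g ((\<Sum>c\<in>?B. f c *\<^sub>R c) + t *\<^sub>R b) \<partial>lborel) \<partial>(\<Pi>\<^sub>M _\<in>?B. lborel))"
  proof -
    have "(\<Sum>c\<in>Basis. (f(b := t)) c *\<^sub>R c) = (\<Sum>c\<in>?B. f c *\<^sub>R c) + t *\<^sub>R b" for f :: "'a \<Rightarrow> real" and t
      using b by (subst sum.remove[of Basis b]) (auto intro!: sum.cong simp: add.commute)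
    then show ?thesis by simp
  qed
  also have "\<dots> = (\<integral>\<^sup>+ y. (\<integral>\<^sup>+ t. g (y + t *\<^sub>R b) \<partial>lborel) \<partial>flat_lborel b)"
    unfolding flat_lborel_def by (subst nn_integral_distr) (auto intro!: lborel.borel_measurable_nn_integral measurable_coord_sum)
  finally show ?thesis .
qed

lemma AE_hyperplane: 
  fixes b :: "'a::euclidean_space"
  assumes "b \<in> Basis"
  shows "AE y in flat_lborel b. y \<bullet> b = 0"
  unfolding flat_lborel_def
  by (subst AE_distr_iff) (use assms in \<open>auto simp: inner_sum_left inner_not_same_Basis intro!: measurable_coord_sum\<close>)

text \<open>
  The cylinder of height \<open>1\<close> over \<open>S\<close> has the measure of \<open>S\<close>. This transfers
  translation invariance and finiteness from Lebesgue measure of the whole space.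
\<close>

lemma emeasure_hyperplane_cylinder:
  fixes b :: "'a::euclidean_space"
  assumes b: "b \<in> Basis" and S: "S \<in> sets borel"
  shows "emeasure (flat_lborel b) S = emeasure lborel {x. x - (x \<bullet> b) *\<^sub>R b \<in> S \<and> x \<bullet> b \<in> {0..1}}"
proof -
  note [measurable] = S
  have "emeasure lborel {x. x - (x \<bullet> b) *\<^sub>R b \<in> S \<and> x \<bullet> b \<in> {0..1}}
      = (\<integral>\<^sup>+ x. indicator S (x - (x \<bullet> b) *\<^sub>R b) * indicator {0..1} (x \<bullet> b) \<partial>lborel)"
    by (subst nn_integral_indicator[symmetric]) (auto intro!: nn_integral_cong simp: indicator_def simp del: nn_integral_indicator)
  also have "\<dots> = (\<integral>\<^sup>+ y. (\<integral>\<^sup>+ t. indicator S (y + t *\<^sub>R b - ((y + t *\<^sub>R b) \<bullet> b) *\<^sub>R b)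
       * indicator {0..1} ((y + t *\<^sub>R b) \<bullet> b) \<partial>lborel) \<partial>flat_lborel b)"
    by (rule hyperplane_fubini[OF b]) measurable
  also have "\<dots> = (\<integral>\<^sup>+ y. indicator S y \<partial>flat_lborel b)"
  proof (rule nn_integral_cong_AE)
    show "AE y in flat_lborel b. (\<integral>\<^sup>+ t. indicator S (y + t *\<^sub>R b - ((y + t *\<^sub>R b) \<bullet> b) *\<^sub>R b)
       * indicator {0..1} ((y + t *\<^sub>R b) \<bullet> b) \<partial>lborel) = indicator S y"
      using AE_hyperplane[OF b] by eventually_elim (use b in \<open>simp add: inner_add_left nn_integral_cmult\<close>)
  qed
  finally show ?thesis using S by simp
qed

lemma hyperplane_translation:
  fixes b :: "'a::euclidean_space"
  assumes b: "b \<in> Basis" and w: "w \<bullet> b = 0"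
  shows "distr (flat_lborel b) borel (\<lambda>y. y + w) = flat_lborel b"
proof (rule measure_eqI)
  fix S assume "S \<in> sets (distr (flat_lborel b) borel (\<lambda>y. y + w))"
  then have S [measurable]: "S \<in> sets borel" by simp
  have pre: "(\<lambda>y. y + w) -` S \<in> sets borel" using measurable_sets[of "\<lambda>y. y + w" borel borel S] by simp
  let ?C = "{x. x - (x \<bullet> b) *\<^sub>R b \<in> S \<and> x \<bullet> b \<in> {0..1}}"
  have C: "?C \<in> sets borel" by measurable
  have "emeasure (distr (flat_lborel b) borel (\<lambda>y. y + w)) S = emeasure (flat_lborel b) ((\<lambda>y. y + w) -` S)"
    by (subst emeasure_distr) auto
  also have "\<dots> = emeasure lborel ((+) w -` ?C)"
    by (subst emeasure_hyperplane_cylinder[OF b pre]) (auto simp: inner_add_left w algebra_simps intro!: arg_cong[where f="emeasure lborel"])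
  also have "\<dots> = emeasure (distr lborel borel ((+) w)) ?C"
    using C by (subst emeasure_distr) auto
  also have "\<dots> = emeasure (flat_lborel b) S"
    by (simp add: lborel_distr_plus emeasure_hyperplane_cylinder[OF b S])
  finally show "emeasure (distr (flat_lborel b) borel (\<lambda>y. y + w)) S = emeasure (flat_lborel b) S" .
qed simp

lemma hyperplane_bounded_finite:
  fixes b :: "'a::euclidean_space"
  assumes b: "b \<in> Basis" and S: "bounded S"
  shows "emeasure (flat_lborel b) S < \<infinity>"
proof -
  obtain m where m: "S \<subseteq> cball 0 m" using S by (force simp: bounded_iff)
  have "{x. x - (x \<bullet> b) *\<^sub>R b \<in> cball 0 m \<and> x \<bullet> b \<in> {0..1}} \<subseteq> cball 0 (m + 1)" 
  proof clarify
    fix x assume x: "x - (x \<bullet> b) *\<^sub>R b \<in> cball 0 m" "x \<bullet> b \<in> {0..1}"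
    have "norm x \<le> norm (x - (x \<bullet> b) *\<^sub>R b) + norm ((x \<bullet> b) *\<^sub>R b)"
      by (metis diff_add_cancel norm_triangle_ineq)
    also have "\<dots> \<le> m + 1" using x b by (intro add_mono) auto
    finally show "x \<in> cball 0 (m + 1)" by simp
  qed
  then have "emeasure (flat_lborel b) (cball 0 m) \<le> emeasure lborel (cball 0 (m + 1) :: 'a set)"
    by (subst emeasure_hyperplane_cylinder[OF b]) (auto intro!: emeasure_mono)
  also have "\<dots> < \<infinity>" by (rule emeasure_bounded_finite) simp
  finally show ?thesis using emeasure_mono[OF m, of "flat_lborel b"] by (auto intro: le_less_trans)
qed

lemma sigma_finite_borel_measureI:
  fixes M :: "'a::euclidean_space measure"
  assumes M: "sets M = sets borel" and fin: "\<And>m::nat. emeasure M (cball 0 (real m)) < \<infinity>"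
  shows "sigma_finite_measure M"
proof
  have "\<exists>m::nat. x \<in> cball 0 (real m)" for x :: 'a
    using real_arch_simple[of "norm x"] by auto
  then have "(\<Union>(range (\<lambda>m::nat. cball (0::'a) (real m)))) = UNIV" by blast
  moreover have "space M = UNIV" using sets_eq_imp_space_eq[OF M] by simp
  ultimately show "\<exists>A. countable A \<and> A \<subseteq> sets M \<and> \<Union> A = space M \<and> (\<forall>a\<in>A. emeasure M a \<noteq> \<infinity>)"
    using fin M by (intro exI[of _ "range (\<lambda>m::nat. cball (0::'a) (real m))"]) (auto simp: less_top)
qed

text \<open>
  Uniqueness of translation invariant measures up to a constant, in the form of a proportion: evaluate
  \<open>\<integral>\<integral> indicator A (x + y) * indicator B y\<close> by Fubini, once by shifting \<open>x\<close> and once by shifting \<open>y\<close>.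
  The set \<open>V\<close> of admissible translations carries both measures, so that the lemma applies to measures
  on a hyperplane.
\<close>

lemma translation_invariant_unique:
  fixes M N :: "'a::euclidean_space measure"
  assumes M: "sets M = sets borel" "sigma_finite_measure M" "AE x in M. x \<in> V"
      "\<And>w. w \<in> V \<Longrightarrow> distr M borel (\<lambda>x. x + w) = M"
    and N: "sets N = sets borel" "sigma_finite_measure N" "AE x in N. x \<in> V"
      "\<And>w. w \<in> V \<Longrightarrow> distr N borel (\<lambda>x. x + w) = N"
    and V: "\<And>w. w \<in> V \<Longrightarrow> - w \<in> V"
    and A: "A \<in> sets borel" and B: "B \<in> sets borel" "\<And>x. - x \<in> B \<longleftrightarrow> x \<in> B"
  shows "emeasure M A * emeasure N B = emeasure N A * emeasure M B"
proof -
  interpret M: sigma_finite_measure M by fact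
  interpret N: sigma_finite_measure N by fact
  interpret MN: pair_sigma_finite M N by standard
  note [measurable] = A B(1) 
  note [measurable_cong] = M(1) N(1)
  have trM: "(\<integral>\<^sup>+ x. f (x + w) \<partial>M) = (\<integral>\<^sup>+ x. f x \<partial>M)"
    if "w \<in> V" and [measurable]: "f \<in> borel_measurable borel" for f :: "'a \<Rightarrow> ennreal" and w
    by (subst M(4)[OF that(1), symmetric]) (simp add: nn_integral_distr)
  have trN: "(\<integral>\<^sup>+ x. f (x + w) \<partial>N) = (\<integral>\<^sup>+ x. f x \<partial>N)"
    if "w \<in> V" and [measurable]: "f \<in> borel_measurable borel" for f :: "'a \<Rightarrow> ennreal" and w
    by (subst N(4)[OF that(1), symmetric]) (simp add: nn_integral_distr)
  have "emeasure M A * emeasure N B = (\<integral>\<^sup>+ y. indicator B y * emeasure M A \<partial>N)"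
    by (simp add: nn_integral_multc N(1) B(1) mult.commute)
  also have "\<dots> = (\<integral>\<^sup>+ y. (\<integral>\<^sup>+ x. indicator B y * indicator A (x + y) \<partial>M) \<partial>N)"
  proof (rule nn_integral_cong_AE)
    show "AE y in N. indicator B y * emeasure M A = (\<integral>\<^sup>+ x. indicator B y * indicator A (x + y) \<partial>M)"
      using N(3)
    proof eventually_elim
      case (elim y)
      then show ?case using trM[OF elim, of "indicator A"] by (simp add: nn_integral_cmult M(1) A)
    qed
  qed
  also have "\<dots> = (\<integral>\<^sup>+ x. (\<integral>\<^sup>+ y. indicator B y * indicator A (x + y) \<partial>N) \<partial>M)"
    by (rule MN.Fubini') measurable
  also have "\<dots> = (\<integral>\<^sup>+ x. (\<integral>\<^sup>+ y. indicator B (y - x) * indicator A y \<partial>N) \<partial>M)"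
  proof (rule nn_integral_cong_AE)
    show "AE x in M. (\<integral>\<^sup>+ y. indicator B y * indicator A (x + y) \<partial>N)
        = (\<integral>\<^sup>+ y. indicator B (y - x) * indicator A y \<partial>N)"
      using M(3)
    proof eventually_elim
      case (elim x)
      have "(\<integral>\<^sup>+ y. indicator B (y - x) * indicator A y \<partial>N)
          = (\<integral>\<^sup>+ y. indicator B (y + x - x) * indicator A (y + x) \<partial>N)"
        by (rule trN[OF elim, symmetric]) measurable
      then show ?case by (simp add: add.commute)
    qed
  qed
  also have "\<dots> = (\<integral>\<^sup>+ y. (\<integral>\<^sup>+ x. indicator B (y - x) * indicator A y \<partial>M) \<partial>N)"
    by (rule MN.Fubini'[symmetric]) measurable
  also have "\<dots> = (\<integral>\<^sup>+ y. emeasure M B * indicator A y \<partial>N)"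
  proof (rule nn_integral_cong_AE)
    show "AE y in N. (\<integral>\<^sup>+ x. indicator B (y - x) * indicator A y \<partial>M) = emeasure M B * indicator A y"
      using N(3)
    proof eventually_elim
      case (elim y)
      have "indicator B (y - x) = (indicator B (x + - y) :: ennreal)" for x
        using B(2)[of "x - y"] by (simp add: indicator_def)
      then have "(\<integral>\<^sup>+ x. indicator B (y - x) \<partial>M) = (\<integral>\<^sup>+ x. indicator B x \<partial>M)"
        using trM[OF V[OF elim], of "indicator B"] by simp
      then show ?case by (simp add: nn_integral_multc M(1) B(1))
    qed
  qed
  also have "\<dots> = emeasure N A * emeasure M B"
    by (simp add: nn_integral_cmult N(1) A) (rule mult.commute)
  finally show ?thesis .
qed

text \<open>
  The image of Lebesgue measure is again translation invariant, and the isometry fixes the unit ball.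
\<close>

lemma lborel_isometry_invariant:
  fixes R :: "'a::euclidean_space \<Rightarrow> 'a"
  assumes R: "linear R" "\<And>x. norm (R x) = norm x" "\<And>x. R (R x) = x"
  shows "distr lborel borel R = lborel"
proof (rule measure_eqI)
  have c: "continuous_on UNIV R" using R(1) by (simp add: linear_continuous_on linear_linear)
  then have [measurable]: "R \<in> borel \<rightarrow>\<^sub>M borel" by (rule borel_measurable_continuous_onI)
  let ?M = "distr lborel borel R"
  have b: "emeasure ?M (cball 0 r) = emeasure lborel (cball 0 r :: 'a set)" for r
    by (subst emeasure_distr) (auto simp: vimage_def R(2) cball_def)
  fix A assume "A \<in> sets ?M"
  then have A: "A \<in> sets borel" by simp
  have "emeasure ?M A * emeasure lborel (cball 0 1 :: 'a set) = emeasure lborel A * emeasure ?M (cball 0 1)"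
  proof (rule translation_invariant_unique[where V=UNIV])
    show "sigma_finite_measure ?M"
      by (rule sigma_finite_borel_measureI) (use emeasure_bounded_finite[OF bounded_cball] in \<open>auto simp: b\<close>)
    show "distr ?M borel (\<lambda>x. x + w) = ?M" for w
    proof -
      have "distr ?M borel (\<lambda>x. x + w) = distr lborel borel (\<lambda>x. R x + w)"
        by (subst distr_distr) (auto simp: comp_def)
      also have "(\<lambda>x. R x + w) = R \<circ> ((+) (R w))"
        using R by (auto simp: linear_add add.commute)
      also have "distr lborel borel (R \<circ> ((+) (R w))) = distr (distr lborel borel ((+) (R w))) borel R"
        by (subst distr_distr) auto
      finally show ?thesis by (simp add: lborel_distr_plus)
    qed
    show "distr lborel borel (\<lambda>x. x + w) = lborel" for w :: 'a
    proof -
      have "(\<lambda>x. x + w) = (+) w" by (auto simp: add.commute)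
      then show ?thesis by (simp add: lborel_distr_plus)
    qed
  qed (use A in \<open>auto simp: sigma_finite_lborel\<close>)
  moreover have "0 < emeasure lborel (cball 0 1 :: 'a set)" "emeasure lborel (cball 0 1 :: 'a set) < \<infinity>"
    by (auto simp: emeasure_cball intro!: emeasure_bounded_finite)
  ultimately show "emeasure ?M A = emeasure lborel A"
    unfolding b by (subst (asm) (1 2) mult.commute) (auto simp: ennreal_mult_cancel_left)
qed simp

lemma hyperplane_isodiametric:
  fixes b :: "'a::euclidean_space"
  assumes b: "b \<in> Basis" and S: "S \<in> sets borel" "S \<subseteq> {x. x \<bullet> b = 0}" and "0 \<le> d"
    and d: "\<And>x y. x \<in> S \<Longrightarrow> y \<in> S \<Longrightarrow> dist x y \<le> d"
  shows "emeasure (flat_lborel b) S \<le> ennreal (unit_ball_vol (DIM('a) - 1) * (d / 2) ^ (DIM('a) - 1))"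
proof -
  let ?P = "\<Pi>\<^sub>M _\<in>Basis - {b}. (lborel :: real measure)"
  let ?e = "\<lambda>f :: 'a \<Rightarrow> real. \<Sum>c\<in>Basis - {b}. f c *\<^sub>R c"
  let ?E = "?e -` S \<inter> space ?P"
  have card: "card (Basis - {b}) = DIM('a) - 1" using b by simp
  have coord: "?e f \<bullet> c = (if c = b then 0 else f c)" if "c \<in> Basis" for f c
    using that by (auto simp: inner_sum_left inner_Basis if_distrib cong: if_cong)
  have "emeasure ?P ?E \<le> ennreal (unit_ball_vol (card (Basis - {b})) * (d / 2) ^ card (Basis - {b}))"
  proof (rule isodiametric_PiM)
    show "?E \<in> sets ?P" by (rule measurable_sets[OF measurable_coord_sum S(1)]) auto
    fix f g assume fg: "f \<in> ?E" "g \<in> ?E"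
    have "(\<Sum>i\<in>Basis - {b}. (f i - g i)\<^sup>2) = (\<Sum>i\<in>Basis. ((?e f - ?e g) \<bullet> i)\<^sup>2)"
      using b by (subst (2) sum.remove[of _ b]) (auto simp: inner_diff_left coord)
    also have "\<dots> = (norm (?e f - ?e g))\<^sup>2"
      unfolding power2_norm_eq_inner by (subst euclidean_inner) (simp only: power2_eq_square)
    also have "\<dots> \<le> d\<^sup>2" using d[of "?e f" "?e g"] fg by (intro power_mono) (auto simp: dist_norm)
    finally show "(\<Sum>i\<in>Basis - {b}. (f i - g i)\<^sup>2) \<le> d\<^sup>2" .
  qed (use \<open>0 \<le> d\<close> in auto)
  then show ?thesis unfolding flat_lborel_def card using S(1) by (subst emeasure_distr) auto
qed

lemma hyperplane_cball:
  fixes b :: "'a::euclidean_space"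
  assumes b: "b \<in> Basis" and p: "p \<bullet> b = 0" and "0 < r"
  shows "emeasure (flat_lborel b) (cball p r) = ennreal (unit_ball_vol (DIM('a) - 1) * r ^ (DIM('a) - 1))"
proof -
  let ?P = "\<Pi>\<^sub>M _\<in>Basis - {b}. (lborel :: real measure)"
  let ?e = "\<lambda>f :: 'a \<Rightarrow> real. \<Sum>c\<in>Basis - {b}. f c *\<^sub>R c"
  have card: "card (Basis - {b}) = DIM('a) - 1" using b by simp
  have coord: "?e f \<bullet> c = (if c = b then 0 else f c)" if "c \<in> Basis" for f c
    using that by (auto simp: inner_sum_left inner_Basis if_distrib cong: if_cong)
  have nrm: "norm (?e f) = sqrt (\<Sum>i\<in>Basis - {b}. (f i)\<^sup>2)" for f
  proof -
    have "norm (?e f) = sqrt (\<Sum>i\<in>Basis. (?e f \<bullet> i)\<^sup>2)"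
      by (simp only: norm_eq_sqrt_inner euclidean_inner[of "?e f" "?e f"] power2_eq_square)
    also have "(\<Sum>i\<in>Basis. (?e f \<bullet> i)\<^sup>2) = (\<Sum>i\<in>Basis - {b}. (f i)\<^sup>2)"
      using b by (subst sum.remove[of _ b]) (auto simp: coord)
    finally show ?thesis .
  qed
  have "emeasure (flat_lborel b) (cball p r) = emeasure (distr (flat_lborel b) borel (\<lambda>y. y + p)) (cball p r)"
    using hyperplane_translation[OF b p] by simp
  also have "\<dots> = emeasure (flat_lborel b) (cball 0 r)"
    by (subst emeasure_distr) (auto intro!: arg_cong[where f="emeasure (flat_lborel b)"] simp: dist_norm)
  also have "\<dots> = emeasure ?P (?e -` cball 0 r \<inter> space ?P)"
    unfolding flat_lborel_def by (subst emeasure_distr) auto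
  also have "?e -` cball 0 r \<inter> space ?P = {f. sqrt (\<Sum>i\<in>Basis - {b}. (f i)\<^sup>2) \<le> r} \<inter> space ?P"
    by (auto simp: nrm)
  also have "emeasure ?P \<dots> = ennreal (unit_ball_vol (DIM('a) - 1) * r ^ (DIM('a) - 1))"
    using emeasure_cball_aux[of "Basis - {b}" r] \<open>0 < r\<close> b by (simp add: card)
  finally show ?thesis .
qed


section \<open>Hausdorff measure on a hyperplane is Lebesgue measure\<close>

text \<open>
  Each member of a cover may be replaced by its closure, which has the same diameter and is
  measurable; the isodiametric inequality then bounds its measure by its cost.
\<close>

lemma hyperplane_le_hausdorff:
  fixes b :: "'a::euclidean_space"
  assumes b: "b \<in> Basis" and A: "A \<in> sets borel" "A \<subseteq> {x. x \<bullet> b = 0}"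
  shows "emeasure (flat_lborel b) A \<le> hausdorff_outer (DIM('a) - 1) A"
proof -
  let ?k = "DIM('a) - 1" and ?H = "{x::'a. x \<bullet> b = 0}"
  have H: "closed ?H" by (simp add: closed_hyperplane inner_commute[of _ b])
  have cl: "closure X \<inter> ?H \<in> sets borel" for X
    using H by (intro borel_closed closed_Int) auto
  have "emeasure (flat_lborel b) A \<le> hausdorff_pre ?k 1 A"
    unfolding hausdorff_pre_def
  proof (rule INF_greatest, clarify)
    fix C :: "nat \<Rightarrow> 'a set"
    assume C: "A \<subseteq> (\<Union>i. C i)" "\<forall>i. bounded (C i) \<and> diameter (C i) \<le> 1"
    have g: "emeasure (flat_lborel b) (closure (C i) \<inter> ?H) \<le> hausdorff_gauge ?k (C i)" for i
    proof (cases "C i = {}")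
      case False
      have bc: "bounded (closure (C i))" "bounded (C i)" using C(2) by auto
      have dist: "dist x y \<le> diameter (C i)" if "x \<in> closure (C i)" "y \<in> closure (C i)" for x y
        using diameter_bounded_bound[OF bc(1) that] diameter_closure[OF bc(2)] by simp
      have "emeasure (flat_lborel b) (closure (C i) \<inter> ?H)
          \<le> ennreal (unit_ball_vol ?k * (diameter (C i) / 2) ^ ?k)"
        by (rule hyperplane_isodiametric[OF b]) (use cl dist bc in \<open>auto simp: diameter_ge_0\<close>)
      then show ?thesis using False by (simp add: hausdorff_gauge_def)
    qed simp
    have "emeasure (flat_lborel b) A \<le> emeasure (flat_lborel b) (\<Union>i. closure (C i) \<inter> ?H)"
    proof (rule emeasure_mono)
      show "A \<subseteq> (\<Union>i. closure (C i) \<inter> ?H)"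
      proof
        fix x assume "x \<in> A"
        then obtain i where "x \<in> C i" using C(1) by auto
        then show "x \<in> (\<Union>i. closure (C i) \<inter> ?H)"
          using closure_subset[of "C i"] A(2) \<open>x \<in> A\<close> by auto
      qed
      show "(\<Union>i. closure (C i) \<inter> ?H) \<in> sets (flat_lborel b)" using cl by auto
    qed
    also have "\<dots> \<le> (\<Sum>i. emeasure (flat_lborel b) (closure (C i) \<inter> ?H))"
      by (rule emeasure_subadditive_countably) (use cl in auto)
    also have "\<dots> \<le> (\<Sum>i. hausdorff_gauge ?k (C i))"
      by (intro suminf_le g) auto
    finally show "emeasure (flat_lborel b) A \<le> (\<Sum>i. hausdorff_gauge ?k (C i))" .
  qed
  also have "\<dots> \<le> hausdorff_outer ?k A" by (rule hausdorff_pre_le_outer) simp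
  finally show ?thesis .
qed

text \<open>
  The cube is centred at \<open>0\<close> because the uniqueness lemma compares measures through a set that is
  symmetric about the origin.
\<close>

definition unit_cube :: "'a::euclidean_space \<Rightarrow> 'a set" where
  "unit_cube b = {y. y \<bullet> b = 0 \<and> (\<forall>c\<in>Basis. \<bar>y \<bullet> c\<bar> \<le> 1 / 2)}"

text \<open>
  The centres of the \<open>N ^ (n - 1)\<close> cubes of side \<open>1 / N\<close> into which the unit cube is divided.
\<close>

definition grid_point :: "'a::euclidean_space \<Rightarrow> nat \<Rightarrow> ('a \<Rightarrow> nat) \<Rightarrow> 'a" where
  "grid_point b N m = (\<Sum>c\<in>Basis - {b}. ((real (m c) + 1 / 2) / N - 1 / 2) *\<^sub>R c)"

abbreviation grid_index :: "'a::euclidean_space \<Rightarrow> nat \<Rightarrow> ('a \<Rightarrow> nat) set" where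
  "grid_index b N \<equiv> PiE (Basis - {b}) (\<lambda>_. {..<N})"

lemma grid_point_inner:
  "c \<in> Basis \<Longrightarrow> grid_point b N m \<bullet> c = (if c = b then 0 else (real (m c) + 1 / 2) / N - 1 / 2)"
  by (auto simp: grid_point_def inner_sum_left inner_Basis if_distrib cong: if_cong)

lemma grid_index_finite: "finite (grid_index b N)"
  by (auto intro!: finite_PiE)

lemma card_grid_index: "b \<in> Basis \<Longrightarrow> card (grid_index b N) = N ^ (DIM('a) - 1)"
  for b :: "'a::euclidean_space"
  by (simp add: card_PiE)

text \<open>
  The small cubes are closed, so the last index in each direction also serves the points of the far
  face, where the integer part is \<open>N\<close>; this is the role of the minimum in the proof.
\<close>

lemma unit_cube_covered:
  fixes b :: "'a::euclidean_space"
  assumes "b \<in> Basis" "0 < N" "y \<in> unit_cube b"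
  shows "\<exists>m\<in>grid_index b N. \<forall>c\<in>Basis. \<bar>(y - grid_point b N m) \<bullet> c\<bar> \<le> 1 / (2 * real N)"
proof -
  define m where "m = (\<lambda>c\<in>Basis - {b}. min (N - 1) (nat \<lfloor>(y \<bullet> c + 1 / 2) * N\<rfloor>))"
  have "\<bar>(y - grid_point b N m) \<bullet> c\<bar> \<le> 1 / (2 * real N)" if c: "c \<in> Basis" for c
  proof (cases "c = b")
    case True
    then show ?thesis using assms by (simp add: inner_diff_left grid_point_inner unit_cube_def)
  next
    case False
    define s where "s = (y \<bullet> c + 1 / 2) * N"
    have yc: "\<bar>y \<bullet> c\<bar> \<le> 1 / 2" using assms c by (auto simp: unit_cube_def)
    then have "0 \<le> s" unfolding s_def by (auto simp: abs_le_iff)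
    have "(y \<bullet> c + 1 / 2) * N \<le> 1 * real N" using yc by (intro mult_right_mono) auto
    then have "s \<le> N" unfolding s_def by simp
    have mc: "m c = min (N - 1) (nat \<lfloor>s\<rfloor>)" using False c by (simp add: m_def s_def)
    have "\<bar>s - (real (m c) + 1 / 2)\<bar> \<le> 1 / 2"
    proof (cases "nat \<lfloor>s\<rfloor> \<le> N - 1")
      case True
      then have "real (m c) = of_int \<lfloor>s\<rfloor>" using \<open>0 \<le> s\<close> mc by simp
      then show ?thesis by linarith
    next
      case False
      then have "int (N - 1) < \<lfloor>s\<rfloor>" using \<open>0 \<le> s\<close> by linarith
      then have "s \<ge> N" using \<open>0 < N\<close> by linarith
      moreover have "real (m c) = real N - 1" using mc False \<open>0 < N\<close> by simp
      ultimately show ?thesis using \<open>s \<le> N\<close> by simp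
    qed
    moreover have "(y - grid_point b N m) \<bullet> c = (s - (real (m c) + 1 / 2)) / N"
      using False c \<open>0 < N\<close> by (simp add: inner_diff_left grid_point_inner s_def field_simps)
    ultimately show ?thesis using \<open>0 < N\<close> by (simp add: abs_divide field_simps)
  qed
  moreover have "m \<in> grid_index b N" using \<open>0 < N\<close> by (auto simp: m_def)
  ultimately show ?thesis by blast
qed

lemma grid_point_separated:
  fixes b :: "'a::euclidean_space"
  assumes "m \<in> grid_index b N" "m' \<in> grid_index b N" "m \<noteq> m'" "0 < N"
  shows "1 / real N \<le> dist (grid_point b N m) (grid_point b N m')"
proof -
  obtain c where c: "c \<in> Basis - {b}" "m c \<noteq> m' c"
    using assms(1-3) by (metis PiE_ext)
  have "1 \<le> \<bar>real (m c) - real (m' c)\<bar>" using c(2) by linarith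
  then have "1 / real N \<le> \<bar>real (m c) - real (m' c)\<bar> / N" by (simp add: divide_right_mono)
  also have "\<dots> = \<bar>(grid_point b N m - grid_point b N m') \<bullet> c\<bar>"
    using c by (simp add: inner_diff_left grid_point_inner add_divide_distrib abs_divide flip: diff_divide_distrib)
  also have "\<dots> \<le> norm (grid_point b N m - grid_point b N m')"
    using c by (intro Basis_le_norm) auto
  finally show ?thesis by (simp add: dist_norm)
qed

lemma hausdorff_pre_le_gauge_bound:
  assumes "0 \<le> d" "d \<le> \<delta>" "0 < \<delta>" "\<And>x y. x \<in> S \<Longrightarrow> y \<in> S \<Longrightarrow> dist x y \<le> d"
  shows "hausdorff_pre k \<delta> S \<le> ennreal (unit_ball_vol (real k) * (d / 2) ^ k)"
proof -
  have S: "bounded S" using assms(4) by (auto simp: bounded_two_points)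
  have d: "diameter S \<le> d" by (rule diameter_leI) (use assms in auto)
  have "hausdorff_pre k \<delta> S \<le> hausdorff_gauge k S"
    by (rule hausdorff_gauge_le_pre) (use S d assms in auto)
  also have "\<dots> \<le> ennreal (unit_ball_vol (real k) * (d / 2) ^ k)"
    using d S by (auto simp: hausdorff_gauge_def diameter_ge_0 intro!: ennreal_leI mult_left_mono power_mono)
  finally show ?thesis .
qed

text \<open>
  The cover by small cubes has a cost that does not depend on the mesh size. The crude bound
  \<open>n / N\<close> for their diameters suffices.
\<close>

lemma hausdorff_unit_cube_finite:
  fixes b :: "'a::euclidean_space"
  assumes b: "b \<in> Basis"
  shows "hausdorff_outer (DIM('a) - 1) (unit_cube b) < \<infinity>"
proof -
  let ?k = "DIM('a) - 1"
  have "hausdorff_outer ?k (unit_cube b) \<le> ennreal (unit_ball_vol ?k * (DIM('a) / 2) ^ ?k)"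
  proof (rule hausdorff_outer_leI)
    fix \<delta> :: real assume "0 < \<delta>"
    obtain N :: nat where N: "DIM('a) / \<delta> < N" using reals_Archimedean2 by blast
    then have "0 < N" using \<open>0 < \<delta>\<close> by (cases N) (auto simp: field_simps)
    let ?Q = "\<lambda>m. {y. \<forall>c\<in>Basis. \<bar>(y - grid_point b N m) \<bullet> c\<bar> \<le> 1 / (2 * real N)}"
    have d: "dist x y \<le> DIM('a) / N" if "x \<in> ?Q m" "y \<in> ?Q m" for x y m
    proof -
      have "\<bar>(x - y) \<bullet> c\<bar> \<le> 1 / N" if "c \<in> Basis" for c
      proof -
        have "\<bar>(x - grid_point b N m) \<bullet> c\<bar> \<le> 1 / (2 * real N)" "\<bar>(y - grid_point b N m) \<bullet> c\<bar> \<le> 1 / (2 * real N)"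
          using \<open>x \<in> ?Q m\<close> \<open>y \<in> ?Q m\<close> that by auto
        moreover have "1 / (2 * real N) + 1 / (2 * real N) = 1 / N" by (simp add: field_simps)
        ultimately show ?thesis unfolding inner_diff_left by linarith
      qed
      then have "(\<Sum>c\<in>Basis. \<bar>(x - y) \<bullet> c\<bar>) \<le> (\<Sum>c\<in>(Basis::'a set). 1 / N)" by (intro sum_mono) auto
      then show ?thesis using norm_le_l1[of "x - y"] by (simp add: dist_norm)
    qed
    have "hausdorff_pre ?k \<delta> (unit_cube b) \<le> hausdorff_pre ?k \<delta> (\<Union>m\<in>grid_index b N. ?Q m)"
      using unit_cube_covered[OF b \<open>0 < N\<close>] by (intro hausdorff_pre_mono) blast
    also have "\<dots> \<le> (\<Sum>m\<in>grid_index b N. hausdorff_pre ?k \<delta> (?Q m))"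
      by (rule hausdorff_pre_UN_finite[OF \<open>0 < \<delta>\<close> grid_index_finite])
    also have "\<dots> \<le> (\<Sum>m\<in>grid_index b N. ennreal (unit_ball_vol ?k * (DIM('a) / N / 2) ^ ?k))"
      by (intro sum_mono hausdorff_pre_le_gauge_bound d)
         (use N \<open>0 < N\<close> \<open>0 < \<delta>\<close> in \<open>auto simp: field_simps\<close>)
    also have "\<dots> = ennreal (unit_ball_vol ?k * (DIM('a) / 2) ^ ?k)"
      using \<open>0 < N\<close> by (simp add: card_grid_index[OF b] ennreal_of_nat_eq_real_of_nat
        ennreal_mult'[symmetric] power_divide)
    finally show "hausdorff_pre ?k \<delta> (unit_cube b) \<le> ennreal (unit_ball_vol ?k * (DIM('a) / 2) ^ ?k)" .
  qed
  then show ?thesis by (auto intro: le_less_trans)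
qed

lemma hausdorff_hyperplane_bounded_finite:
  fixes b :: "'a::euclidean_space"
  assumes b: "b \<in> Basis" and S: "bounded S" "S \<subseteq> {x. x \<bullet> b = 0}"
  shows "hausdorff_outer (DIM('a) - 1) S < \<infinity>"
proof -
  let ?k = "DIM('a) - 1"
  obtain r where r: "0 < r" "\<And>x. x \<in> S \<Longrightarrow> norm x \<le> r" using S(1) bounded_pos by metis
  have "S \<subseteq> (\<lambda>y. (2 * r) *\<^sub>R y) ` unit_cube b"
  proof
    fix x assume x: "x \<in> S"
    have "\<bar>x \<bullet> c\<bar> \<le> r" if "c \<in> Basis" for c
      using Basis_le_norm[OF that, of x] r(2)[OF x] by linarith
    then have "(1 / (2 * r)) *\<^sub>R x \<in> unit_cube b"
      using r(1) S(2) x by (auto simp: unit_cube_def abs_mult)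
    moreover have "x = (2 * r) *\<^sub>R ((1 / (2 * r)) *\<^sub>R x)" using r(1) by simp
    ultimately show "x \<in> (\<lambda>y. (2 * r) *\<^sub>R y) ` unit_cube b" by blast
  qed
  then have "hausdorff_outer ?k S \<le> hausdorff_outer ?k ((\<lambda>y. (2 * r) *\<^sub>R y) ` unit_cube b)"
    by (rule hausdorff_outer_mono)
  also have "\<dots> \<le> ennreal ((2 * r) ^ ?k) * hausdorff_outer ?k (unit_cube b)"
    by (rule hausdorff_outer_lipschitz_image) (use r in \<open>auto simp: dist_norm simp flip: scaleR_diff_right\<close>)
  also have "\<dots> < \<infinity>" using hausdorff_unit_cube_finite[OF b] by (auto simp: ennreal_mult_less_top)
  finally show ?thesis .
qed

text \<open>
  Both measures are translation invariant, so the quotient of \<open>h\<close> and \<open>q\<close>, the two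
  measures of the cube, is their constant ratio. Inside the cube choose disjoint balls of small
  diameter and total Lebesgue measure \<open>\<beta>\<close>, the same for all mesh sizes. Covering these balls by themselves costs
  \<open>\<beta>\<close>, and the rest of the cube has Hausdorff measure \<open>(q - \<beta>) h / q\<close>. Thus
  \<open>h \<le> \<beta> + (q - \<beta>) h / q\<close>, that is \<open>h \<le> q\<close>.
\<close>

lemma hausdorff_eq_hyperplane:
  fixes b :: "'a::euclidean_space"
  assumes b: "b \<in> Basis" and A: "A \<in> sets borel" "A \<subseteq> {x. x \<bullet> b = 0}"
  shows "hausdorff_outer (DIM('a) - 1) A = emeasure (flat_lborel b) A"
proof (rule antisym)
  let ?k = "DIM('a) - 1" and ?H = "{x::'a. x \<bullet> b = 0}"
  have cl: "closed ?H" by (simp add: closed_hyperplane inner_commute[of _ b])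
  then have Hs [measurable]: "?H \<in> sets borel" by (rule borel_closed)
  define M where "M = density (hausdorff_measure ?k) (indicator ?H)"
  have sM: "sets M = sets borel" by (simp add: M_def)
  have M: "emeasure M S = hausdorff_outer ?k (S \<inter> ?H)" if "S \<in> sets borel" for S
  proof -
    have "emeasure M S = (\<integral>\<^sup>+ x. indicator ?H x * indicator S x \<partial>hausdorff_measure ?k)"
      unfolding M_def using that by (subst emeasure_density) auto
    also have "\<dots> = (\<integral>\<^sup>+ x. indicator (S \<inter> ?H) x \<partial>hausdorff_measure ?k)"
      by (intro nn_integral_cong) (auto simp: indicator_def)
    also have "\<dots> = emeasure (hausdorff_measure ?k) (S \<inter> ?H)"
      using that Hs by (intro nn_integral_indicator) auto
    also have "\<dots> = hausdorff_outer ?k (S \<inter> ?H)"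
      using that Hs by (intro emeasure_hausdorff_measure) auto
    finally show ?thesis .
  qed
  have sfM: "sigma_finite_measure M"
  proof (rule sigma_finite_borel_measureI[OF sM])
    show "emeasure M (cball 0 (real m)) < \<infinity>" for m
      using hausdorff_hyperplane_bounded_finite[OF b, of "cball 0 (real m) \<inter> ?H"]
      by (subst M) (auto intro: bounded_subset[OF bounded_cball])
  qed
  have sfN: "sigma_finite_measure (flat_lborel b)"
    by (rule sigma_finite_borel_measureI) (use hyperplane_bounded_finite[OF b bounded_cball] in auto)
  have trM: "distr M borel (\<lambda>x. x + w) = M" if w: "w \<in> ?H" for w
  proof (rule measure_eqI)
    fix S assume "S \<in> sets (distr M borel (\<lambda>x. x + w))"
    then have S: "S \<in> sets borel" by simp
    then have pre: "(\<lambda>x. x + w) -` S \<in> sets borel"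
      using measurable_sets[of "\<lambda>y. y + w" borel borel S] by simp
    have "emeasure (distr M borel (\<lambda>x. x + w)) S = emeasure M ((\<lambda>x. x + w) -` S)"
      using S sM by (subst emeasure_distr) (auto simp: sets_eq_imp_space_eq[OF sM] measurable_cong_sets[OF sM refl])
    also have "\<dots> = hausdorff_outer ?k ((\<lambda>x. x + w) -` S \<inter> ?H)" by (rule M[OF pre])
    also have "(\<lambda>x. x + w) -` S \<inter> ?H = (\<lambda>x. x - w) ` (S \<inter> ?H)"
    proof (intro equalityI subsetI)
      fix x assume "x \<in> (\<lambda>x. x + w) -` S \<inter> ?H"
      then show "x \<in> (\<lambda>x. x - w) ` (S \<inter> ?H)"
        using w by (intro image_eqI[of _ _ "x + w"]) (auto simp: inner_add_left)
    qed (use w in \<open>auto simp: inner_diff_left\<close>)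
    also have "hausdorff_outer ?k \<dots> = hausdorff_outer ?k (S \<inter> ?H)"
      by (rule hausdorff_outer_isometry) (simp add: dist_norm)
    finally show "emeasure (distr M borel (\<lambda>x. x + w)) S = emeasure M S" by (simp add: M[OF S])
  qed (simp add: sM)
  define Q where "Q = unit_cube b"
  have Qcl: "closed Q"
  proof -
    have "unit_cube b = ?H \<inter> (\<Inter>c\<in>Basis. {y. \<bar>y \<bullet> c\<bar> \<le> 1 / 2})" by (auto simp: unit_cube_def)
    moreover have "closed {y::'a. \<bar>y \<bullet> c\<bar> \<le> 1 / 2}" for c by (intro closed_Collect_le continuous_intros)
    ultimately show ?thesis unfolding Q_def using cl by (metis (no_types, lifting) closed_Int closed_INT)
  qed
  then have Q: "Q \<in> sets borel" by (rule borel_closed)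
  have QH: "Q \<subseteq> ?H" by (auto simp: Q_def unit_cube_def)
  have Qb: "bounded Q"
  proof -
    have "norm y \<le> (\<Sum>c\<in>(Basis::'a set). 1 / 2)" if "y \<in> Q" for y
      by (rule order_trans[OF norm_le_l1 sum_mono]) (use that in \<open>auto simp: Q_def unit_cube_def\<close>)
    then show ?thesis by (rule boundedI)
  qed
  have ratio: "emeasure M S * emeasure (flat_lborel b) Q = emeasure (flat_lborel b) S * emeasure M Q"
    if "S \<in> sets borel" for S
  proof (rule translation_invariant_unique[where V = ?H])
    show "AE x in M. x \<in> ?H" unfolding M_def by (subst AE_density) (auto simp: indicator_def)
    show "AE x in flat_lborel b. x \<in> ?H" using AE_hyperplane[OF b] by simp
    show "distr (flat_lborel b) borel (\<lambda>x. x + w) = flat_lborel b" if "w \<in> ?H" for w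
      using hyperplane_translation[OF b] that by simp
    show "- x \<in> Q \<longleftrightarrow> x \<in> Q" for x by (auto simp: Q_def unit_cube_def)
  qed (use sM sfM trM sfN that Q in auto)
  \<comment> \<open>The balls around the grid points fill the same proportion of the cube for every mesh size.\<close>
  define \<beta> where "\<beta> = unit_ball_vol ?k * (1 / 4) ^ ?k"
  have "0 < \<beta>" by (simp add: \<beta>_def)
  have pack: "\<exists>U \<in> sets borel. U \<subseteq> Q \<and> emeasure (flat_lborel b) U = ennreal \<beta> \<and> hausdorff_pre ?k \<delta> U \<le> ennreal \<beta>"
    if "0 < \<delta>" for \<delta> :: real
  proof -
    obtain N :: nat where N: "1 / \<delta> < N" using reals_Archimedean2 by blast
    then have "0 < N" using \<open>0 < \<delta>\<close> by (cases N) (auto simp: field_simps)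
    \<comment> \<open>Half the inradius of the small cubes: then closed balls are disjoint.\<close>
    define r where "r = 1 / (4 * real N)"
    have "0 < r" using \<open>0 < N\<close> by (simp add: r_def)
    let ?B = "\<lambda>m. cball (grid_point b N m) r \<inter> ?H"
    have gb: "grid_point b N m \<bullet> b = 0" for m using b by (simp add: grid_point_inner)
    have Bs: "?B m \<in> sets borel" for m using Hs by auto
    have hB: "emeasure (flat_lborel b) (?B m) = ennreal (unit_ball_vol ?k * r ^ ?k)" for m
    proof -
      have "emeasure (flat_lborel b) (?B m) = emeasure (flat_lborel b) (cball (grid_point b N m) r)"
        by (rule emeasure_eq_AE) (use AE_hyperplane[OF b] Bs in auto)
      then show ?thesis using hyperplane_cball[OF b gb \<open>0 < r\<close>] by simp
    qed
    have total: "(\<Sum>m\<in>grid_index b N. ennreal (unit_ball_vol ?k * r ^ ?k)) = ennreal \<beta>"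
      using \<open>0 < N\<close> \<open>0 < r\<close> by (simp add: card_grid_index[OF b] ennreal_of_nat_eq_real_of_nat
        ennreal_mult'[symmetric] power_divide power_mult_distrib r_def \<beta>_def)
    have disj: "disjoint_family_on ?B (grid_index b N)"
    proof (unfold disjoint_family_on_def, intro ballI impI)
      fix m m' assume m: "m \<in> grid_index b N" "m' \<in> grid_index b N" "m \<noteq> m'"
      have far: "1 / real N \<le> dist (grid_point b N m) (grid_point b N m')"
        by (rule grid_point_separated[OF m \<open>0 < N\<close>])
      have "2 * r < 1 / real N" using \<open>0 < N\<close> by (simp add: r_def field_simps)
      have False if "x \<in> ?B m" "x \<in> ?B m'" for x
        using that far \<open>2 * r < 1 / real N\<close> dist_triangle2[of "grid_point b N m" "grid_point b N m'" x]
        by (auto simp: dist_commute)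
      then show "?B m \<inter> ?B m' = {}" by blast
    qed
    show ?thesis
    proof (intro bexI[of _ "\<Union>m\<in>grid_index b N. ?B m"] conjI)
      show U: "(\<Union>m\<in>grid_index b N. ?B m) \<in> sets borel"
        using grid_index_finite Bs by (intro sets.finite_UN) auto
      show "(\<Union>m\<in>grid_index b N. ?B m) \<subseteq> Q"
      proof safe
        fix m x assume m: "m \<in> grid_index b N" and x: "x \<in> cball (grid_point b N m) r" "x \<bullet> b = 0"
        have "\<bar>x \<bullet> c\<bar> \<le> 1 / 2" if c: "c \<in> Basis" "c \<noteq> b" for c
        proof -
          have "\<bar>(grid_point b N m - x) \<bullet> c\<bar> \<le> r"
            using Basis_le_norm[OF c(1)] x(1) by (force simp: dist_norm intro: order_trans)
          moreover have "m c < N" using m c by auto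
          then have "\<bar>grid_point b N m \<bullet> c\<bar> \<le> 1 / 2 - 2 * r"
            using c \<open>0 < N\<close> by (auto simp: grid_point_inner r_def abs_le_iff field_simps)
          ultimately show ?thesis using \<open>0 < r\<close> unfolding inner_diff_left by linarith
        qed
        then show "x \<in> Q" using x(2) by (force simp: Q_def unit_cube_def)
      qed
      have "emeasure (flat_lborel b) (\<Union>m\<in>grid_index b N. ?B m) = (\<Sum>m\<in>grid_index b N. emeasure (flat_lborel b) (?B m))"
        using grid_index_finite Bs disj by (intro sum_emeasure[symmetric]) auto
      then show "emeasure (flat_lborel b) (\<Union>m\<in>grid_index b N. ?B m) = ennreal \<beta>"
        by (simp only: hB total)
      have "hausdorff_pre ?k \<delta> (\<Union>m\<in>grid_index b N. ?B m) \<le> (\<Sum>m\<in>grid_index b N. hausdorff_pre ?k \<delta> (?B m))"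
        by (rule hausdorff_pre_UN_finite[OF that grid_index_finite])
      also have "\<dots> \<le> (\<Sum>m\<in>grid_index b N. ennreal (unit_ball_vol ?k * (2 * r / 2) ^ ?k))"
      proof (intro sum_mono hausdorff_pre_le_gauge_bound that)
        show "0 \<le> 2 * r" using \<open>0 < r\<close> by simp
        have "1 / real N < \<delta>" using N \<open>0 < N\<close> that by (simp add: field_simps)
        then show "2 * r \<le> \<delta>" using \<open>0 < N\<close> by (simp add: r_def field_simps)
        show "dist x y \<le> 2 * r" if "x \<in> ?B m" "y \<in> ?B m" for x y m
          using that dist_triangle3[of x y "grid_point b N m"] by auto
      qed
      finally show "hausdorff_pre ?k \<delta> (\<Union>m\<in>grid_index b N. ?B m) \<le> ennreal \<beta>" using total by simp
    qed
  qed
  obtain h where h: "emeasure M Q = ennreal h" "0 \<le> h"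
    using hausdorff_hyperplane_bounded_finite[OF b Qb QH] QH
    by (cases "emeasure M Q") (auto simp: M[OF Q] Int_absorb2)
  obtain q where q: "emeasure (flat_lborel b) Q = ennreal q" "0 \<le> q"
    using hyperplane_bounded_finite[OF b Qb] by (cases "emeasure (flat_lborel b) Q") auto
  obtain U0 where U0: "U0 \<in> sets borel" "U0 \<subseteq> Q" "emeasure (flat_lborel b) U0 = ennreal \<beta>"
    using pack[of 1] by auto
  then have "ennreal \<beta> \<le> ennreal q" using emeasure_mono[of U0 Q "flat_lborel b"] Q q by simp
  then have "\<beta> \<le> q" using q by (simp add: ennreal_le_iff)
  have "hausdorff_pre ?k \<delta> Q \<le> ennreal (\<beta> + (q - \<beta>) * h / q)" if d: "0 < \<delta>" for \<delta>
  proof -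
    obtain U where U: "U \<in> sets borel" "U \<subseteq> Q" "emeasure (flat_lborel b) U = ennreal \<beta>"
      "hausdorff_pre ?k \<delta> U \<le> ennreal \<beta>" using pack[OF d] by auto
    have "emeasure (flat_lborel b) (Q - U) = ennreal (q - \<beta>)"
      using U Q q \<open>0 < \<beta>\<close> by (subst emeasure_Diff) (auto simp: ennreal_minus)
    then have "emeasure M (Q - U) * ennreal q = ennreal (q - \<beta>) * ennreal h"
      using ratio[of "Q - U"] U Q q h by simp
    moreover have "emeasure M (Q - U) \<noteq> \<infinity>"
      using emeasure_mono[of "Q - U" Q M] Q sM h by (auto simp: top_unique)
    ultimately obtain r where r: "emeasure M (Q - U) = ennreal r" "0 \<le> r"
        "ennreal r * ennreal q = ennreal (q - \<beta>) * ennreal h"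
      by (cases "emeasure M (Q - U)") auto
    then have "ennreal (r * q) = ennreal ((q - \<beta>) * h)"
      using q(2) h(2) \<open>\<beta> \<le> q\<close> by (simp add: ennreal_mult)
    then have "r * q = (q - \<beta>) * h"
      using r(2) q(2) h(2) \<open>\<beta> \<le> q\<close> by (subst (asm) ennreal_inj) auto
    then have "r = (q - \<beta>) * h / q" using \<open>\<beta> \<le> q\<close> \<open>0 < \<beta>\<close> by (simp add: field_simps)
    then have MQU: "emeasure M (Q - U) = ennreal ((q - \<beta>) * h / q)" using r(1) by simp
    have "hausdorff_pre ?k \<delta> Q \<le> hausdorff_pre ?k \<delta> (U \<union> (Q - U))"
      by (rule hausdorff_pre_mono) auto
    also have "\<dots> \<le> hausdorff_pre ?k \<delta> U + hausdorff_pre ?k \<delta> (Q - U)"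
      by (rule hausdorff_pre_Un[OF d])
    also have "\<dots> \<le> ennreal \<beta> + hausdorff_outer ?k (Q - U)"
      by (intro add_mono U hausdorff_pre_le_outer d)
    also have "hausdorff_outer ?k (Q - U) = emeasure M (Q - U)"
    proof -
      have "(Q - U) \<inter> ?H = Q - U" using QH by auto
      then show ?thesis using U(1) Q by (subst M) auto
    qed
    also have "ennreal \<beta> + \<dots> = ennreal (\<beta> + (q - \<beta>) * h / q)"
      using \<open>\<beta> \<le> q\<close> \<open>0 < \<beta>\<close> h by (subst MQU) (simp add: ennreal_plus)
    finally show ?thesis .
  qed
  then have "hausdorff_outer ?k Q \<le> ennreal (\<beta> + (q - \<beta>) * h / q)" by (rule hausdorff_outer_leI)
  moreover have "hausdorff_outer ?k Q = ennreal h" using h(1) QH by (simp add: M[OF Q] Int_absorb2)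
  ultimately have "ennreal h \<le> ennreal (\<beta> + (q - \<beta>) * h / q)" by simp
  then have "h \<le> \<beta> + (q - \<beta>) * h / q"
    using \<open>\<beta> \<le> q\<close> \<open>0 < \<beta>\<close> h by (subst (asm) ennreal_le_iff) auto
  then have "h * q \<le> \<beta> * q + (q - \<beta>) * h"
    using \<open>\<beta> \<le> q\<close> \<open>0 < \<beta>\<close> by (simp add: field_simps)
  then have "\<beta> * h \<le> \<beta> * q" by (simp add: algebra_simps)
  then have "h \<le> q" using \<open>0 < \<beta>\<close> by simp
  have "emeasure M A * ennreal q = emeasure (flat_lborel b) A * ennreal h"
    using ratio[OF A(1)] q h by simp
  also have "\<dots> \<le> emeasure (flat_lborel b) A * ennreal q" by (intro mult_left_mono ennreal_leI \<open>h \<le> q\<close>) simp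
  finally have "emeasure M A \<le> emeasure (flat_lborel b) A"
    using \<open>\<beta> \<le> q\<close> \<open>0 < \<beta>\<close> by (simp add: mult.commute[of _ "ennreal q"] ennreal_mult_le_mult_iff)
  then show "hausdorff_outer ?k A \<le> emeasure (flat_lborel b) A"
    using A(2) by (simp add: M[OF A(1)] Int_absorb2)
  show "emeasure (flat_lborel b) A \<le> hausdorff_outer ?k A" by (rule hyperplane_le_hausdorff[OF b A])
qed

section \<open>Sweeping a nearly flat set along a direction\<close>

text \<open>
  Reflection in the hyperplane that bisects \<open>u\<close> and \<open>v\<close>. A reflection is preferred to a general
  rotation since it is its own inverse and its own adjoint.
\<close>

lemma reflection_exists:
  fixes u v :: "'a::euclidean_space"
  assumes "norm u = 1" "norm v = 1"
  obtains R :: "'a \<Rightarrow> 'a" where "linear R" "\<And>x. norm (R x) = norm x" "\<And>x. R (R x) = x"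
    "\<And>x y. R x \<bullet> y = x \<bullet> R y" "R u = v"
proof -
  define w where "w = v - u"
  define R where "R x = x - (2 * (x \<bullet> w) / (w \<bullet> w)) *\<^sub>R w" for x
  have lin: "linear R"
    by (rule linearI) (simp_all add: R_def inner_add_left algebra_simps add_divide_distrib)
  have adj: "R x \<bullet> y = x \<bullet> R y" for x y
    by (simp add: R_def inner_diff_left inner_diff_right inner_commute)
  have invol: "R (R x) = x" for x
  proof (cases "w = 0")
    case False
    then have "R x \<bullet> w = - (x \<bullet> w)" by (simp add: R_def inner_diff_left)
    then show ?thesis unfolding R_def[of "R x"] by (simp add: R_def)
  qed (simp add: R_def)
  have nrm: "norm (R x) = norm x" for x
    by (simp add: norm_eq_sqrt_inner adj invol)
  have "R u = v"
  proof (cases "w = 0")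
    case False
    have "u \<bullet> u = 1" "v \<bullet> v = 1" using assms by (simp_all add: norm_eq_1)
    then have "w \<bullet> w = - 2 * (u \<bullet> w)" by (simp add: w_def inner_diff_left inner_diff_right inner_commute)
    moreover have "w \<bullet> w \<noteq> 0" using False by simp
    ultimately have "2 * (u \<bullet> w) / (w \<bullet> w) = - 1" by (simp add: field_simps)
    then show ?thesis by (simp add: R_def w_def)
  qed (simp add: R_def w_def)
  with lin nrm invol adj show ?thesis by (rule that)
qed

text \<open>
  Fubini along lines that are oblique to the hyperplane: translating each parallel hyperplane within itself
  makes the lines orthogonal, which leaves only the change of scale \<open>a \<bullet> b\<close> along the lines.
\<close>

lemma nn_integral_shear:
  fixes b :: "'a::euclidean_space" and g :: "'a \<Rightarrow> ennreal"
  assumes b: "b \<in> Basis" and g [measurable]: "g \<in> borel_measurable borel" and a: "0 < a \<bullet> b"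
  shows "(\<integral>\<^sup>+ x. g x \<partial>lborel) = ennreal (a \<bullet> b) * (\<integral>\<^sup>+ y. (\<integral>\<^sup>+ t. g (y + t *\<^sub>R a) \<partial>lborel) \<partial>flat_lborel b)"
proof -
  interpret H: sigma_finite_measure "flat_lborel b"
    by (rule sigma_finite_borel_measureI) (use hyperplane_bounded_finite[OF b bounded_cball] in auto)
  interpret HL: pair_sigma_finite "flat_lborel b" "lborel :: real measure" by standard
  define p where "p = a - (a \<bullet> b) *\<^sub>R b"
  have pb: "p \<bullet> b = 0" using b by (simp add: p_def inner_diff_left)
  have tr: "(\<integral>\<^sup>+ y. f (y + w) \<partial>flat_lborel b) = (\<integral>\<^sup>+ y. f y \<partial>flat_lborel b)"
    if "w \<bullet> b = 0" and [measurable]: "f \<in> borel_measurable borel" for f :: "'a \<Rightarrow> ennreal" and w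
    by (subst hyperplane_translation[OF b that(1), symmetric]) (simp add: nn_integral_distr)
  have "(\<integral>\<^sup>+ y. (\<integral>\<^sup>+ t. g (y + t *\<^sub>R a) \<partial>lborel) \<partial>flat_lborel b) = (\<integral>\<^sup>+ t. (\<integral>\<^sup>+ y. g (y + t *\<^sub>R a) \<partial>flat_lborel b) \<partial>lborel)"
    by (rule HL.Fubini'[symmetric]) measurable
  also have "\<dots> = (\<integral>\<^sup>+ t. (\<integral>\<^sup>+ y. g (y + (t * (a \<bullet> b)) *\<^sub>R b) \<partial>flat_lborel b) \<partial>lborel)"
  proof (rule nn_integral_cong)
    fix t :: real
    have "(\<integral>\<^sup>+ y. g ((y + t *\<^sub>R p) + (t * (a \<bullet> b)) *\<^sub>R b) \<partial>flat_lborel b) = (\<integral>\<^sup>+ y. g (y + (t * (a \<bullet> b)) *\<^sub>R b) \<partial>flat_lborel b)"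
      by (rule tr) (simp add: pb, measurable)
    moreover have "(y + t *\<^sub>R p) + (t * (a \<bullet> b)) *\<^sub>R b = y + t *\<^sub>R a" for y
      by (simp add: p_def algebra_simps)
    ultimately show "(\<integral>\<^sup>+ y. g (y + t *\<^sub>R a) \<partial>flat_lborel b) = (\<integral>\<^sup>+ y. g (y + (t * (a \<bullet> b)) *\<^sub>R b) \<partial>flat_lborel b)" by simp
  qed
  also have "\<dots> = (\<integral>\<^sup>+ y. (\<integral>\<^sup>+ t. g (y + (t * (a \<bullet> b)) *\<^sub>R b) \<partial>lborel) \<partial>flat_lborel b)"
    by (rule HL.Fubini') measurable
  finally have eq: "(\<integral>\<^sup>+ y. (\<integral>\<^sup>+ t. g (y + t *\<^sub>R a) \<partial>lborel) \<partial>flat_lborel b)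
      = (\<integral>\<^sup>+ y. (\<integral>\<^sup>+ t. g (y + (t * (a \<bullet> b)) *\<^sub>R b) \<partial>lborel) \<partial>flat_lborel b)" .
  have "(\<integral>\<^sup>+ t. g (y + t *\<^sub>R b) \<partial>lborel)
      = ennreal (a \<bullet> b) * (\<integral>\<^sup>+ t. g (y + (t * (a \<bullet> b)) *\<^sub>R b) \<partial>lborel)" for y
    using a nn_integral_real_affine[of "\<lambda>t. g (y + t *\<^sub>R b)" "a \<bullet> b" 0] by (simp add: mult.commute)
  then have "(\<integral>\<^sup>+ x. g x \<partial>lborel)
      = (\<integral>\<^sup>+ y. ennreal (a \<bullet> b) * (\<integral>\<^sup>+ t. g (y + (t * (a \<bullet> b)) *\<^sub>R b) \<partial>lborel) \<partial>flat_lborel b)"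
    by (simp add: hyperplane_fubini[OF b g])
  also have "\<dots> = ennreal (a \<bullet> b) * (\<integral>\<^sup>+ y. (\<integral>\<^sup>+ t. g (y + (t * (a \<bullet> b)) *\<^sub>R b) \<partial>lborel) \<partial>flat_lborel b)"
    by (rule nn_integral_cmult) measurable
  finally show ?thesis unfolding eq .
qed

definition sweep :: "'a::real_vector set \<Rightarrow> 'a \<Rightarrow> 'a set" where
  "sweep C e = (\<lambda>(x, s). x + s *\<^sub>R e) ` (C \<times> {0..1::real})"

text \<open>
  Projection along \<open>e\<close> onto the hyperplane orthogonal to \<open>v\<close>.
\<close>

definition skew_proj :: "'a::real_inner \<Rightarrow> 'a \<Rightarrow> 'a \<Rightarrow> 'a" where
  "skew_proj v e x = x - ((x \<bullet> v) / (e \<bullet> v)) *\<^sub>R e"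

lemma compact_sweep: "compact C \<Longrightarrow> compact (sweep C e)"
  for C :: "'a::real_normed_vector set"
  unfolding sweep_def
  by (rule compact_continuous_image) (auto simp: split_def intro!: continuous_intros compact_Times)

lemma continuous_on_skew_proj: "continuous_on S (skew_proj v e)"
  unfolding skew_proj_def by (cases "e \<bullet> v = 0") (auto intro!: continuous_intros)

text \<open>
  Every line in direction \<open>e\<close> that meets \<open>C\<close> does so once, and meets the sweep in a segment of
  length \<open>\<bar>e\<bar>\<close>. So the volume is computed by oblique Fubini over the hyperplane orthogonal to \<open>v\<close>,
  after a reflection that takes \<open>v\<close> to a basis vector.
\<close>

lemma emeasure_sweep:
  fixes C :: "'a::euclidean_space set"
  assumes C: "compact C" and v: "norm v = 1" and ev: "0 < e \<bullet> v" and inj: "inj_on (skew_proj v e) C"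
  shows "emeasure lborel (sweep C e)
    = ennreal (e \<bullet> v) * hausdorff_outer (DIM('a) - 1) (skew_proj v e ` C)"
proof -
  let ?k = "DIM('a) - 1" and ?q = "skew_proj v e"
  obtain b :: 'a where b: "b \<in> Basis" using nonempty_Basis by blast
  obtain R :: "'a \<Rightarrow> 'a" where R: "linear R" "\<And>x. norm (R x) = norm x" "\<And>x. R (R x) = x"
    "\<And>x y. R x \<bullet> y = x \<bullet> R y" "R b = v"
    using reflection_exists[of b v] b v by auto
  have cR: "continuous_on X R" for X using R(1) by (simp add: linear_continuous_on linear_linear)
  then have [measurable]: "R \<in> borel \<rightarrow>\<^sub>M borel" by (intro borel_measurable_continuous_onI)
  have S [measurable]: "sweep C e \<in> sets borel"
    by (intro borel_compact compact_sweep C)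
  have a: "R e \<bullet> b = e \<bullet> v" by (simp add: R)
  have q_add: "?q (x + s *\<^sub>R e) = ?q x" for x s
    using ev by (simp add: skew_proj_def inner_add_left algebra_simps add_divide_distrib)
  have q_id: "?q x = x" if "x \<bullet> v = 0" for x using that by (simp add: skew_proj_def)
  have q_v: "?q x \<bullet> v = 0" for x using ev by (simp add: skew_proj_def inner_diff_left)
  define D where "D = R ` ?q ` C"
  have D: "compact D" unfolding D_def
    by (intro compact_continuous_image cR continuous_on_skew_proj C)
  have DH: "D \<subseteq> {x. x \<bullet> b = 0}" by (auto simp: D_def R q_v)
  have "emeasure lborel (sweep C e) = (\<integral>\<^sup>+ x. indicator (sweep C e) x \<partial>distr lborel borel R)"
    by (simp add: lborel_isometry_invariant[OF R(1-3)])
  also have "\<dots> = (\<integral>\<^sup>+ x. indicator (sweep C e) (R x) \<partial>lborel)"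
    by (rule nn_integral_distr) auto
  also have "\<dots> = ennreal (R e \<bullet> b)
      * (\<integral>\<^sup>+ y. (\<integral>\<^sup>+ t. indicator (sweep C e) (R (y + t *\<^sub>R R e)) \<partial>lborel) \<partial>flat_lborel b)"
    by (rule nn_integral_shear[OF b]) (use a ev in auto)
  also have "(\<integral>\<^sup>+ y. (\<integral>\<^sup>+ t. indicator (sweep C e) (R (y + t *\<^sub>R R e)) \<partial>lborel) \<partial>flat_lborel b)
      = (\<integral>\<^sup>+ y. indicator D y \<partial>flat_lborel b)"
  proof (rule nn_integral_cong_AE)
    have "(\<integral>\<^sup>+ t. indicator (sweep C e) (R (y + t *\<^sub>R R e)) \<partial>lborel) = indicator D y"
      if y: "y \<bullet> b = 0" for y
    proof -
      have Ry: "R (y + t *\<^sub>R R e) = R y + t *\<^sub>R e" for t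
        by (simp add: linear_add[OF R(1)] linear_cmul[OF R(1)] R)
      have yv: "R y \<bullet> v = 0" using y R by (metis)
      show ?thesis
      proof (cases "y \<in> D")
        case True
        then obtain x where x: "x \<in> C" "y = R (?q x)" by (auto simp: D_def)
        define s where "s = (x \<bullet> v) / (e \<bullet> v)"
        have Rx: "R y = x - s *\<^sub>R e" using x by (simp add: R skew_proj_def s_def)
        have "R y + t *\<^sub>R e \<in> sweep C e \<longleftrightarrow> t \<in> {s..s + 1}" for t
        proof
          assume "R y + t *\<^sub>R e \<in> sweep C e"
          then obtain x' s' where x': "x' \<in> C" "s' \<in> {0..1}" "R y + t *\<^sub>R e = x' + s' *\<^sub>R e"
            by (auto simp: sweep_def)
          then have "?q (R y + t *\<^sub>R e) = ?q (x' + s' *\<^sub>R e)" by simp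
          then have "?q x = ?q x'" unfolding q_add using q_id[OF yv] x(2) R(3) by simp
          then have "x = x'" using inj x(1) x'(1) by (auto dest: inj_onD)
          then have "(t - s) *\<^sub>R e = s' *\<^sub>R e" using x'(3) Rx by (simp add: algebra_simps)
          then show "t \<in> {s..s + 1}" using x'(2) ev by (auto simp: scaleR_cancel_right)
        next
          assume "t \<in> {s..s + 1}"
          then show "R y + t *\<^sub>R e \<in> sweep C e"
            using x(1) unfolding sweep_def
            by (intro image_eqI[of _ _ "(x, t - s)"]) (auto simp: Rx algebra_simps)
        qed
        then have "(\<integral>\<^sup>+ t. indicator (sweep C e) (R (y + t *\<^sub>R R e)) \<partial>lborel)
            = (\<integral>\<^sup>+ t. indicator {s..s + 1} t \<partial>lborel)"
          unfolding Ry by (intro nn_integral_cong) (auto simp: indicator_def)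
        then show ?thesis using True by simp
      next
        case False
        have "R y + t *\<^sub>R e \<notin> sweep C e" for t
        proof
          assume "R y + t *\<^sub>R e \<in> sweep C e"
          then obtain x' s' where x': "x' \<in> C" "R y + t *\<^sub>R e = x' + s' *\<^sub>R e"
            by (auto simp: sweep_def)
          then have "?q (R y + t *\<^sub>R e) = ?q (x' + s' *\<^sub>R e)" by simp
          then have "R y = ?q x'" unfolding q_add using q_id[OF yv] by simp
          then have "y = R (?q x')" using R(3) by metis
          then show False using False x'(1) by (auto simp: D_def)
        qed
        then show ?thesis using False by (simp add: Ry)
      qed
    qed
    then show "AE y in flat_lborel b. (\<integral>\<^sup>+ t. indicator (sweep C e) (R (y + t *\<^sub>R R e)) \<partial>lborel) = indicator D y"
      using AE_hyperplane[OF b] by (auto elim: eventually_mono)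
  qed
  also have "\<dots> = emeasure (flat_lborel b) D" using D by (simp add: borel_compact)
  also have "\<dots> = hausdorff_outer ?k D"
    by (rule hausdorff_eq_hyperplane[OF b _ DH, symmetric]) (use D in \<open>simp add: borel_compact\<close>)
  also have "\<dots> = hausdorff_outer ?k (?q ` C)"
    unfolding D_def
    by (rule hausdorff_outer_isometry) (simp add: dist_norm R flip: linear_diff[OF R(1)])
  finally show ?thesis unfolding a .
qed

text \<open>
  The projection along \<open>e\<close> moves the difference of two points of \<open>C\<close> by at most \<open>\<eta>\<close> times its length,
  hence it is Lipschitz with constant \<open>1 + \<eta>\<close> and so is its inverse with constant \<open>1 / (1 - \<eta>)\<close>.
\<close>

lemma sweep_flat_bounds:
  fixes C :: "'a::euclidean_space set"
  assumes C: "compact C" and v: "norm v = 1" and ev: "0 < e \<bullet> v"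
    and flat: "\<And>x y. x \<in> C \<Longrightarrow> y \<in> C \<Longrightarrow> \<bar>(x - y) \<bullet> v\<bar> \<le> \<epsilon> * norm (x - y)"
    and \<eta>: "\<epsilon> * norm e \<le> \<eta> * (e \<bullet> v)" "0 \<le> \<eta>" "\<eta> < 1"
  shows "emeasure lborel (sweep C e)
      \<le> ennreal (e \<bullet> v * (1 + \<eta>) ^ (DIM('a) - 1)) * hausdorff_outer (DIM('a) - 1) C"
    and "ennreal (e \<bullet> v * (1 - \<eta>) ^ (DIM('a) - 1)) * hausdorff_outer (DIM('a) - 1) C
      \<le> emeasure lborel (sweep C e)"
    and "hausdorff_outer (DIM('a) - 1) C < \<infinity>"
proof -
  let ?k = "DIM('a) - 1" and ?q = "skew_proj v e"
  have near: "norm ((?q x - ?q y) - (x - y)) \<le> \<eta> * norm (x - y)" if "x \<in> C" "y \<in> C" for x y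
  proof -
    have "(?q x - ?q y) - (x - y) = - (((x - y) \<bullet> v / (e \<bullet> v)) *\<^sub>R e)"
      by (simp add: skew_proj_def inner_diff_left diff_divide_distrib algebra_simps)
    then have "norm ((?q x - ?q y) - (x - y)) = \<bar>(x - y) \<bullet> v\<bar> * norm e / (e \<bullet> v)"
      using ev by (simp add: abs_divide)
    also have "\<dots> \<le> (\<epsilon> * norm (x - y)) * norm e / (e \<bullet> v)"
      using ev by (intro divide_right_mono mult_right_mono flat that) auto
    also have "\<dots> = (\<epsilon> * norm e) * (norm (x - y) / (e \<bullet> v))" by simp
    also have "\<dots> \<le> (\<eta> * (e \<bullet> v)) * (norm (x - y) / (e \<bullet> v))"
      using ev by (intro mult_right_mono \<eta>) auto
    finally show ?thesis using ev by simp
  qed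
  have up: "dist (?q x) (?q y) \<le> (1 + \<eta>) * dist x y" if "x \<in> C" "y \<in> C" for x y
    using near[OF that] norm_triangle_ineq[of "(?q x - ?q y) - (x - y)" "x - y"]
    by (simp add: dist_norm algebra_simps)
  have low: "(1 - \<eta>) * dist x y \<le> dist (?q x) (?q y)" if "x \<in> C" "y \<in> C" for x y
    using near[OF that] norm_triangle_ineq2[of "x - y" "(x - y) - (?q x - ?q y)"]
      norm_minus_commute[of "x - y" "?q x - ?q y"]
    by (simp add: dist_norm algebra_simps)
  have inj: "inj_on ?q C"
  proof (rule inj_onI)
    fix x y assume "x \<in> C" "y \<in> C" "?q x = ?q y"
    then have "(1 - \<eta>) * dist x y \<le> 0" using low by force
    then show "x = y" using \<eta>(3) by (simp add: mult_le_0_iff)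
  qed
  have W: "emeasure lborel (sweep C e) = ennreal (e \<bullet> v) * hausdorff_outer ?k (?q ` C)"
    by (rule emeasure_sweep[OF C v ev inj])
  have "hausdorff_outer ?k (?q ` C) \<le> ennreal ((1 + \<eta>) ^ ?k) * hausdorff_outer ?k C"
    by (rule hausdorff_outer_lipschitz_image) (use \<eta> up in auto)
  then show "emeasure lborel (sweep C e) \<le> ennreal (e \<bullet> v * (1 + \<eta>) ^ ?k) * hausdorff_outer ?k C"
    unfolding W using ev \<eta> by (simp add: ennreal_mult' mult.assoc mult_left_mono)
  have inv: "inv_into C ?q ` ?q ` C = C" using inj by simp
  have "hausdorff_outer ?k (inv_into C ?q ` ?q ` C)
      \<le> ennreal ((1 / (1 - \<eta>)) ^ ?k) * hausdorff_outer ?k (?q ` C)"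
  proof (rule hausdorff_outer_lipschitz_image)
    fix x y assume "x \<in> ?q ` C" "y \<in> ?q ` C"
    then obtain x' y' where "x' \<in> C" "y' \<in> C" "x = ?q x'" "y = ?q y'" by auto
    then show "dist (inv_into C ?q x) (inv_into C ?q y) \<le> 1 / (1 - \<eta>) * dist x y"
      using low[of x' y'] inj \<eta>(3) by (simp add: field_simps)
  qed (use \<eta> in auto)
  then have le: "hausdorff_outer ?k C \<le> ennreal ((1 / (1 - \<eta>)) ^ ?k) * hausdorff_outer ?k (?q ` C)"
    unfolding inv .
  then have "ennreal (e \<bullet> v * (1 - \<eta>) ^ ?k) * hausdorff_outer ?k C
      \<le> ennreal (e \<bullet> v * (1 - \<eta>) ^ ?k) * (ennreal ((1 / (1 - \<eta>)) ^ ?k) * hausdorff_outer ?k (?q ` C))"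
    by (rule mult_left_mono) simp
  also have "\<dots> = ennreal (e \<bullet> v * (1 - \<eta>) ^ ?k * (1 / (1 - \<eta>)) ^ ?k) * hausdorff_outer ?k (?q ` C)"
    using \<eta> ev by (simp add: ennreal_mult' mult.assoc)
  also have "e \<bullet> v * (1 - \<eta>) ^ ?k * (1 / (1 - \<eta>)) ^ ?k = e \<bullet> v"
    using \<eta>(3) by (simp add: power_divide)
  finally show "ennreal (e \<bullet> v * (1 - \<eta>) ^ ?k) * hausdorff_outer ?k C \<le> emeasure lborel (sweep C e)"
    unfolding W .
  have "emeasure lborel (sweep C e) < \<infinity>"
    by (intro emeasure_bounded_finite compact_imp_bounded compact_sweep C)
  then have "hausdorff_outer ?k (?q ` C) < \<infinity>"
    unfolding W using ev by (auto simp: ennreal_mult_less_top)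
  then show "hausdorff_outer ?k C < \<infinity>"
    using le by (auto simp: ennreal_mult_less_top intro: le_less_trans)
qed

section \<open>Outer normals of a convex body\<close>

definition touching :: "'a::euclidean_space set \<Rightarrow> 'a set \<Rightarrow> 'a set" where
  "touching K V = {x \<in> frontier K. \<exists>v\<in>V. is_outer_unit_normal K x v}"

definition smooth_points :: "'a::euclidean_space set \<Rightarrow> 'a set" where
  "smooth_points K = {x \<in> frontier K. \<exists>!v. is_outer_unit_normal K x v}"

lemma outer_unit_normal_smooth:
  assumes "x \<in> smooth_points K"
  shows "is_outer_unit_normal K x (outer_unit_normal K x)"
    and "is_outer_unit_normal K x v \<Longrightarrow> v = outer_unit_normal K x"
proof -
  have ex: "\<exists>!v. is_outer_unit_normal K x v" using assms by (simp add: smooth_points_def)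
  then have eq: "outer_unit_normal K x = (THE v. is_outer_unit_normal K x v)"
    by (simp add: outer_unit_normal_def)
  show 1: "is_outer_unit_normal K x (outer_unit_normal K x)" unfolding eq by (rule theI'[OF ex])
  show "is_outer_unit_normal K x v \<Longrightarrow> v = outer_unit_normal K x" using ex 1 by auto
qed

lemma outer_unit_normal_not_smooth:
  "x \<in> frontier K \<Longrightarrow> x \<notin> smooth_points K \<Longrightarrow> outer_unit_normal K x = 0"
  by (auto simp: smooth_points_def outer_unit_normal_def)

text \<open>
  A normal at \<open>x\<close> shows that \<open>y\<close> is almost on the lower side of the hyperplane through \<open>x\<close>, and vice
  versa.
\<close>

lemma touching_flat:
  assumes "closed K" "x \<in> touching K (cball v \<epsilon>)" "y \<in> touching K (cball v \<epsilon>)"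
  shows "\<bar>(x - y) \<bullet> v\<bar> \<le> \<epsilon> * norm (x - y)"
proof -
  have half: "(y - x) \<bullet> v \<le> \<epsilon> * norm (x - y)"
    if xy: "x \<in> touching K (cball v \<epsilon>)" "y \<in> touching K (cball v \<epsilon>)" for x y
  proof -
    obtain w where w: "w \<in> cball v \<epsilon>" "is_outer_unit_normal K x w" using xy(1) by (auto simp: touching_def)
    have "y \<in> K" using xy(2) assms(1) by (auto simp: touching_def frontier_def)
    then have "(y - x) \<bullet> w \<le> 0" using w(2) by (auto simp: is_outer_unit_normal_def)
    then have "(y - x) \<bullet> v \<le> (y - x) \<bullet> (v - w)" by (simp add: inner_diff_right)
    also have "\<dots> \<le> norm (y - x) * norm (v - w)" by (rule norm_cauchy_schwarz)
    also have "\<dots> \<le> norm (y - x) * \<epsilon>" using w(1) by (intro mult_left_mono) (auto simp: dist_norm)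
    finally show ?thesis by (simp add: mult.commute norm_minus_commute)
  qed
  show ?thesis
    using half[OF assms(2,3)] half[OF assms(3,2)] by (simp add: inner_diff_left norm_minus_commute)
qed

locale convex_body =
  fixes K :: "'a::euclidean_space set"
  assumes K_compact: "compact K" and K_convex: "convex K" and K_zero: "0 \<in> interior K"
begin

lemma K_closed: "closed K" using K_compact by (rule compact_imp_closed)

lemma frontier_compact: "compact (frontier K)" using K_compact by (rule compact_frontier)

lemma frontier_subset: "frontier K \<subseteq> K" using K_closed by (auto simp: frontier_def)

lemma compact_touching:
  assumes "closed V"
  shows "compact (touching K V)"
proof -
  define N where "N = (frontier K \<times> (sphere 0 1 \<inter> V)) \<inter> (\<Inter>y\<in>K. {p. (y - fst p) \<bullet> snd p \<le> 0})"
  have N: "(x, v) \<in> N \<longleftrightarrow> x \<in> frontier K \<and> v \<in> V \<and> is_outer_unit_normal K x v" for x v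
    by (auto simp: N_def is_outer_unit_normal_def)
  have "touching K V = fst ` N"
    by (auto simp: touching_def N image_iff Bex_def) blast
  moreover have "compact N" unfolding N_def
    by (intro compact_Int_closed compact_Times frontier_compact compact_sphere closed_INT ballI
        closed_Collect_le continuous_intros assms)
  ultimately show ?thesis by (simp add: compact_continuous_image continuous_on_fst)
qed

lemma touching_borel: "closed V \<Longrightarrow> touching K V \<in> sets borel"
  by (intro borel_compact compact_touching)

lemma normal_exists:
  assumes "x \<in> frontier K"
  shows "\<exists>v. is_outer_unit_normal K x v"
proof -
  have "interior K \<noteq> {}" using K_zero by auto
  then have "x \<notin> rel_interior K" using assms by (simp add: rel_interior_nonempty_interior frontier_def)
  moreover have "x \<in> K" using assms frontier_subset by auto
  ultimately obtain a where a: "a \<noteq> 0" "\<And>y. y \<in> K \<Longrightarrow> a \<bullet> x \<le> a \<bullet> y"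
    using supporting_hyperplane_rel_boundary[OF K_convex] by metis
  have "is_outer_unit_normal K x (- (a /\<^sub>R norm a))"
    unfolding is_outer_unit_normal_def
  proof (intro conjI ballI)
    show "norm (- (a /\<^sub>R norm a)) = 1" using a(1) by simp
    fix y assume "y \<in> K"
    then have "0 \<le> (y - x) \<bullet> a" using a(2)[of y] by (simp add: inner_diff_left inner_diff_right inner_commute[of _ a])
    then show "(y - x) \<bullet> - (a /\<^sub>R norm a) \<le> 0" by simp
  qed
  then show ?thesis by blast
qed

lemma normal_inner_pos:
  assumes "is_outer_unit_normal K x v"
  shows "0 < x \<bullet> v"
proof -
  obtain r where r: "0 < r" "cball 0 r \<subseteq> K" using K_zero by (auto simp: mem_interior_cball)
  have nv: "norm v = 1" using assms by (simp add: is_outer_unit_normal_def)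
  then have "r *\<^sub>R v \<in> K" using r by (intro subsetD[OF r(2)]) simp
  then have "(r *\<^sub>R v - x) \<bullet> v \<le> 0" using assms by (simp add: is_outer_unit_normal_def)
  then have "r \<le> x \<bullet> v" using nv by (simp add: inner_diff_left norm_eq_1)
  then show ?thesis using r(1) by linarith
qed

text \<open>
  If a point has two normals, they are separated by two small balls with centres in a countable dense set, and
  the points with normals in two given closed balls form a compact set.
\<close>

lemma smooth_points_borel: "smooth_points K \<in> sets borel"
proof -
  obtain D :: "'a set" where D: "countable D" "\<And>X. open X \<Longrightarrow> X \<noteq> {} \<Longrightarrow> \<exists>d\<in>D. d \<in> X"
    using countable_dense_exists by blast
  let ?I = "{(p, q, n). p \<in> D \<and> q \<in> D \<and> 2 / real (Suc n) < dist p q}"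
  let ?T = "\<lambda>(p, q, n). touching K (cball p (1 / Suc n)) \<inter> touching K (cball q (1 / Suc n))"
  have "frontier K - smooth_points K = (\<Union>i\<in>?I. ?T i)"
  proof (intro equalityI subsetI)
    fix x assume x: "x \<in> frontier K - smooth_points K"
    obtain v where v: "is_outer_unit_normal K x v" using normal_exists x by auto
    then obtain w where w: "is_outer_unit_normal K x w" "v \<noteq> w" using x by (auto simp: smooth_points_def)
    obtain n where n: "4 / dist v w < real n" using reals_Archimedean2 by blast
    then have "4 < real n * dist v w" using w(2) by (simp add: pos_divide_less_eq)
    also have "\<dots> \<le> real (Suc n) * dist v w" by (intro mult_right_mono) auto
    finally have n': "4 / real (Suc n) < dist v w" by (simp only: pos_divide_less_eq of_nat_0_less_iff zero_less_Suc mult.commute)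
    obtain p where p: "p \<in> D" "p \<in> ball v (1 / Suc n)" using D(2)[of "ball v (1 / Suc n)"] by auto
    obtain q where q: "q \<in> D" "q \<in> ball w (1 / Suc n)" using D(2)[of "ball w (1 / Suc n)"] by auto
    have "dist v w \<le> dist v p + dist p q + dist q w" by metric
    then have "2 / real (Suc n) < dist p q" using n' p(2) q(2) by (simp add: dist_commute)
    moreover have "x \<in> ?T (p, q, n)"
    proof -
      have "v \<in> cball p (1 / Suc n)" "w \<in> cball q (1 / Suc n)" using p(2) q(2) by (auto simp: dist_commute)
      then show ?thesis using x v w(1) unfolding touching_def by blast
    qed
    ultimately show "x \<in> (\<Union>i\<in>?I. ?T i)" using p(1) q(1) by blast
  next
    fix x assume "x \<in> (\<Union>i\<in>?I. ?T i)"
    then obtain p q n v w where *: "2 / real (Suc n) < dist p q" "x \<in> frontier K"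
      "is_outer_unit_normal K x v" "is_outer_unit_normal K x w" "dist p v \<le> 1 / Suc n" "dist q w \<le> 1 / Suc n"
      by (auto simp: touching_def)
    have "v \<noteq> w"
    proof
      assume "v = w"
      then have "dist p q \<le> 1 / Suc n + 1 / Suc n"
        using *(5,6) dist_triangle2[of p q v] by auto
      then show False using *(1) by (simp add: field_simps)
    qed
    then show "x \<in> frontier K - smooth_points K" using * by (auto simp: smooth_points_def)
  qed
  moreover have "(\<Union>i\<in>?I. ?T i) \<in> sets borel"
  proof (rule sets.countable_UN'')
    show "countable ?I"
      by (rule countable_subset[of _ "D \<times> D \<times> UNIV"]) (auto intro!: countable_SIGMA D(1))
    show "?T i \<in> sets borel" if "i \<in> ?I" for i using that by (auto intro!: sets.Int touching_borel)
  qed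
  ultimately have "frontier K - (frontier K - smooth_points K) \<in> sets borel"
    using borel_compact[OF frontier_compact] by auto
  moreover have "frontier K - (frontier K - smooth_points K) = smooth_points K"
    by (auto simp: smooth_points_def)
  ultimately show ?thesis by simp
qed

definition normal :: "'a \<Rightarrow> 'a" where
  "normal x = (if x \<in> smooth_points K then outer_unit_normal K x else 0)"

lemma normal_measurable [measurable]: "normal \<in> borel \<rightarrow>\<^sub>M borel"
proof (rule borel_measurableI)
  fix U :: "'a set" assume "open U"
  have eq: "smooth_points K \<inter> normal -` U = smooth_points K - touching K (- U)"
  proof -
    have "x \<in> touching K (- U) \<longleftrightarrow> normal x \<notin> U" if x: "x \<in> smooth_points K" for x
    proof -
      have "is_outer_unit_normal K x v \<longleftrightarrow> v = outer_unit_normal K x" for v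
        using outer_unit_normal_smooth[OF x] by metis
      moreover have "x \<in> frontier K" using x by (simp add: smooth_points_def)
      ultimately show ?thesis using x by (simp add: touching_def normal_def)
    qed
    then show ?thesis by blast
  qed
  have "touching K (- U) \<in> sets borel" using \<open>open U\<close> by (intro touching_borel) auto
  then have "smooth_points K \<inter> normal -` U \<in> sets borel" unfolding eq using smooth_points_borel by auto
  moreover have "- smooth_points K \<in> sets borel" using smooth_points_borel by auto
  ultimately have "(smooth_points K \<inter> normal -` U) \<union> (if 0 \<in> U then - smooth_points K else {}) \<in> sets borel"
    by (cases "0 \<in> U") auto
  also have "(smooth_points K \<inter> normal -` U) \<union> (if 0 \<in> U then - smooth_points K else {}) = normal -` U"
    by (auto simp: normal_def split: if_splits)
  finally show "normal -` U \<inter> space borel \<in> sets borel" by simp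
qed

lemma touching_sweep_bounds:
  assumes C: "compact C" "C \<subseteq> touching K (cball v \<epsilon>)" and v: "norm v = 1" and ev: "0 < e \<bullet> v"
    and \<eta>: "\<epsilon> * norm e \<le> \<eta> * (e \<bullet> v)" "0 \<le> \<eta>" "\<eta> < 1"
  shows "emeasure lborel (sweep C e)
      \<le> ennreal (e \<bullet> v * (1 + \<eta>) ^ (DIM('a) - 1)) * hausdorff_outer (DIM('a) - 1) C"
    and "ennreal (e \<bullet> v * (1 - \<eta>) ^ (DIM('a) - 1)) * hausdorff_outer (DIM('a) - 1) C
      \<le> emeasure lborel (sweep C e)"
    and "hausdorff_outer (DIM('a) - 1) C < \<infinity>"
proof -
  have "\<bar>(x - y) \<bullet> v\<bar> \<le> \<epsilon> * norm (x - y)" if "x \<in> C" "y \<in> C" for x y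
    using touching_flat[OF K_closed] that C(2) by blast
  note sweep_flat_bounds[OF C(1) v ev this \<eta>]
  then show "emeasure lborel (sweep C e)
      \<le> ennreal (e \<bullet> v * (1 + \<eta>) ^ (DIM('a) - 1)) * hausdorff_outer (DIM('a) - 1) C"
    and "ennreal (e \<bullet> v * (1 - \<eta>) ^ (DIM('a) - 1)) * hausdorff_outer (DIM('a) - 1) C
      \<le> emeasure lborel (sweep C e)"
    and "hausdorff_outer (DIM('a) - 1) C < \<infinity>" by blast+
qed

end

section \<open>The upper boundary and its projection\<close>

locale symmetric_body = convex_body K for K :: "'a::euclidean_space set" +
  fixes b :: 'a
  assumes b: "b \<in> Basis" and K_sym: "\<And>x. x \<in> K \<Longrightarrow> x - (2 * (x \<bullet> b)) *\<^sub>R b \<in> K"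
begin

text \<open>
  On points of \<open>K\<close> this is the distance that one can move in direction \<open>b\<close> without leaving \<open>K\<close>. The value
  elsewhere is arbitrary, but fixed to keep the function measurable.
\<close>

definition height :: "'a \<Rightarrow> real" where
  "height y = (if y \<in> K then Sup {t. y + t *\<^sub>R b \<in> K} else 0)"

definition top_point :: "'a \<Rightarrow> 'a" where
  "top_point y = y + height y *\<^sub>R b"

text \<open>
  A set of boundary points is measured by its projection to the hyperplane, as far as it is seen from above.
\<close>

definition top_measure :: "'a measure" where
  "top_measure = distr (density (flat_lborel b) (indicator K)) borel top_point"

abbreviation shadow :: "'a \<Rightarrow> 'a" where
  "shadow \<equiv> skew_proj b b"

lemma shadow_eq: "shadow x = x - (x \<bullet> b) *\<^sub>R b"
  using b by (simp add: skew_proj_def)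

text \<open>
  The shadow is the midpoint of the point and its mirror image.
\<close>

lemma shadow_in_K: "x \<in> K \<Longrightarrow> shadow x \<in> K"
proof -
  assume x: "x \<in> K"
  have "(1 / 2) *\<^sub>R x + (1 / 2) *\<^sub>R (x - (2 * (x \<bullet> b)) *\<^sub>R b) \<in> K"
    by (rule convexD[OF K_convex x K_sym[OF x]]) auto
  moreover have "(1 / 2) *\<^sub>R x + (1 / 2) *\<^sub>R (x - (2 * (x \<bullet> b)) *\<^sub>R b) = shadow x"
    unfolding shadow_eq by (simp add: algebra_simps flip: scaleR_add_left)
  ultimately show ?thesis by simp
qed

lemma fibre_bounded: 
  assumes "y \<in> K" "y + t *\<^sub>R b \<in> K"
  shows "\<bar>t\<bar> \<le> diameter K"
proof -
  have "dist (y + t *\<^sub>R b) y \<le> diameter K"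
    by (rule diameter_bounded_bound) (use assms K_compact compact_imp_bounded in auto)
  then show ?thesis using b by (simp add: dist_norm)
qed

lemma compact_fibre: "y \<in> K \<Longrightarrow> compact {t. y + t *\<^sub>R b \<in> K}"
proof -
  assume y: "y \<in> K"
  have "closed ((\<lambda>t. y + t *\<^sub>R b) -` K)"
    by (intro closed_vimage K_closed continuous_intros)
  moreover have "bounded {t. y + t *\<^sub>R b \<in> K}" using fibre_bounded[OF y] by (auto simp: bounded_iff)
  ultimately show ?thesis by (simp add: compact_eq_bounded_closed vimage_def)
qed

lemma
  assumes "y \<in> K"
  shows top_point_in_K: "top_point y \<in> K"
    and height_upper: "y + t *\<^sub>R b \<in> K \<Longrightarrow> t \<le> height y"
    and height_nonneg: "0 \<le> height y"
proof -
  have ne: "{t. y + t *\<^sub>R b \<in> K} \<noteq> {}" using assms by (auto intro!: exI[of _ 0])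
  have h: "height y = Sup {t. y + t *\<^sub>R b \<in> K}" using assms by (simp add: height_def)
  have bdd: "bdd_above {t. y + t *\<^sub>R b \<in> K}"
    using compact_imp_bounded[OF compact_fibre[OF assms]] by (rule bounded_imp_bdd_above)
  have "Sup {t. y + t *\<^sub>R b \<in> K} \<in> {t. y + t *\<^sub>R b \<in> K}"
    by (rule closed_contains_Sup[OF ne bdd]) (use compact_fibre[OF assms] compact_imp_closed in auto)
  then show "top_point y \<in> K" by (simp add: top_point_def h)
  show up: "t \<le> height y" if "y + t *\<^sub>R b \<in> K" for t
    unfolding h by (rule cSup_upper) (use that bdd in auto)
  show "0 \<le> height y" using up[of 0] assms by simp
qed

lemma height_measurable [measurable]: "height \<in> borel_measurable borel"
  unfolding borel_measurable_iff_ge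
proof
  fix a :: real
  let ?D = "diameter K"
  let ?X = "(K \<times> {a..?D}) \<inter> {p. fst p + snd p *\<^sub>R b \<in> K}"
  have "closed ((\<lambda>p::'a \<times> real. fst p + snd p *\<^sub>R b) -` K)"
    by (intro closed_vimage K_closed continuous_intros)
  then have "compact ?X" 
    by (intro compact_Int_closed compact_Times K_compact) (auto simp: vimage_def)
  then have "compact (fst ` ?X)" by (intro compact_continuous_image continuous_on_fst continuous_on_id)
  then have 1: "fst ` ?X \<in> sets borel" by (rule borel_compact)
  have "{y. a \<le> height y} = fst ` ?X \<union> (if a \<le> 0 then - K else {})"
  proof (intro equalityI subsetI)
    fix y assume "y \<in> {y. a \<le> height y}"
    then have y: "a \<le> height y" by simp
    show "y \<in> fst ` ?X \<union> (if a \<le> 0 then - K else {})"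
    proof (cases "y \<in> K")
      case True
      have "y + height y *\<^sub>R b \<in> K" using top_point_in_K[OF True] by (simp add: top_point_def)
      moreover from fibre_bounded[OF True this] have "height y \<le> ?D" by simp
      ultimately have "(y, height y) \<in> ?X" using y True by auto
      then show ?thesis by force
    next
      case False
      then show ?thesis using y by (simp add: height_def)
    qed
  next
    fix y assume y: "y \<in> fst ` ?X \<union> (if a \<le> 0 then - K else {})"
    show "y \<in> {y. a \<le> height y}"
    proof (cases "y \<in> fst ` ?X")
      case True
      then obtain t where "y \<in> K" "a \<le> t" "y + t *\<^sub>R b \<in> K" by auto
      then show ?thesis using height_upper[of y t] by auto
    next
      case False
      then show ?thesis using y by (auto simp: height_def split: if_splits)
    qed
  qed
  moreover have "(if a \<le> 0 then - K else {}) \<in> sets borel" using K_closed by auto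
  ultimately show "{w \<in> space borel. a \<le> height w} \<in> sets borel" using 1 by simp
qed

lemma top_point_measurable [measurable]: "top_point \<in> borel \<rightarrow>\<^sub>M borel"
  unfolding top_point_def by measurable

lemma K_borel [measurable]: "K \<in> sets borel" using K_compact by (rule borel_compact)

lemma sets_top_measure [simp, measurable_cong]: "sets top_measure = sets borel"
  and space_top_measure [simp]: "space top_measure = UNIV"
  by (simp_all add: top_measure_def)

lemma emeasure_top_measure:
  assumes [measurable]: "A \<in> sets borel"
  shows "emeasure top_measure A = emeasure (flat_lborel b) {y \<in> K. top_point y \<in> A}"
proof -
  have *: "top_point -` A \<in> sets borel" using measurable_sets[OF top_point_measurable assms] by simp
  have "emeasure top_measure A = (\<integral>\<^sup>+ y. indicator K y * indicator (top_point -` A) y \<partial>flat_lborel b)"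
    unfolding top_measure_def using * by (subst emeasure_distr) (auto simp: emeasure_density)
  also have "\<dots> = (\<integral>\<^sup>+ y. indicator {y \<in> K. top_point y \<in> A} y \<partial>flat_lborel b)"
    by (intro nn_integral_cong) (auto simp: indicator_def)
  also have "\<dots> = emeasure (flat_lborel b) {y \<in> K. top_point y \<in> A}"
    by (rule nn_integral_indicator) measurable
  finally show ?thesis .
qed

lemma top_measure_finite: "emeasure top_measure A < \<infinity>"
proof -
  have "emeasure top_measure A \<le> emeasure top_measure (space top_measure)"
    by (rule emeasure_space)
  also have "\<dots> \<le> emeasure (flat_lborel b) K"
    by (subst space_top_measure, subst emeasure_top_measure) (auto intro!: emeasure_mono)
  also have "\<dots> < \<infinity>" using hyperplane_bounded_finite[OF b compact_imp_bounded[OF K_compact]] .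
  finally show ?thesis .
qed

lemma top_point_eq:
  assumes x: "x \<in> frontier K" and v: "is_outer_unit_normal K x v" "0 < v \<bullet> b"
  shows "top_point (shadow x) = x"
proof -
  have xK: "x \<in> K" using x frontier_subset by auto
  have sK: "shadow x \<in> K" by (rule shadow_in_K[OF xK])
  have "shadow x + (x \<bullet> b) *\<^sub>R b \<in> K" using xK by (simp add: shadow_eq)
  then have le: "x \<bullet> b \<le> height (shadow x)" by (rule height_upper[OF sK])
  have "top_point (shadow x) - x = (height (shadow x) - x \<bullet> b) *\<^sub>R b"
    by (simp add: top_point_def shadow_eq algebra_simps)
  moreover have "(top_point (shadow x) - x) \<bullet> v \<le> 0"
    using v(1) top_point_in_K[OF sK] by (auto simp: is_outer_unit_normal_def)
  ultimately have "(height (shadow x) - x \<bullet> b) * (v \<bullet> b) \<le> 0" by (simp add: inner_commute)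
  then have "height (shadow x) \<le> x \<bullet> b" using v(2) by (simp add: mult_le_0_iff)
  then show ?thesis using le by (simp add: top_point_def shadow_eq)
qed

lemma top_measure_compact:
  assumes C: "compact C" and top: "\<And>x. x \<in> C \<Longrightarrow> x \<in> frontier K \<and> (\<exists>v. is_outer_unit_normal K x v \<and> 0 < v \<bullet> b)"
  shows "emeasure top_measure C = emeasure lborel (sweep C b)"
proof -
  have tp: "top_point (shadow x) = x" if "x \<in> C" for x using top[OF that] top_point_eq by blast
  have inj: "inj_on shadow C" by (metis inj_onI tp)
  have sC: "shadow ` C \<in> sets borel"
    by (intro borel_compact compact_continuous_image continuous_on_skew_proj C)
  have mC: "{y \<in> K. top_point y \<in> C} \<in> sets borel"
    using C borel_compact by measurable
  have "emeasure (flat_lborel b) {y \<in> K. top_point y \<in> C} = emeasure (flat_lborel b) (shadow ` C)"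
  proof (rule emeasure_eq_AE)
    show "AE y in flat_lborel b. y \<in> {y \<in> K. top_point y \<in> C} \<longleftrightarrow> y \<in> shadow ` C"
      using AE_hyperplane[OF b]
    proof eventually_elim
      case (elim y)
      have "y \<in> shadow ` C" if "y \<in> K" "top_point y \<in> C"
      proof -
        have "shadow (top_point y) = y" using elim b by (simp add: shadow_eq top_point_def inner_add_left)
        then show ?thesis using that(2) by (metis imageI)
      qed
      moreover have "y \<in> K \<and> top_point y \<in> C" if "y \<in> shadow ` C"
        using that tp top frontier_subset shadow_in_K by auto
      ultimately show ?case by auto
    qed
  qed (use sC mC in auto)
  also have "\<dots> = hausdorff_outer (DIM('a) - 1) (shadow ` C)"
    by (rule hausdorff_eq_hyperplane[OF b sC, symmetric]) (use b in \<open>auto simp: shadow_eq inner_diff_left\<close>)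
  also have "\<dots> = emeasure lborel (sweep C b)"
    using emeasure_sweep[OF C _ _ inj] b by simp
  finally show ?thesis using C borel_compact by (subst emeasure_top_measure) auto
qed

end

section \<open>The projection measure is the normal component times Hausdorff measure\<close>

lemma compact_regularity_le:
  fixes M N :: "'a::euclidean_space measure"
  assumes M: "sets M = sets borel" and N: "sets N = sets borel"
    and P: "P \<in> sets borel" "emeasure M P < \<infinity>"
    and le: "\<And>C. compact C \<Longrightarrow> C \<subseteq> P \<Longrightarrow> c * emeasure M C \<le> d * emeasure N C"
    and A: "A \<in> sets borel" "A \<subseteq> P"
  shows "c * emeasure M A \<le> d * emeasure N A"
proof -
  define M' where "M' = density M (indicator P)"
  have M': "emeasure M' B = emeasure M (B \<inter> P)" if "B \<in> sets borel" for B
  proof -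
    have "emeasure M' B = (\<integral>\<^sup>+ x. indicator P x * indicator B x \<partial>M)"
      unfolding M'_def using that P M by (subst emeasure_density) (auto simp: measurable_cong_sets[OF M refl])
    also have "\<dots> = (\<integral>\<^sup>+ x. indicator (B \<inter> P) x \<partial>M)"
      by (intro nn_integral_cong) (auto simp: indicator_def)
    also have "\<dots> = emeasure M (B \<inter> P)" using that P M by (intro nn_integral_indicator) auto
    finally show ?thesis .
  qed
  have sM': "sets M' = sets borel" using M by (simp add: M'_def)
  have fin: "emeasure M' (space M') \<noteq> \<infinity>"
    using P(2) M'[of UNIV] sets_eq_imp_space_eq[OF sM'] by simp
  have "emeasure M A = emeasure M' A" using A by (simp add: M' Int_absorb2)
  also have "\<dots> = (SUP C\<in>{C. C \<subseteq> A \<and> compact C}. emeasure M' C)"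
    by (rule inner_regular[OF sM' fin A(1)])
  finally have "c * emeasure M A = (SUP C\<in>{C. C \<subseteq> A \<and> compact C}. c * emeasure M' C)"
    by (simp add: SUP_mult_left_ennreal)
  also have "\<dots> \<le> d * emeasure N A"
  proof (rule SUP_least)
    fix C assume "C \<in> {C. C \<subseteq> A \<and> compact C}"
    then have C: "C \<subseteq> A" "compact C" by auto
    have "c * emeasure M' C = c * emeasure M C"
    proof -
      have "C \<inter> P = C" using C A by auto
      then show ?thesis using C by (simp add: M' borel_compact)
    qed
    also have "\<dots> \<le> d * emeasure N C" using le C A by auto
    also have "\<dots> \<le> d * emeasure N A"
      using C A N by (intro mult_left_mono emeasure_mono) auto
    finally show "c * emeasure M' C \<le> d * emeasure N A" .
  qed
  finally show ?thesis .
qed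

context symmetric_body
begin

lemma linear_shadow: "linear shadow"
  by (rule linearI) (simp_all add: shadow_eq inner_add_left algebra_simps)

text \<open>
  A boundary point of \<open>K\<close> in the hyperplane lies on the boundary of the convex cylinder over \<open>K\<close>:
  otherwise a slightly larger multiple of it would be in \<open>K\<close>, which together with the
  interior point \<open>0\<close> would make it an interior point of \<open>K\<close>.
\<close>

lemma hyperplane_frontier_null: "emeasure (flat_lborel b) (frontier K) = 0"
proof -
  define P where "P = shadow -` K"
  have "convex P" unfolding P_def by (rule convex_linear_vimage[OF linear_shadow K_convex])
  have "x \<in> frontier P" if x: "shadow x \<in> frontier K" for x
  proof -
    have "x \<in> P" using x frontier_subset by (auto simp: P_def)
    moreover have "x \<notin> interior P"
    proof
      assume "x \<in> interior P"
      then obtain r where r: "0 < r" "cball x r \<subseteq> P" by (auto simp: mem_interior_cball)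
      define \<delta> where "\<delta> = r / (norm x + 1)"
      have "0 < \<delta>" using r(1) by (simp add: \<delta>_def add_nonneg_pos)
      have "\<delta> * norm x \<le> \<delta> * (norm x + 1)" using \<open>0 < \<delta>\<close> by simp
      also have "\<dots> = r" by (simp add: \<delta>_def add_nonneg_eq_0_iff)
      finally have "x + \<delta> *\<^sub>R x \<in> cball x r" using \<open>0 < \<delta>\<close> by (simp add: dist_norm)
      then have "shadow (x + \<delta> *\<^sub>R x) \<in> K" using r(2) by (auto simp: P_def)
      then have K: "(1 + \<delta>) *\<^sub>R shadow x \<in> K"
        by (simp add: linear_add[OF linear_shadow] linear_cmul[OF linear_shadow] scaleR_add_left)
      have "(1 + \<delta>) *\<^sub>R shadow x - (\<delta> / (1 + \<delta>)) *\<^sub>R ((1 + \<delta>) *\<^sub>R shadow x - 0) \<in> interior K"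
        by (rule mem_interior_convex_shrink[OF K_convex K_zero K]) (use \<open>0 < \<delta>\<close> in auto)
      moreover have "(1 + \<delta>) *\<^sub>R shadow x - (\<delta> / (1 + \<delta>)) *\<^sub>R ((1 + \<delta>) *\<^sub>R shadow x - 0) = shadow x"
        using \<open>0 < \<delta>\<close> by (simp flip: scaleR_diff_left)
      ultimately show False using x by (simp add: frontier_def)
    qed
    ultimately show ?thesis using closure_subset by (auto simp: frontier_def)
  qed
  then have "{x. x - (x \<bullet> b) *\<^sub>R b \<in> frontier K \<and> x \<bullet> b \<in> {0..1}} \<subseteq> frontier P"
    by (auto simp: shadow_eq)
  moreover have "frontier P \<in> null_sets lborel"
    using negligible_convex_frontier[OF \<open>convex P\<close>]
    by (simp add: negligible_iff_null_sets null_sets_completion_iff)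
  ultimately have "emeasure lborel {x. x - (x \<bullet> b) *\<^sub>R b \<in> frontier K \<and> x \<bullet> b \<in> {0..1}} \<le> 0"
    by (metis emeasure_mono null_setsD1 null_setsD2)
  then show ?thesis
    using frontier_compact by (subst emeasure_hyperplane_cylinder[OF b]) (auto simp: borel_compact)
qed

lemma AE_hyperplane_interior: "AE y in flat_lborel b. y \<in> K \<longrightarrow> y \<in> interior K"
proof -
  have "frontier K \<in> null_sets (flat_lborel b)"
    using hyperplane_frontier_null frontier_compact by (auto simp: borel_compact)
  then have "AE y in flat_lborel b. y \<notin> frontier K" by (rule AE_not_in)
  then show ?thesis by eventually_elim (use K_closed in \<open>auto simp: frontier_def\<close>)
qed

lemma
  assumes y: "y \<in> interior K"
  shows height_pos: "0 < height y"
    and top_point_frontier: "top_point y \<in> frontier K"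
    and top_normal_pos: "is_outer_unit_normal K (top_point y) v \<Longrightarrow> 0 < v \<bullet> b"
proof -
  have yK: "y \<in> K" using y interior_subset by auto
  obtain r where r: "0 < r" "cball y r \<subseteq> K" using y by (auto simp: mem_interior_cball)
  have "y + r *\<^sub>R b \<in> K" using r b by (intro subsetD[OF r(2)]) (simp add: dist_norm)
  then show h: "0 < height y" using height_upper[OF yK] r(1) by force
  have "top_point y \<notin> interior K"
  proof
    assume "top_point y \<in> interior K"
    then obtain s where s: "0 < s" "cball (top_point y) s \<subseteq> K" by (auto simp: mem_interior_cball)
    have "top_point y + s *\<^sub>R b \<in> K" using s b by (intro subsetD[OF s(2)]) (simp add: dist_norm)
    then have "y + (height y + s) *\<^sub>R b \<in> K" by (simp add: top_point_def algebra_simps)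
    then show False using height_upper[OF yK] s(1) by force
  qed
  then show "top_point y \<in> frontier K"
    using top_point_in_K[OF yK] closure_subset by (auto simp: frontier_def)
  assume v: "is_outer_unit_normal K (top_point y) v"
  then have nv: "norm v = 1" by (simp add: is_outer_unit_normal_def)
  have "y + r *\<^sub>R v \<in> K" using r nv by (intro subsetD[OF r(2)]) (simp add: dist_norm)
  then have "(y + r *\<^sub>R v - top_point y) \<bullet> v \<le> 0" using v by (simp add: is_outer_unit_normal_def)
  moreover have "y + r *\<^sub>R v - top_point y = r *\<^sub>R v - height y *\<^sub>R b" by (simp add: top_point_def)
  ultimately have "r \<le> height y * (v \<bullet> b)"
    using nv by (simp add: inner_diff_left norm_eq_1 inner_commute[of b v])
  then have "0 < height y * (v \<bullet> b)" using r(1) by linarith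
  then show "0 < v \<bullet> b" using h by (simp add: zero_less_mult_iff)
qed

lemma top_measure_sweep:
  assumes "compact C" "C \<subseteq> touching K (cball v \<epsilon>)" "\<epsilon> < v \<bullet> b"
  shows "emeasure top_measure C = emeasure lborel (sweep C b)"
proof (rule top_measure_compact[OF assms(1)])
  fix x assume "x \<in> C"
  then obtain w where w: "x \<in> frontier K" "w \<in> cball v \<epsilon>" "is_outer_unit_normal K x w"
    using assms(2) by (auto simp: touching_def)
  have "(v - w) \<bullet> b \<le> norm (v - w) * norm b" by (rule norm_cauchy_schwarz)
  also have "\<dots> \<le> \<epsilon>" using w(2) b by (simp add: dist_norm)
  finally have "0 < w \<bullet> b" using assms(3) by (simp add: inner_diff_left)
  then show "x \<in> frontier K \<and> (\<exists>v. is_outer_unit_normal K x v \<and> 0 < v \<bullet> b)" using w by blast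
qed

text \<open>
  The sweep of \<open>C\<close> along \<open>e\<close> has volume close to \<open>(e \<bullet> v) H C\<close> and also close to \<open>(e \<bullet> w) H C\<close>. As
  \<open>e \<bullet> w < e \<bullet> v\<close>, this forces \<open>H C = 0\<close> when the errors are small enough, and the sweep along \<open>b\<close>
  is then null as well.
\<close>

lemma two_normals_null_aux:
  assumes v: "norm v = 1" "0 < v \<bullet> b" and w: "norm w = 1" and e: "0 < e \<bullet> w" "e \<bullet> w < e \<bullet> v"
  shows "\<exists>\<epsilon>>0. emeasure top_measure (touching K (cball v \<epsilon>) \<inter> touching K (cball w \<epsilon>)) = 0"
proof -
  let ?k = "DIM('a) - 1"
  have "((\<lambda>\<eta>. e \<bullet> v * (1 - \<eta>) ^ ?k - e \<bullet> w * (1 + \<eta>) ^ ?k) \<longlongrightarrow>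
      e \<bullet> v * (1 - 0) ^ ?k - e \<bullet> w * (1 + 0) ^ ?k) (at_right 0)"
    by (intro tendsto_intros)
  then have "\<forall>\<^sub>F \<eta> in at_right 0. 0 < e \<bullet> v * (1 - \<eta>) ^ ?k - e \<bullet> w * (1 + \<eta>) ^ ?k"
    by (rule order_tendstoD(1)) (use e in simp)
  moreover have "\<forall>\<^sub>F \<eta>::real in at_right 0. \<eta> \<in> {0<..<1}" by (rule eventually_at_right_real) simp
  ultimately have "\<forall>\<^sub>F \<eta> in at_right 0. 0 < \<eta> \<and> \<eta> < 1 \<and> e \<bullet> w * (1 + \<eta>) ^ ?k < e \<bullet> v * (1 - \<eta>) ^ ?k"
    by eventually_elim auto
  then obtain \<eta> where \<eta>: "0 < \<eta>" "\<eta> < 1" "e \<bullet> w * (1 + \<eta>) ^ ?k < e \<bullet> v * (1 - \<eta>) ^ ?k"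
    using eventually_happens'[OF trivial_limit_at_right_real] by blast
  have "e \<noteq> 0" using e by auto
  define \<epsilon> where "\<epsilon> = min (\<eta> * (e \<bullet> w) / norm e) (\<eta> * (v \<bullet> b))"
  have "\<epsilon> \<le> \<eta> * (e \<bullet> w) / norm e" by (simp add: \<epsilon>_def)
  then have "\<epsilon> * norm e \<le> \<eta> * (e \<bullet> w)" using \<open>e \<noteq> 0\<close> by (simp add: pos_le_divide_eq)
  moreover have "0 < \<epsilon>" "\<epsilon> \<le> \<eta> * (v \<bullet> b)" using \<eta> v e \<open>e \<noteq> 0\<close> by (auto simp: \<epsilon>_def)
  ultimately have \<epsilon>: "0 < \<epsilon>" "\<epsilon> * norm e \<le> \<eta> * (e \<bullet> w)" "\<epsilon> \<le> \<eta> * (v \<bullet> b)" by auto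
  define C where "C = touching K (cball v \<epsilon>) \<inter> touching K (cball w \<epsilon>)"
  have C: "compact C" "C \<subseteq> touching K (cball v \<epsilon>)" "C \<subseteq> touching K (cball w \<epsilon>)"
    by (auto simp: C_def intro!: compact_Int compact_touching)
  have ve: "\<epsilon> * norm e \<le> \<eta> * (e \<bullet> v)" using \<epsilon>(2) e(2) \<eta>(1) by (smt (verit) mult_less_cancel_left_pos)
  have ev: "0 < e \<bullet> v" using e by simp
  note V = touching_sweep_bounds[OF C(1,2) v(1) ev ve less_imp_le[OF \<eta>(1)] \<eta>(2)]
  note W = touching_sweep_bounds[OF C(1,3) w e(1) \<epsilon>(2) less_imp_le[OF \<eta>(1)] \<eta>(2)]
  obtain h where h: "hausdorff_outer ?k C = ennreal h" "0 \<le> h"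
    using V(3) by (cases "hausdorff_outer ?k C") auto
  have "ennreal (e \<bullet> v * (1 - \<eta>) ^ ?k) * hausdorff_outer ?k C \<le> ennreal (e \<bullet> w * (1 + \<eta>) ^ ?k) * hausdorff_outer ?k C"
    using V(2) W(1) by (rule order_trans)
  then have "e \<bullet> v * (1 - \<eta>) ^ ?k * h \<le> e \<bullet> w * (1 + \<eta>) ^ ?k * h"
    using h e \<eta> ev by (simp add: ennreal_mult'[symmetric] ennreal_le_iff)
  then have "h = 0" using \<eta>(3) h(2) by (metis less_eq_real_def mult_less_cancel_right not_le)
  have "emeasure top_measure C = emeasure lborel (sweep C b)"
  proof (rule top_measure_sweep[OF C(1,2)])
    have "\<eta> * (v \<bullet> b) < 1 * (v \<bullet> b)" using \<eta> v by (intro mult_strict_right_mono) auto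
    then show "\<epsilon> < v \<bullet> b" using \<epsilon>(3) by simp
  qed
  also have "\<dots> \<le> ennreal (b \<bullet> v * (1 + \<eta>) ^ ?k) * hausdorff_outer ?k C"
    by (rule touching_sweep_bounds[OF C(1,2) v(1)]) (use v \<epsilon> \<eta> b in \<open>auto simp: inner_commute\<close>)
  also have "\<dots> = 0" using h \<open>h = 0\<close> by simp
  finally show ?thesis using \<epsilon>(1) unfolding C_def by auto
qed

text \<open>
  The direction \<open>b\<close> itself works unless \<open>v\<close> and \<open>w\<close> are equally inclined to it; then it is tilted slightly
  towards \<open>v - w\<close>.
\<close>

lemma two_normals_null:
  assumes v: "norm v = 1" "0 < v \<bullet> b" and w: "norm w = 1" "0 < w \<bullet> b" and "v \<noteq> w"
  shows "\<exists>\<epsilon>>0. emeasure top_measure (touching K (cball v \<epsilon>) \<inter> touching K (cball w \<epsilon>)) = 0"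
proof -
  let ?d = "(v - w) \<bullet> (v - w)"
  let ?m = "min (v \<bullet> b) (w \<bullet> b)"
  have d: "0 < ?d" using \<open>v \<noteq> w\<close> by simp
  define s where "s = (if (v - w) \<bullet> b = 0 then ?m / 4 else 0)"
  define e where "e = b + s *\<^sub>R (v - w)"
  have s: "0 \<le> s" "s \<le> ?m / 4" using v w by (auto simp: s_def)
  have "norm (v - w) \<le> 2" using norm_triangle_ineq4[of v w] v w by simp
  have small: "\<bar>s *\<^sub>R (v - w) \<bullet> u\<bar> < u \<bullet> b" if "norm u = 1" "?m \<le> u \<bullet> b" for u
  proof -
    have "\<bar>(s *\<^sub>R (v - w)) \<bullet> u\<bar> \<le> norm (s *\<^sub>R (v - w)) * norm u" by (rule Cauchy_Schwarz_ineq2)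
    also have "\<dots> \<le> s * 2" using \<open>norm (v - w) \<le> 2\<close> s that by (simp add: mult_left_mono)
    also have "\<dots> < u \<bullet> b" using s that v(2) w(2) by (auto simp: min_def split: if_splits)
    finally show ?thesis .
  qed
  have "0 < e \<bullet> v" "0 < e \<bullet> w"
    using small[of v] small[of w] v w unfolding e_def by (simp_all add: inner_add_left inner_commute[of b])
  moreover have "e \<bullet> v \<noteq> e \<bullet> w"
  proof -
    have "e \<bullet> v - e \<bullet> w = (v - w) \<bullet> b + s * ?d"
      by (simp add: e_def inner_add_left inner_commute[of b] inner_diff_left[of v w b]
          inner_diff_right[of "v - w" v w] right_diff_distrib)
    moreover have "(v - w) \<bullet> b + s * ?d \<noteq> 0" using d v w by (auto simp: s_def)
    ultimately show ?thesis by auto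
  qed
  ultimately consider "0 < e \<bullet> w" "e \<bullet> w < e \<bullet> v" | "0 < e \<bullet> v" "e \<bullet> v < e \<bullet> w" by linarith
  then show ?thesis
  proof cases
    case 1
    then show ?thesis by (rule two_normals_null_aux[OF v w(1)])
  next
    case 2
    obtain \<epsilon> where "0 < \<epsilon>" "emeasure top_measure (touching K (cball w \<epsilon>) \<inter> touching K (cball v \<epsilon>)) = 0"
      using two_normals_null_aux[OF w v(1) 2] by blast
    then show ?thesis
      by (intro exI[of _ \<epsilon>]) (simp add: Int_commute[of "touching K (cball v \<epsilon>)"])
  qed
qed

text \<open>
  Above an interior point of \<open>K\<close> all normals have a positive \<open>b\<close>-component. So each point with two normals lies in
  one of the null sets of the previous lemma, and by the Lindeloef property countably many of them are enough.
\<close>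

lemma top_measure_not_smooth: "emeasure top_measure (frontier K - smooth_points K) = 0"
proof -
  define C where "C = (\<lambda>(v, w, \<epsilon>). touching K (cball v \<epsilon>) \<inter> touching K (cball w \<epsilon>))"
  define G where "G = {(v, w, \<epsilon>). 0 < \<epsilon> \<and> emeasure top_measure (C (v, w, \<epsilon>)) = 0}"
  define nb where "nb = (\<lambda>(v::'a, w::'a, \<epsilon>). ball v \<epsilon> \<times> ball w \<epsilon>)"
  obtain F where F: "F \<subseteq> nb ` G" "countable F" "\<Union>F = \<Union>(nb ` G)"
  proof (rule Lindelof[of "nb ` G"])
    show "open S" if "S \<in> nb ` G" for S using that by (auto simp: nb_def intro!: open_Times)
  qed
  obtain G' where G': "countable G'" "G' \<subseteq> G" "F = nb ` G'"
    using F(1,2) by (meson countable_subset_image)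
  define N where "N = (\<Union>g\<in>G'. C g)"
  have N: "N \<in> null_sets top_measure" unfolding N_def
  proof (rule null_sets_UN'[OF G'(1)])
    fix g assume "g \<in> G'"
    then have "g \<in> G" using G'(2) by auto
    obtain v w \<epsilon> where g: "g = (v, w, \<epsilon>)" by (cases g) auto
    have "C g \<in> sets borel" unfolding C_def g prod.case by (intro sets.Int touching_borel closed_cball)
    then show "C g \<in> null_sets top_measure" using \<open>g \<in> G\<close> by (auto simp: G_def g)
  qed
  have cover: "top_point y \<in> N" if y: "y \<in> interior K" and ns: "top_point y \<notin> smooth_points K" for y
  proof -
    let ?x = "top_point y"
    have fr: "?x \<in> frontier K" by (rule top_point_frontier[OF y])
    obtain v where v: "is_outer_unit_normal K ?x v" using normal_exists[OF fr] by auto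
    then obtain w where w: "is_outer_unit_normal K ?x w" "v \<noteq> w"
      using ns fr by (auto simp: smooth_points_def)
    have nvw: "norm v = 1" "norm w = 1" using v w by (auto simp: is_outer_unit_normal_def)
    obtain \<epsilon> where \<epsilon>: "0 < \<epsilon>" "emeasure top_measure (C (v, w, \<epsilon>)) = 0"
      using two_normals_null[OF nvw(1) top_normal_pos[OF y v] nvw(2) top_normal_pos[OF y w(1)] w(2)]
      by (auto simp: C_def)
    then have "(v, w, \<epsilon>) \<in> G" by (simp add: G_def)
    moreover have "(v, w) \<in> nb (v, w, \<epsilon>)" using \<epsilon>(1) by (simp add: nb_def)
    ultimately have "(v, w) \<in> \<Union>F" unfolding F(3) by blast
    then obtain g where g: "g \<in> G'" "(v, w) \<in> nb g" using G'(3) by auto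
    then have "?x \<in> C g"
      using fr v w(1) by (auto simp: nb_def C_def touching_def intro: less_imp_le split: prod.splits)
    then show ?thesis using g(1) by (auto simp: N_def)
  qed
  have Nb: "N \<in> sets borel" using N by auto
  have fs: "frontier K - smooth_points K \<in> sets borel"
    using smooth_points_borel frontier_compact borel_compact by auto
  have "emeasure top_measure (frontier K - smooth_points K)
      = emeasure (flat_lborel b) {y \<in> K. top_point y \<in> frontier K - smooth_points K}"
    by (rule emeasure_top_measure[OF fs])
  also have "\<dots> \<le> emeasure (flat_lborel b) {y \<in> K. top_point y \<in> N}"
  proof (rule emeasure_mono_AE)
    show "AE y in flat_lborel b. y \<in> {y \<in> K. top_point y \<in> frontier K - smooth_points K} \<longrightarrow> y \<in> {y \<in> K. top_point y \<in> N}"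
      using AE_hyperplane_interior by eventually_elim (use cover in auto)
    show "{y \<in> K. top_point y \<in> N} \<in> sets (flat_lborel b)" using Nb by measurable
  qed
  also have "\<dots> = emeasure top_measure N" by (rule emeasure_top_measure[OF Nb, symmetric])
  also have "\<dots> = 0" using N by auto
  finally show ?thesis by simp
qed

definition upper_part :: "'a set" where
  "upper_part = {x \<in> smooth_points K. 0 < normal x \<bullet> b}"

lemma upper_part_borel [measurable]: "upper_part \<in> sets borel"
proof -
  note [measurable] = smooth_points_borel
  show ?thesis unfolding upper_part_def by measurable
qed

lemma top_measure_not_upper: "emeasure top_measure (- upper_part) = 0"
proof -
  have fs: "frontier K - smooth_points K \<in> sets borel"
    using smooth_points_borel frontier_compact borel_compact by auto
  have c: "- upper_part \<in> sets borel" using upper_part_borel by auto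
  have in_upper: "top_point y \<in> upper_part" if "y \<in> interior K" "top_point y \<in> smooth_points K" for y
    using top_normal_pos[OF that(1) outer_unit_normal_smooth(1)[OF that(2)]] that(2)
    by (simp add: upper_part_def normal_def)
  have "emeasure top_measure (- upper_part) = emeasure (flat_lborel b) {y \<in> K. top_point y \<in> - upper_part}"
    by (rule emeasure_top_measure[OF c])
  also have "\<dots> \<le> emeasure (flat_lborel b) {y \<in> K. top_point y \<in> frontier K - smooth_points K}"
  proof (rule emeasure_mono_AE)
    show "AE y in flat_lborel b. y \<in> {y \<in> K. top_point y \<in> - upper_part} \<longrightarrow>
        y \<in> {y \<in> K. top_point y \<in> frontier K - smooth_points K}"
      using AE_hyperplane_interior by eventually_elim (use in_upper top_point_frontier in auto)
    show "{y \<in> K. top_point y \<in> frontier K - smooth_points K} \<in> sets (flat_lborel b)" using fs by measurable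
  qed
  also have "\<dots> = 0" using top_measure_not_smooth by (subst emeasure_top_measure[OF fs, symmetric])
  finally show ?thesis by simp
qed

text \<open>
  The conversion to \<^typ>\<open>ennreal\<close> keeps only the part of the boundary that faces upwards.
\<close>

definition facing_measure :: "'a measure" where
  "facing_measure = density (hausdorff_measure (DIM('a) - 1)) (\<lambda>x. ennreal (normal x \<bullet> b))"

lemma sets_facing_measure [simp, measurable_cong]: "sets facing_measure = sets borel"
  by (simp add: facing_measure_def)

lemma emeasure_facing_measure:
  "A \<in> sets borel \<Longrightarrow> emeasure facing_measure A
    = (\<integral>\<^sup>+ x. ennreal (normal x \<bullet> b) * indicator A x \<partial>hausdorff_measure (DIM('a) - 1))"
  unfolding facing_measure_def by (subst emeasure_density) auto

text \<open>
  On a piece whose normals are within \<open>\<eta> (v \<bullet> b)\<close> of \<open>v\<close>, both measures equal \<open>(v \<bullet> b) H\<close> up to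
  powers of \<open>1 + \<eta>\<close> and \<open>1 - \<eta>\<close>. The sweep estimates are for compact sets; regularity extends them to Borel sets.
  The exponent in \<open>\<kappa>\<close> is one more than the dimension of the boundary, to absorb the variation of the
  normal as well.
\<close>

lemma piece_comparison:
  assumes v: "norm v = 1" "0 < v \<bullet> b" and \<eta>: "0 < \<eta>" "\<eta> < 1"
    and A: "A \<in> sets borel" "A \<subseteq> upper_part" "A \<subseteq> touching K (cball v (\<eta> * (v \<bullet> b)))"
  defines "\<kappa> \<equiv> ((1 + \<eta>) / (1 - \<eta>)) ^ DIM('a)"
  shows "emeasure facing_measure A \<le> ennreal \<kappa> * emeasure top_measure A"
    and "emeasure top_measure A \<le> ennreal \<kappa> * emeasure facing_measure A"
proof -
  let ?k = "DIM('a) - 1" and ?\<epsilon> = "\<eta> * (v \<bullet> b)" and ?c = "v \<bullet> b"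
  let ?H = "hausdorff_measure ?k :: 'a measure"
  define P where "P = touching K (cball v ?\<epsilon>)"
  have P: "compact P" unfolding P_def by (rule compact_touching) simp
  have "\<eta> * ?c < 1 * ?c" using \<eta> v by (intro mult_strict_right_mono) auto
  then have \<epsilon>: "?\<epsilon> < v \<bullet> b" by simp
  have bounds:
    "emeasure top_measure C \<le> ennreal (?c * (1 + \<eta>) ^ ?k) * emeasure ?H C"
    "ennreal (?c * (1 - \<eta>) ^ ?k) * emeasure ?H C \<le> emeasure top_measure C"
    "emeasure ?H C < \<infinity>" if C: "compact C" "C \<subseteq> P" for C
  proof -
    have C': "C \<subseteq> touching K (cball v ?\<epsilon>)" using C(2) by (simp add: P_def)
    have eq: "emeasure top_measure C = emeasure lborel (sweep C b)"
      by (rule top_measure_sweep[OF C(1) C' \<epsilon>])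
    have H: "emeasure ?H C = hausdorff_outer ?k C"
      by (rule emeasure_hausdorff_measure) (use C in \<open>auto simp: borel_compact\<close>)
    have "0 < b \<bullet> v" using v by (simp add: inner_commute)
    from touching_sweep_bounds[OF C(1) C' v(1) this, of \<eta>]
    show "emeasure top_measure C \<le> ennreal (?c * (1 + \<eta>) ^ ?k) * emeasure ?H C"
      "ennreal (?c * (1 - \<eta>) ^ ?k) * emeasure ?H C \<le> emeasure top_measure C" "emeasure ?H C < \<infinity>"
      unfolding eq H using b \<eta> by (auto simp: inner_commute)
  qed
  have PA: "A \<subseteq> P" using A(3) by (simp add: P_def)
  have up: "emeasure top_measure A \<le> ennreal (?c * (1 + \<eta>) ^ ?k) * emeasure ?H A"
    using compact_regularity_le[of top_measure ?H P 1 "ennreal (?c * (1 + \<eta>) ^ ?k)" A]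
      bounds(1) A(1) PA P borel_compact top_measure_finite by auto
  have low: "ennreal (?c * (1 - \<eta>) ^ ?k) * emeasure ?H A \<le> emeasure top_measure A"
    using compact_regularity_le[of ?H top_measure P "ennreal (?c * (1 - \<eta>) ^ ?k)" 1 A]
      bounds(2) bounds(3)[OF P] A(1) PA P borel_compact by auto
  have near: "(1 - \<eta>) * ?c \<le> normal x \<bullet> b \<and> normal x \<bullet> b \<le> (1 + \<eta>) * ?c" if xA: "x \<in> A" for x
  proof -
    have x: "x \<in> smooth_points K" using xA A(2) by (auto simp: upper_part_def)
    obtain w where w: "w \<in> cball v ?\<epsilon>" "is_outer_unit_normal K x w"
      using subsetD[OF A(3) xA] unfolding touching_def by blast
    then have "normal x = w" using outer_unit_normal_smooth(2)[OF x w(2)] x by (simp add: normal_def)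
    then have "\<bar>(v - normal x) \<bullet> b\<bar> \<le> ?\<epsilon>"
      using Cauchy_Schwarz_ineq2[of "v - w" b] w(1) b by (simp add: dist_norm)
    then show ?thesis by (auto simp: inner_diff_left algebra_simps abs_le_iff)
  qed
  have A': "A \<in> sets ?H" using A(1) by simp
  have F: "emeasure facing_measure A = (\<integral>\<^sup>+ x. ennreal (normal x \<bullet> b) * indicator A x \<partial>?H)"
    by (rule emeasure_facing_measure[OF A(1)])
  have "emeasure facing_measure A \<le> (\<integral>\<^sup>+ x. ennreal ((1 + \<eta>) * ?c) * indicator A x \<partial>?H)"
    unfolding F by (intro nn_integral_mono) (use near in \<open>auto simp: indicator_def intro!: ennreal_leI\<close>)
  also have "\<dots> = ennreal ((1 + \<eta>) * ?c) * emeasure ?H A" using A' by (rule nn_integral_cmult_indicator)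
  finally have Fup: "emeasure facing_measure A \<le> ennreal ((1 + \<eta>) * ?c) * emeasure ?H A" .
  have "ennreal ((1 - \<eta>) * ?c) * emeasure ?H A = (\<integral>\<^sup>+ x. ennreal ((1 - \<eta>) * ?c) * indicator A x \<partial>?H)"
    using A' by (rule nn_integral_cmult_indicator[symmetric])
  also have "\<dots> \<le> emeasure facing_measure A"
    unfolding F by (intro nn_integral_mono) (use near in \<open>auto simp: indicator_def intro!: ennreal_leI\<close>)
  finally have Flow: "ennreal ((1 - \<eta>) * ?c) * emeasure ?H A \<le> emeasure facing_measure A" .
  have D: "DIM('a) = Suc ?k" using DIM_positive[where 'a='a] by simp
  have p1: "1 \<le> (1 + \<eta>) ^ ?k" using \<eta> by (intro one_le_power) auto
  have p2: "(1 - \<eta>) ^ ?k \<le> 1" "0 < (1 - \<eta>) ^ ?k" using \<eta> by (auto intro!: power_le_one)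
  have \<kappa>: "\<kappa> = (1 + \<eta>) * (1 + \<eta>) ^ ?k / ((1 - \<eta>) * (1 - \<eta>) ^ ?k)"
    unfolding \<kappa>_def by (subst D) (simp only: power_Suc power_divide times_divide_times_eq)
  have "0 \<le> \<kappa>" using \<eta> by (simp add: \<kappa>_def)
  have r1: "(1 + \<eta>) * ?c \<le> \<kappa> * (?c * (1 - \<eta>) ^ ?k)"
  proof -
    have "\<kappa> * (?c * (1 - \<eta>) ^ ?k) = (1 + \<eta>) * ?c * ((1 + \<eta>) ^ ?k / (1 - \<eta>))"
      using p2 \<eta> by (simp add: \<kappa>)
    moreover have "1 - \<eta> \<le> (1 + \<eta>) ^ ?k" using p1 \<eta>(1) by linarith
    then have "1 \<le> (1 + \<eta>) ^ ?k / (1 - \<eta>)" using \<eta>(2) by (simp add: pos_le_divide_eq)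
    then have "(1 + \<eta>) * ?c * 1 \<le> (1 + \<eta>) * ?c * ((1 + \<eta>) ^ ?k / (1 - \<eta>))"
      using \<eta> v(2) by (intro mult_left_mono) auto
    ultimately show ?thesis by simp
  qed
  have r2: "?c * (1 + \<eta>) ^ ?k \<le> \<kappa> * ((1 - \<eta>) * ?c)"
  proof -
    have "\<kappa> * ((1 - \<eta>) * ?c) = ?c * (1 + \<eta>) ^ ?k * ((1 + \<eta>) / (1 - \<eta>) ^ ?k)"
      using p2 \<eta> by (simp add: \<kappa>)
    moreover have "(1 - \<eta>) ^ ?k \<le> 1 + \<eta>" using p2(1) \<eta>(1) by linarith
    then have "1 \<le> (1 + \<eta>) / (1 - \<eta>) ^ ?k" using p2(2) by (simp add: pos_le_divide_eq)
    then have "?c * (1 + \<eta>) ^ ?k * 1 \<le> ?c * (1 + \<eta>) ^ ?k * ((1 + \<eta>) / (1 - \<eta>) ^ ?k)"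
      using \<eta> v(2) by (intro mult_left_mono) auto
    ultimately show ?thesis by simp
  qed
  have "emeasure facing_measure A \<le> ennreal (\<kappa> * (?c * (1 - \<eta>) ^ ?k)) * emeasure ?H A"
    by (rule order_trans[OF Fup mult_right_mono]) (use r1 in \<open>auto intro: ennreal_leI\<close>)
  also have "\<dots> = ennreal \<kappa> * (ennreal (?c * (1 - \<eta>) ^ ?k) * emeasure ?H A)"
    using \<open>0 \<le> \<kappa>\<close> v \<eta> by (simp add: ennreal_mult mult.assoc)
  also have "\<dots> \<le> ennreal \<kappa> * emeasure top_measure A" by (intro mult_left_mono low) simp
  finally show "emeasure facing_measure A \<le> ennreal \<kappa> * emeasure top_measure A" .
  have "emeasure top_measure A \<le> ennreal (\<kappa> * ((1 - \<eta>) * ?c)) * emeasure ?H A"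
    by (rule order_trans[OF up mult_right_mono]) (use r2 in \<open>auto intro: ennreal_leI\<close>)
  also have "\<dots> = ennreal \<kappa> * (ennreal ((1 - \<eta>) * ?c) * emeasure ?H A)"
    using \<open>0 \<le> \<kappa>\<close> v \<eta> by (simp add: ennreal_mult mult.assoc)
  also have "\<dots> \<le> ennreal \<kappa> * emeasure facing_measure A" by (intro mult_left_mono Flow) simp
  finally show "emeasure top_measure A \<le> ennreal \<kappa> * emeasure facing_measure A" .
qed

text \<open>
  The radius of the ball of normals shrinks with \<open>v \<bullet> b\<close>, so finitely many pieces may not reach the
  horizon of the body, but countably many do.
\<close>

lemma upper_part_comparison:
  assumes \<eta>: "0 < \<eta>" "\<eta> < 1" and A: "A \<in> sets borel" "A \<subseteq> upper_part"
  defines "\<kappa> \<equiv> ((1 + \<eta>) / (1 - \<eta>)) ^ DIM('a)"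
  shows "emeasure facing_measure A \<le> ennreal \<kappa> * emeasure top_measure A"
    and "emeasure top_measure A \<le> ennreal \<kappa> * emeasure facing_measure A"
proof -
  define U where "U = {v::'a. norm v = 1 \<and> 0 < v \<bullet> b}"
  have "b \<in> U" using b by (simp add: U_def)
  define nb where "nb v = ball v (\<eta> * (v \<bullet> b))" for v
  obtain F where F: "F \<subseteq> nb ` U" "countable F" "\<Union>F = \<Union>(nb ` U)"
  proof (rule Lindelof[of "nb ` U"])
    show "open S" if "S \<in> nb ` U" for S using that by (auto simp: nb_def)
  qed
  obtain U' where U': "countable U'" "U' \<subseteq> U" "F = nb ` U'"
    using F(1,2) by (meson countable_subset_image)
  have "b \<in> nb b" using b \<eta> by (simp add: nb_def)
  then have "U' \<noteq> {}" using F(3) U'(3) \<open>b \<in> U\<close> by auto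
  define v where "v = from_nat_into U'"
  have rv: "range v = U'" unfolding v_def by (rule range_from_nat_into[OF \<open>U' \<noteq> {}\<close> U'(1)])
  have v: "norm (v n) = 1" "0 < v n \<bullet> b" for n
    using rv U'(2) by (auto simp: U_def)
  define P where "P n = touching K (cball (v n) (\<eta> * (v n \<bullet> b)))" for n
  have Pb: "P n \<in> sets borel" for n unfolding P_def by (rule touching_borel) simp
  have cover: "A \<subseteq> (\<Union>n. P n)"
  proof
    fix x assume "x \<in> A"
    then have x: "x \<in> smooth_points K" "0 < normal x \<bullet> b" using A(2) by (auto simp: upper_part_def)
    have nx: "is_outer_unit_normal K x (normal x)"
      using outer_unit_normal_smooth(1)[OF x(1)] x(1) by (simp add: normal_def)
    then have "normal x \<in> U" using x(2) by (simp add: U_def is_outer_unit_normal_def)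
    moreover have "normal x \<in> nb (normal x)" using x(2) \<eta> by (simp add: nb_def)
    ultimately have "normal x \<in> \<Union>F" unfolding F(3) by blast
    then obtain n where "normal x \<in> nb (v n)" using U'(3) rv by auto
    then have "x \<in> P n"
      using nx x(1) by (auto simp: P_def touching_def nb_def smooth_points_def intro!: bexI[of _ "normal x"])
    then show "x \<in> (\<Union>n. P n)" by blast
  qed
  define B where "B n = A \<inter> disjointed P n" for n
  have dP: "disjointed P n \<in> sets borel" for n
    using sets.range_disjointed_sets[of P borel] Pb by auto
  have B: "B n \<in> sets borel" "B n \<subseteq> upper_part" "B n \<subseteq> touching K (cball (v n) (\<eta> * (v n \<bullet> b)))" for n
    using A dP disjointed_subset[of P n] by (auto simp: B_def P_def)
  have "disjoint_family B"
    using disjoint_family_disjointed[of P] by (auto simp: B_def disjoint_family_on_def)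
  have "(\<Union>n. B n) = A" using cover UN_disjointed_eq[of P] by (auto simp: B_def)
  have sum: "emeasure M A = (\<Sum>n. emeasure M (B n))" if "sets M = sets borel" for M
  proof -
    have "range B \<subseteq> sets M" using B(1) that by auto
    from suminf_emeasure[OF this \<open>disjoint_family B\<close>] show ?thesis
      unfolding \<open>(\<Union>n. B n) = A\<close> by (rule sym)
  qed
  note piece = piece_comparison[OF v \<eta> B, folded \<kappa>_def]
  have "emeasure facing_measure A \<le> (\<Sum>n. ennreal \<kappa> * emeasure top_measure (B n))"
    unfolding sum[OF sets_facing_measure] by (intro suminf_le piece) auto
  also have "\<dots> = ennreal \<kappa> * emeasure top_measure A" by (simp add: sum[OF sets_top_measure])
  finally show "emeasure facing_measure A \<le> ennreal \<kappa> * emeasure top_measure A" .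
  have "emeasure top_measure A \<le> (\<Sum>n. ennreal \<kappa> * emeasure facing_measure (B n))"
    unfolding sum[OF sets_top_measure] by (intro suminf_le piece) auto
  also have "\<dots> = ennreal \<kappa> * emeasure facing_measure A" by (simp add: sum[OF sets_facing_measure])
  finally show "emeasure top_measure A \<le> ennreal \<kappa> * emeasure facing_measure A" .
qed

lemma upper_part_equal:
  assumes A: "A \<in> sets borel" "A \<subseteq> upper_part"
  shows "emeasure facing_measure A = emeasure top_measure A"
proof -
  define \<kappa> where "\<kappa> \<eta> = ((1 + \<eta>) / (1 - \<eta>)) ^ DIM('a)" for \<eta> :: real
  note cmp = upper_part_comparison[OF _ _ A, folded \<kappa>_def]
  obtain t where t: "emeasure top_measure A = ennreal t" "0 \<le> t"
    using top_measure_finite[of A] by (cases "emeasure top_measure A") auto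
  have "emeasure facing_measure A < \<infinity>"
    using cmp(1)[of "1/2"] t by (auto simp: ennreal_mult_less_top intro: le_less_trans)
  then obtain f where f: "emeasure facing_measure A = ennreal f" "0 \<le> f"
    by (cases "emeasure facing_measure A") auto
  have le: "f \<le> \<kappa> \<eta> * t" "t \<le> \<kappa> \<eta> * f" if "0 < \<eta>" "\<eta> < 1" for \<eta>
  proof -
    have "0 \<le> \<kappa> \<eta>" using that by (simp add: \<kappa>_def)
    then show "f \<le> \<kappa> \<eta> * t" "t \<le> \<kappa> \<eta> * f"
      using cmp[OF that] t f by (simp_all add: ennreal_mult'[symmetric] ennreal_le_iff)
  qed
  have "(\<kappa> \<longlongrightarrow> ((1 + 0) / (1 - 0)) ^ DIM('a)) (at_right 0)"
    unfolding \<kappa>_def by (intro tendsto_intros) auto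
  then have lim: "(\<kappa> \<longlongrightarrow> 1) (at_right 0)" by simp
  have ev: "\<forall>\<^sub>F \<eta>::real in at_right 0. \<eta> \<in> {0<..<1}" by (rule eventually_at_right_real) simp
  have "f \<le> 1 * t"
  proof (rule tendsto_lowerbound[OF tendsto_mult_right[OF lim]])
    show "\<forall>\<^sub>F \<eta> in at_right 0. f \<le> \<kappa> \<eta> * t" using ev by eventually_elim (use le in auto)
  qed simp
  moreover have "t \<le> 1 * f"
  proof (rule tendsto_lowerbound[OF tendsto_mult_right[OF lim]])
    show "\<forall>\<^sub>F \<eta> in at_right 0. t \<le> \<kappa> \<eta> * f" using ev by eventually_elim (use le in auto)
  qed simp
  ultimately show ?thesis using f t by simp
qed

theorem facing_measure_eq_top_measure: "facing_measure = top_measure"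
proof (rule measure_eqI)
  fix A assume "A \<in> sets facing_measure"
  then have A: "A \<in> sets borel" by simp
  then have AU: "A \<inter> upper_part \<in> sets borel" by simp
  have "emeasure facing_measure A = emeasure facing_measure (A \<inter> upper_part)"
    unfolding emeasure_facing_measure[OF A] emeasure_facing_measure[OF AU]
  proof (intro nn_integral_cong)
    fix x
    have "ennreal (normal x \<bullet> b) = 0" if "x \<notin> upper_part"
      using that by (cases "x \<in> smooth_points K") (auto simp: upper_part_def normal_def ennreal_eq_0_iff)
    then show "ennreal (normal x \<bullet> b) * indicator A x = ennreal (normal x \<bullet> b) * indicator (A \<inter> upper_part) x"
      by (cases "x \<in> upper_part") (auto simp: indicator_def)
  qed
  also have "\<dots> = emeasure top_measure (A \<inter> upper_part)" by (rule upper_part_equal[OF AU]) auto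
  also have "\<dots> = emeasure top_measure A"
  proof (rule emeasure_eq_AE)
    have "AE x in top_measure. x \<notin> - upper_part"
      by (rule AE_not_in) (use top_measure_not_upper upper_part_borel in auto)
    then show "AE x in top_measure. x \<in> A \<inter> upper_part \<longleftrightarrow> x \<in> A" by eventually_elim auto
  qed (use A AU in auto)
  finally show "emeasure facing_measure A = emeasure top_measure A" .
qed simp

end

section \<open>The projection formula\<close>

lemma (in convex_body) frontier_iff_normal:
  "x \<in> frontier K \<longleftrightarrow> x \<in> K \<and> (\<exists>v. is_outer_unit_normal K x v)"
proof
  assume "x \<in> frontier K"
  then show "x \<in> K \<and> (\<exists>v. is_outer_unit_normal K x v)" using normal_exists frontier_subset by auto
next
  assume "x \<in> K \<and> (\<exists>v. is_outer_unit_normal K x v)"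
  then obtain v where x: "x \<in> K" and v: "is_outer_unit_normal K x v" by auto
  have "x \<notin> interior K"
  proof
    assume "x \<in> interior K"
    then obtain s where s: "0 < s" "cball x s \<subseteq> K" by (auto simp: mem_interior_cball)
    have nv: "norm v = 1" using v by (simp add: is_outer_unit_normal_def)
    have "x + s *\<^sub>R v \<in> K" using s nv by (intro subsetD[OF s(2)]) (simp add: dist_norm)
    then have "(x + s *\<^sub>R v - x) \<bullet> v \<le> 0" using v unfolding is_outer_unit_normal_def by blast
    then show False using s nv by (simp add: norm_eq_1)
  qed
  then show "x \<in> frontier K" using x closure_subset by (auto simp: frontier_def)
qed

context symmetric_body
begin

definition reflect :: "'a \<Rightarrow> 'a" where
  "reflect x = x - (2 * (x \<bullet> b)) *\<^sub>R b"

lemma reflect_reflect [simp]: "reflect (reflect x) = x"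
  using b by (simp add: reflect_def inner_diff_left)

lemma reflect_diff: "reflect x - reflect y = reflect (x - y)"
  by (simp add: reflect_def inner_diff_left algebra_simps)

lemma reflect_inner: "reflect x \<bullet> y = x \<bullet> reflect y"
  by (simp add: reflect_def inner_diff_left inner_diff_right inner_commute)

lemma reflect_inner_b [simp]: "reflect x \<bullet> b = - (x \<bullet> b)"
  using b by (simp add: reflect_def inner_diff_left)

lemma norm_reflect [simp]: "norm (reflect x) = norm x"
  by (simp add: norm_eq_sqrt_inner reflect_inner)

lemma reflect_in_K [simp]: "reflect x \<in> K \<longleftrightarrow> x \<in> K"
  using K_sym[of x] K_sym[of "reflect x"] reflect_reflect[of x] unfolding reflect_def by auto

lemma reflect_normal: "is_outer_unit_normal K (reflect x) v \<longleftrightarrow> is_outer_unit_normal K x (reflect v)"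
proof -
  have "(\<forall>y\<in>K. (y - reflect x) \<bullet> v \<le> 0) \<longleftrightarrow> (\<forall>y\<in>K. (reflect y - reflect x) \<bullet> v \<le> 0)"
    by (metis reflect_in_K reflect_reflect)
  then show ?thesis by (simp add: is_outer_unit_normal_def reflect_diff reflect_inner)
qed

lemma reflect_smooth: "reflect x \<in> smooth_points K \<longleftrightarrow> x \<in> smooth_points K"
proof -
  have "(\<exists>!v. is_outer_unit_normal K (reflect x) v) \<longleftrightarrow> (\<exists>!v. is_outer_unit_normal K x v)"
    unfolding reflect_normal by (metis reflect_reflect)
  then show ?thesis by (auto simp: smooth_points_def frontier_iff_normal)
qed

lemma normal_reflect: "normal (reflect x) = reflect (normal x)"
proof (cases "x \<in> smooth_points K")
  case True
  then have r: "reflect x \<in> smooth_points K" by (simp add: reflect_smooth)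
  have "is_outer_unit_normal K (reflect x) (reflect (outer_unit_normal K x))"
    using outer_unit_normal_smooth(1)[OF True] by (simp add: reflect_normal)
  from outer_unit_normal_smooth(2)[OF r this] show ?thesis using True r by (simp add: normal_def)
next
  case False
  then have "reflect x \<notin> smooth_points K" by (simp add: reflect_smooth)
  with False show ?thesis by (simp add: normal_def reflect_def)
qed

lemma reflect_measurable [measurable]: "reflect \<in> borel \<rightarrow>\<^sub>M borel"
  unfolding reflect_def by measurable

lemma distr_hausdorff_reflect: "distr (hausdorff_measure k) borel reflect = hausdorff_measure k"
proof (rule measure_eqI)
  fix A assume "A \<in> sets (distr (hausdorff_measure k) borel reflect)"
  then have A: "A \<in> sets borel" by simp
  have eq: "reflect -` A = reflect ` A"
  proof (intro equalityI subsetI)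
    fix x assume "x \<in> reflect -` A"
    then show "x \<in> reflect ` A" by (intro image_eqI[of _ _ "reflect x"]) auto
  qed auto
  have pre: "reflect -` A \<in> sets borel" using measurable_sets[OF reflect_measurable A] by simp
  have "emeasure (distr (hausdorff_measure k) borel reflect) A = emeasure (hausdorff_measure k) (reflect -` A)"
    using A by (subst emeasure_distr) auto
  also have "\<dots> = hausdorff_outer k (reflect ` A)" using emeasure_hausdorff_measure[OF pre, of k] by (simp add: eq)
  also have "\<dots> = hausdorff_outer k A"
    by (rule hausdorff_outer_isometry) (simp add: dist_norm reflect_diff)
  also have "\<dots> = emeasure (hausdorff_measure k) A" by (rule emeasure_hausdorff_measure[OF A, symmetric])
  finally show "emeasure (distr (hausdorff_measure k) borel reflect) A = emeasure (hausdorff_measure k) A" .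
qed simp

text \<open>
  The part of the boundary that faces downwards is the mirror image of the part that faces upwards.
\<close>

theorem boundary_projection_formula:
  assumes F [measurable]: "F \<in> borel_measurable borel"
  shows "(\<integral>\<^sup>+ x. F x * ennreal \<bar>normal x \<bullet> b\<bar> \<partial>hausdorff_measure (DIM('a) - 1))
    = (\<integral>\<^sup>+ y. indicator K y * (F (top_point y) + F (reflect (top_point y))) \<partial>flat_lborel b)"
proof -
  let ?H = "hausdorff_measure (DIM('a) - 1) :: 'a measure"
  have top: "(\<integral>\<^sup>+ x. G x * ennreal (normal x \<bullet> b) \<partial>?H) = (\<integral>\<^sup>+ y. indicator K y * G (top_point y) \<partial>flat_lborel b)"
    if [measurable]: "G \<in> borel_measurable borel" for G
  proof -
    have "(\<integral>\<^sup>+ x. G x * ennreal (normal x \<bullet> b) \<partial>?H) = (\<integral>\<^sup>+ x. G x \<partial>facing_measure)"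
      unfolding facing_measure_def by (subst nn_integral_density) (auto simp: mult.commute)
    also have "\<dots> = (\<integral>\<^sup>+ x. G x \<partial>top_measure)" by (simp add: facing_measure_eq_top_measure)
    also have "\<dots> = (\<integral>\<^sup>+ y. G (top_point y) \<partial>density (flat_lborel b) (indicator K))"
      unfolding top_measure_def by (rule nn_integral_distr) auto
    also have "\<dots> = (\<integral>\<^sup>+ y. indicator K y * G (top_point y) \<partial>flat_lborel b)"
      by (rule nn_integral_density) auto
    finally show ?thesis .
  qed
  have abs: "ennreal \<bar>r\<bar> = ennreal r + ennreal (- r)" for r :: real
    by (cases "0 \<le> r") (auto simp: ennreal_neg)
  have "(\<integral>\<^sup>+ x. F x * ennreal (- (normal x \<bullet> b)) \<partial>?H)
      = (\<integral>\<^sup>+ x. F x * ennreal (- (normal x \<bullet> b)) \<partial>distr ?H borel reflect)"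
    by (simp only: distr_hausdorff_reflect)
  also have "\<dots> = (\<integral>\<^sup>+ x. F (reflect x) * ennreal (normal x \<bullet> b) \<partial>?H)"
    by (subst nn_integral_distr) (auto simp: normal_reflect)
  finally have minus: "(\<integral>\<^sup>+ x. F x * ennreal (- (normal x \<bullet> b)) \<partial>?H)
      = (\<integral>\<^sup>+ x. F (reflect x) * ennreal (normal x \<bullet> b) \<partial>?H)" .
  have "(\<integral>\<^sup>+ x. F x * ennreal \<bar>normal x \<bullet> b\<bar> \<partial>?H)
      = (\<integral>\<^sup>+ x. F x * ennreal (normal x \<bullet> b) \<partial>?H) + (\<integral>\<^sup>+ x. F x * ennreal (- (normal x \<bullet> b)) \<partial>?H)"
    unfolding abs distrib_left by (rule nn_integral_add) auto
  also have "\<dots> = (\<integral>\<^sup>+ y. indicator K y * F (top_point y) \<partial>flat_lborel b)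
      + (\<integral>\<^sup>+ y. indicator K y * F (reflect (top_point y)) \<partial>flat_lborel b)"
  proof -
    have "(\<lambda>x. F (reflect x)) \<in> borel_measurable borel" by measurable
    from top[OF F] top[OF this] show ?thesis unfolding minus by (simp only:)
  qed
  also have "\<dots> = (\<integral>\<^sup>+ y. indicator K y * (F (top_point y) + F (reflect (top_point y))) \<partial>flat_lborel b)"
    unfolding distrib_left by (rule nn_integral_add[symmetric]) auto
  finally show ?thesis .
qed

lemma reflect_top_point: "y \<bullet> b = 0 \<Longrightarrow> reflect (top_point y) = y - height y *\<^sub>R b"
  using b by (simp add: reflect_def top_point_def inner_add_left algebra_simps flip: scaleR_add_left)

lemma fibre_interior:
  assumes y: "y \<in> interior K" "y \<bullet> b = 0" and t: "\<bar>t\<bar> < height y"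
  shows "y + t *\<^sub>R b \<in> interior K"
proof -
  let ?h = "height y"
  have yK: "y \<in> K" using y interior_subset by auto
  have "y + (?h * sgn t) *\<^sub>R b \<in> K"
  proof (cases "t \<ge> 0")
    case True
    then show ?thesis using top_point_in_K[OF yK] yK by (cases "t = 0") (auto simp: top_point_def)
  next
    case False
    have "reflect (top_point y) \<in> K" using top_point_in_K[OF yK] by simp
    then show ?thesis using False reflect_top_point[OF y(2)] by simp
  qed
  from mem_interior_convex_shrink[OF K_convex y(1) this, of "1 - \<bar>t\<bar> / ?h"]
  have "y + (?h * sgn t) *\<^sub>R b - (1 - \<bar>t\<bar> / ?h) *\<^sub>R ((?h * sgn t) *\<^sub>R b) \<in> interior K"
    using t by (simp only: add_diff_cancel_left') auto
  moreover have "?h * sgn t - (1 - \<bar>t\<bar> / ?h) * (?h * sgn t) = t"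
  proof -
    have "?h \<noteq> 0" using t by auto
    then show ?thesis by (auto simp: sgn_if field_simps)
  qed
  moreover have "y + s *\<^sub>R b - c *\<^sub>R (s *\<^sub>R b) = y + (s - c * s) *\<^sub>R b" for s c
    by (simp add: scaleR_diff_left)
  ultimately show ?thesis by (simp only:)
qed

end

section \<open>A one-dimensional inequality\<close>

text \<open>
  Integrating \<open>(\<psi> - m)\<^sup>2 \<ge> 0\<close> with \<open>m\<close> the mean slope of \<open>\<phi>\<close> over \<open>[0, c]\<close> gives the inequality there. As \<open>\<psi>\<close>
  may be unbounded at \<open>h\<close>, the end point is reached only by a limit \<open>c \<rightarrow> h\<close>.
\<close>

lemma square_le_derivative_integral:
  fixes \<phi> \<psi> :: "real \<Rightarrow> real"
  assumes "0 < h" and cont: "continuous_on {0..h} \<phi>" and "\<phi> 0 = 0"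
    and der: "\<And>t. 0 \<le> t \<Longrightarrow> t < h \<Longrightarrow> (\<phi> has_real_derivative \<psi> t) (at t)"
    and cont': "continuous_on {0..<h} \<psi>"
  shows "ennreal ((\<phi> h)\<^sup>2 / h) \<le> (\<integral>\<^sup>+ t. indicator {0..<h} t * ennreal ((\<psi> t)\<^sup>2) \<partial>lborel)"
    (is "_ \<le> ?J")
proof -
  have le: "ennreal ((\<phi> c)\<^sup>2 / h) \<le> ?J" if c: "0 < c" "c < h" for c
  proof -
    define m where "m = \<phi> c / c"
    have "continuous_on {0..c} \<psi>" using c by (intro continuous_on_subset[OF cont']) auto
    then have int2: "(\<lambda>t. (\<psi> t)\<^sup>2) integrable_on {0..c}"
      by (intro integrable_continuous_real continuous_intros)
    define I where "I = integral {0..c} (\<lambda>t. (\<psi> t)\<^sup>2)"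
    have I: "((\<lambda>t. (\<psi> t)\<^sup>2) has_integral I) {0..c}" unfolding I_def by (rule integrable_integral[OF int2])
    have "(\<psi> has_integral (\<phi> c - \<phi> 0)) {0..c}"
    proof (rule fundamental_theorem_of_calculus)
      show "(\<phi> has_vector_derivative \<psi> x) (at x within {0..c})" if "x \<in> {0..c}" for x
        using der[of x] c that
        by (auto simp: has_real_derivative_iff_has_vector_derivative intro: has_vector_derivative_at_within)
    qed (use c in simp)
    then have "(\<psi> has_integral \<phi> c) {0..c}" using \<open>\<phi> 0 = 0\<close> by simp
    then have "((\<lambda>t. (\<psi> t)\<^sup>2 - 2 * m * \<psi> t + m\<^sup>2) has_integral (I - 2 * m * \<phi> c + c * m\<^sup>2)) {0..c}"
      using has_integral_const_real[of "m\<^sup>2" 0 c] c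
      by (intro has_integral_add has_integral_diff I has_integral_mult_right) auto
    then have "0 \<le> I - 2 * m * \<phi> c + c * m\<^sup>2"
    proof (rule has_integral_nonneg)
      fix t
      have "0 \<le> (\<psi> t - m)\<^sup>2" by simp
      then show "0 \<le> (\<psi> t)\<^sup>2 - 2 * m * \<psi> t + m\<^sup>2" by (simp add: power2_diff algebra_simps)
    qed
    moreover have "m * c = \<phi> c" using c by (simp add: m_def)
    then have "2 * m * \<phi> c - c * m\<^sup>2 = (\<phi> c)\<^sup>2 / c"
      using c by (simp add: m_def power2_eq_square)
    ultimately have "(\<phi> c)\<^sup>2 / c \<le> I" by simp
    moreover have "(\<phi> c)\<^sup>2 / h \<le> (\<phi> c)\<^sup>2 / c" using c by (intro divide_left_mono) auto
    ultimately have "ennreal ((\<phi> c)\<^sup>2 / h) \<le> ennreal I" by (intro ennreal_leI) linarith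
    also have "\<dots> = (\<integral>\<^sup>+ t. indicator {0..c} t * ennreal ((\<psi> t)\<^sup>2) \<partial>lborel)"
      using nn_integral_has_integral_lebesgue[OF _ I] by (simp add: ennreal_mult' ennreal_indicator mult.commute)
    also have "\<dots> \<le> ?J" using c by (intro nn_integral_mono) (auto simp: indicator_def)
    finally show ?thesis .
  qed
  have "(\<phi> \<longlongrightarrow> \<phi> h) (at h within {0..h})"
    using cont \<open>0 < h\<close> by (auto simp: continuous_on_def)
  then have "(\<phi> \<longlongrightarrow> \<phi> h) (at_left h)" using at_within_Icc_at_left[OF \<open>0 < h\<close>] by simp
  then have "((\<lambda>c. ennreal ((\<phi> c)\<^sup>2 / h)) \<longlongrightarrow> ennreal ((\<phi> h)\<^sup>2 / h)) (at_left h)"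
    using \<open>0 < h\<close> by (intro tendsto_intros) auto
  then show ?thesis
  proof (rule tendsto_upperbound)
    have "\<forall>\<^sub>F c in at_left h. c \<in> {0<..<h}" using \<open>0 < h\<close> by (rule eventually_at_left_real)
    then show "\<forall>\<^sub>F c in at_left h. ennreal ((\<phi> c)\<^sup>2 / h) \<le> ?J" by eventually_elim (use le in auto)
  qed simp
qed

lemma square_le_derivative_integral_both:
  fixes \<phi> \<psi> :: "real \<Rightarrow> real"
  assumes h: "0 < h" and cont: "continuous_on {-h..h} \<phi>" and "\<phi> 0 = 0"
    and der: "\<And>t. \<bar>t\<bar> < h \<Longrightarrow> (\<phi> has_real_derivative \<psi> t) (at t)"
    and cont': "continuous_on {-h<..<h} \<psi>"
  shows "ennreal ((\<phi> h)\<^sup>2 / h) + ennreal ((\<phi> (- h))\<^sup>2 / h)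
    \<le> (\<integral>\<^sup>+ t. indicator {-h<..<h} t * ennreal ((\<psi> t)\<^sup>2) \<partial>lborel)"
proof -
  define g where "g t = indicator {-h<..<h} t *\<^sub>R \<psi> t" for t
  have g [measurable]: "g \<in> borel_measurable borel"
    unfolding g_def by (rule borel_measurable_continuous_on_indicator[OF _ cont']) simp
  have 1: "ennreal ((\<phi> h)\<^sup>2 / h) \<le> (\<integral>\<^sup>+ t. indicator {0..<h} t * ennreal ((\<psi> t)\<^sup>2) \<partial>lborel)"
    by (rule square_le_derivative_integral)
       (use h \<open>\<phi> 0 = 0\<close> der in \<open>auto intro: continuous_on_subset[OF cont] continuous_on_subset[OF cont']\<close>)
  have "ennreal ((\<phi> (- h))\<^sup>2 / h) \<le> (\<integral>\<^sup>+ t. indicator {0..<h} t * ennreal ((- \<psi> (- t))\<^sup>2) \<partial>lborel)"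
  proof (rule square_le_derivative_integral[of h "\<lambda>t. \<phi> (- t)"])
    show "continuous_on {0..h} (\<lambda>t. \<phi> (- t))"
      by (rule continuous_on_compose2[OF cont]) (use h in \<open>auto intro!: continuous_intros\<close>)
    show "continuous_on {0..<h} (\<lambda>t. - \<psi> (- t))"
      by (intro continuous_on_minus continuous_on_compose2[OF cont']) (use h in \<open>auto intro!: continuous_intros\<close>)
    show "((\<lambda>t. \<phi> (- t)) has_real_derivative - \<psi> (- t)) (at t)" if "0 \<le> t" "t < h" for t
    proof -
      have "(\<phi> has_real_derivative \<psi> (- t)) (at (- t))" using der[of "- t"] that by simp
      moreover have "((\<lambda>t. - t) has_real_derivative - 1) (at t)" by (auto intro!: derivative_eq_intros)
      ultimately have "((\<lambda>t. \<phi> (- t)) has_real_derivative \<psi> (- t) * - 1) (at t)" by (rule DERIV_chain2)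
      then show ?thesis by simp
    qed
  qed (use h \<open>\<phi> 0 = 0\<close> in auto)
  also have "\<dots> = (\<integral>\<^sup>+ t. indicator {0..<h} t * ennreal ((g (- t))\<^sup>2) \<partial>lborel)"
    using h by (intro nn_integral_cong) (auto simp: indicator_def g_def)
  also have "\<dots> = (\<integral>\<^sup>+ t. indicator {0..<h} (- t) * ennreal ((g t)\<^sup>2) \<partial>lborel)"
  proof -
    have "(\<integral>\<^sup>+ t. indicator {0..<h} (- t) * ennreal ((g t)\<^sup>2) \<partial>lborel)
        = (\<integral>\<^sup>+ t. indicator {0..<h} (- t) * ennreal ((g t)\<^sup>2) \<partial>distr lborel borel uminus)"
      by (simp only: lborel_distr_uminus)
    also have "\<dots> = (\<integral>\<^sup>+ t. indicator {0..<h} t * ennreal ((g (- t))\<^sup>2) \<partial>lborel)"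
      by (subst nn_integral_distr) auto
    finally show ?thesis by simp
  qed
  finally have 2: "ennreal ((\<phi> (- h))\<^sup>2 / h) \<le> (\<integral>\<^sup>+ t. indicator {0..<h} (- t) * ennreal ((g t)\<^sup>2) \<partial>lborel)" .
  have "(\<integral>\<^sup>+ t. indicator {0..<h} t * ennreal ((\<psi> t)\<^sup>2) \<partial>lborel)
      = (\<integral>\<^sup>+ t. indicator {0..<h} t * ennreal ((g t)\<^sup>2) \<partial>lborel)"
    using h by (intro nn_integral_cong) (auto simp: indicator_def g_def)
  then have "ennreal ((\<phi> h)\<^sup>2 / h) + ennreal ((\<phi> (- h))\<^sup>2 / h)
      \<le> (\<integral>\<^sup>+ t. indicator {0..<h} t * ennreal ((g t)\<^sup>2) \<partial>lborel)
        + (\<integral>\<^sup>+ t. indicator {0..<h} (- t) * ennreal ((g t)\<^sup>2) \<partial>lborel)"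
    using 1 2 by (intro add_mono) auto
  also have "\<dots> = (\<integral>\<^sup>+ t. indicator {0..<h} t * ennreal ((g t)\<^sup>2) + indicator {0..<h} (- t) * ennreal ((g t)\<^sup>2) \<partial>lborel)"
    by (rule nn_integral_add[symmetric]) auto
  also have "\<dots> \<le> (\<integral>\<^sup>+ t. indicator {-h<..<h} t * ennreal ((\<psi> t)\<^sup>2) \<partial>lborel)"
  proof (rule nn_integral_mono_AE)
    have "AE t in lborel. t \<noteq> (0::real)" by (rule AE_lborel_singleton)
    then show "AE t in lborel. indicator {0..<h} t * ennreal ((g t)\<^sup>2) + indicator {0..<h} (- t) * ennreal ((g t)\<^sup>2)
        \<le> indicator {-h<..<h} t * ennreal ((\<psi> t)\<^sup>2)"
      by eventually_elim (auto simp: indicator_def g_def)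
  qed
  finally show ?thesis .
qed

section \<open>Partial derivatives within a convex set\<close>

text \<open>
  Two derivatives agree in every direction from \<open>x\<close> to a point of \<open>S\<close>, and differences of such
  directions fill a ball.
\<close>

lemma has_derivative_unique_within_convex:
  fixes f :: "'a::euclidean_space \<Rightarrow> 'b::real_normed_vector"
  assumes S: "convex S" "interior S \<noteq> {}" and x: "x \<in> S"
    and D: "(f has_derivative D) (at x within S)" and E: "(f has_derivative E) (at x within S)"
  shows "D = E"
proof -
  interpret D: bounded_linear D using D by (rule has_derivative_bounded_linear)
  interpret E: bounded_linear E using E by (rule has_derivative_bounded_linear)
  have dir: "D (z - x) = E (z - x)" if z: "z \<in> S" for z
  proof -
    define g where "g s = x + s *\<^sub>R (z - x)" for s :: real
    have gS: "g ` {0..1} \<subseteq> S"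
    proof clarify
      fix s :: real assume "s \<in> {0..1}"
      then have "(1 - s) *\<^sub>R x + s *\<^sub>R z \<in> S" using S(1) x z by (intro convexD) auto
      moreover have "(1 - s) *\<^sub>R x + s *\<^sub>R z = g s" by (simp add: g_def algebra_simps)
      ultimately show "g s \<in> S" by simp
    qed
    have g0: "g 0 = x" by (simp add: g_def)
    have dg: "(g has_vector_derivative (z - x)) (at 0 within {0..1})"
      unfolding g_def by (auto intro!: derivative_eq_intros)
    have vec: "((\<lambda>s. f (g s)) has_vector_derivative F (z - x)) (at 0 within {0..1})"
      if "(f has_derivative F) (at x within S)" for F
    proof -
      have "(f has_derivative F) (at (g 0) within g ` {0..1})"
        using has_derivative_subset[OF that gS] g0 by simp
      from vector_derivative_diff_chain_within[OF dg this] show ?thesis by (simp add: comp_def)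
    qed
    show ?thesis
      by (rule vector_derivative_unique_within[OF _ vec[OF D] vec[OF E]])
         (simp add: trivial_limit_within islimpt_Icc)
  qed
  obtain c r where r: "0 < r" "cball c r \<subseteq> S" using S(2) by (auto simp: mem_interior_cball)
  have "D w = E w" for w
  proof (cases "w = 0")
    case False
    define s where "s = r / norm w"
    have s: "0 < s" "norm (s *\<^sub>R w) = r" using r(1) False by (auto simp: s_def)
    have "c \<in> S" "c + s *\<^sub>R w \<in> S" using r s(2) by (auto intro!: subsetD[OF r(2)] simp: dist_norm)
    then have "D ((c + s *\<^sub>R w - x) - (c - x)) = E ((c + s *\<^sub>R w - x) - (c - x))"
      using dir by (simp only: D.diff E.diff)
    then have "s *\<^sub>R D w = s *\<^sub>R E w" by (simp add: D.scaleR E.scaleR)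
    then show ?thesis using s(1) by simp
  qed (simp add: D.zero E.zero)
  then show ?thesis by auto
qed

lemma partial_within_eq:
  fixes S :: "(real^'n::finite) set"
  assumes "convex S" "interior S \<noteq> {}" "x \<in> S" "(f has_derivative D) (at x within S)"
  shows "partial_within S i f x = D (axis i 1)"
proof -
  have "f differentiable (at x within S)" using assms(4) by (rule differentiableI)
  then have "(f has_derivative frechet_derivative f (at x within S)) (at x within S)"
    by (simp only: frechet_derivative_works)
  from has_derivative_unique_within_convex[OF assms(1-3) this assms(4)]
  show ?thesis by (simp add: partial_within_def)
qed

lemma partial_within_interior:
  "x \<in> interior K \<Longrightarrow> partial_within K i f x = partial_within (interior K) i f x"
  unfolding partial_within_def by (simp only: at_within_interior at_within_open[OF _ open_interior])

lemma coord_reflect_eq: "coord_reflect i x = x - (2 * x $ i) *\<^sub>R axis i 1"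
  by (simp add: coord_reflect_def vec_eq_iff axis_def)

lemma uncond_symmetric_body:
  fixes K :: "(real^'n::finite) set"
  assumes "K \<in> uncond_bodies"
  shows "symmetric_body K (axis i 1)"
proof
  show "compact K" "convex K" "0 \<in> interior K" using assms by (auto simp: uncond_bodies_def)
  show "axis i 1 \<in> (Basis :: (real^'n) set)" by (simp add: axis_in_Basis_iff)
  fix x assume "x \<in> K"
  then have "coord_reflect i x \<in> K" using assms by (auto simp: uncond_bodies_def)
  moreover have "coord_reflect i x = x - (2 * (x \<bullet> axis i 1)) *\<^sub>R axis i 1"
    by (simp add: coord_reflect_eq inner_axis)
  ultimately show "x - (2 * (x \<bullet> axis i 1)) *\<^sub>R axis i 1 \<in> K" by simp
qed

section \<open>The inequality\<close>

lemma uncond_normal_sign: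
  fixes K :: "(real^'n::finite) set"
  assumes "K \<in> uncond_bodies" "x \<in> K" "is_outer_unit_normal K x v"
  shows "0 \<le> x $ i * v $ i"
proof -
  have "coord_reflect i x \<in> K" using assms by (auto simp: uncond_bodies_def)
  then have "(coord_reflect i x - x) \<bullet> v \<le> 0" using assms(3) by (auto simp: is_outer_unit_normal_def)
  then show ?thesis by (simp add: coord_reflect_eq inner_axis' mult.assoc mult.commute[of "v $ i"])
qed

text \<open>
  The Cauchy-Schwarz inequality for \<open>u\<^sub>i \<nu>\<^sub>i = p\<^sub>i q\<^sub>i\<close> with \<open>q\<^sub>i\<^sup>2 = x\<^sub>i \<nu>\<^sub>i\<close>. If \<open>x\<^sub>i = 0\<close> the convention
  \<open>0 / 0 = 0\<close> is harmless, since then \<open>u\<^sub>i = 0\<close>.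
\<close>

lemma normal_deriv_bound:
  fixes K :: "(real^'n::finite) set"
  assumes K: "K \<in> uncond_bodies" and x: "x \<in> frontier K"
    and van: "\<And>i. x $ i = 0 \<Longrightarrow> partial_within K i u x = 0"
  shows "ennreal ((normal_deriv K u x)\<^sup>2 / inner x (outer_unit_normal K x))
    \<le> (\<Sum>i\<in>UNIV. ennreal ((partial_within K i u x)\<^sup>2 / \<bar>x $ i\<bar>) * ennreal \<bar>convex_body.normal K x \<bullet> axis i 1\<bar>)"
proof (cases "x \<in> smooth_points K")
  case False
  then show ?thesis using x by (simp add: normal_deriv_def outer_unit_normal_not_smooth)
next
  case True
  interpret convex_body K using uncond_symmetric_body[OF K] by (simp add: symmetric_body_def)
  let ?\<nu> = "outer_unit_normal K x" and ?D = "\<lambda>i. partial_within K i u x"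
  have \<nu>: "is_outer_unit_normal K x ?\<nu>" by (rule outer_unit_normal_smooth(1)[OF True])
  have nrm: "normal x = ?\<nu>" using True by (simp add: normal_def)
  have xK: "x \<in> K" using x frontier_subset by auto
  note sgn = uncond_normal_sign[OF K xK \<nu>]
  have pos: "0 < x \<bullet> ?\<nu>" by (rule normal_inner_pos[OF \<nu>])
  define p where "p i = ?D i * sgn (?\<nu> $ i) * sqrt (\<bar>?\<nu> $ i\<bar> / \<bar>x $ i\<bar>)" for i
  define q where "q i = sqrt (\<bar>x $ i\<bar> * \<bar>?\<nu> $ i\<bar>)" for i
  have pq: "p i * q i = ?D i * ?\<nu> $ i" for i
  proof (cases "x $ i = 0")
    case False
    have "sqrt (\<bar>?\<nu> $ i\<bar> / \<bar>x $ i\<bar>) * sqrt (\<bar>x $ i\<bar> * \<bar>?\<nu> $ i\<bar>) = \<bar>?\<nu> $ i\<bar>"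
      using False by (simp flip: real_sqrt_mult)
    then have "p i * q i = ?D i * (sgn (?\<nu> $ i) * \<bar>?\<nu> $ i\<bar>)" by (simp add: p_def q_def mult.assoc)
    then show ?thesis by (simp add: sgn_mult_abs)
  qed (simp add: p_def van)
  have p2: "(p i)\<^sup>2 = (?D i)\<^sup>2 / \<bar>x $ i\<bar> * \<bar>?\<nu> $ i\<bar>" for i
    by (cases "?\<nu> $ i = 0") (simp_all add: p_def power_mult_distrib sgn_if)
  have q2: "(q i)\<^sup>2 = x $ i * ?\<nu> $ i" for i
    using sgn[of i] by (simp add: q_def abs_mult[symmetric])
  have nd: "normal_deriv K u x = (\<Sum>i\<in>UNIV. p i * q i)"
    by (simp add: normal_deriv_def grad_within_def inner_vec_def pq)
  have "(normal_deriv K u x)\<^sup>2 \<le> (\<Sum>i\<in>UNIV. (p i)\<^sup>2) * (\<Sum>i\<in>UNIV. (q i)\<^sup>2)"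
    unfolding nd by (rule Cauchy_Schwarz_ineq_sum)
  also have "(\<Sum>i\<in>UNIV. (q i)\<^sup>2) = x \<bullet> ?\<nu>" by (simp add: q2 inner_vec_def)
  finally have "(normal_deriv K u x)\<^sup>2 / (x \<bullet> ?\<nu>) \<le> (\<Sum>i\<in>UNIV. (p i)\<^sup>2)"
    using pos by (simp add: pos_divide_le_eq)
  then have "ennreal ((normal_deriv K u x)\<^sup>2 / (x \<bullet> ?\<nu>)) \<le> ennreal (\<Sum>i\<in>UNIV. (?D i)\<^sup>2 / \<bar>x $ i\<bar> * \<bar>?\<nu> $ i\<bar>)"
    unfolding p2 by (rule ennreal_leI)
  also have "\<dots> = (\<Sum>i\<in>UNIV. ennreal ((?D i)\<^sup>2 / \<bar>x $ i\<bar> * \<bar>?\<nu> $ i\<bar>))"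
    by (rule sum_ennreal[symmetric]) simp
  also have "\<dots> = (\<Sum>i\<in>UNIV. ennreal ((?D i)\<^sup>2 / \<bar>x $ i\<bar>) * ennreal \<bar>?\<nu> $ i\<bar>)"
    by (intro sum.cong refl ennreal_mult) auto
  finally show ?thesis by (simp add: nrm inner_axis)
qed

lemma measurable_extend_zero:
  fixes f :: "'a::euclidean_space \<Rightarrow> real"
  assumes "A \<in> sets borel" "continuous_on A f"
  shows "(\<lambda>x. indicator A x * f x) \<in> borel_measurable borel"
  using borel_measurable_continuous_on_indicator[OF assms] by simp

lemma S0_partial:
  fixes K :: "(real^'n::finite) set"
  assumes K: "K \<in> uncond_bodies" and u: "u \<in> S0 K"
  defines "w i \<equiv> partial_within (interior K) i (partial_within (interior K) i u)"
  shows "continuous_on K (partial_within K i u)" "continuous_on (interior K) (w i)"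
    and "y + t *\<^sub>R axis i 1 \<in> interior K \<Longrightarrow>
      ((\<lambda>t. partial_within K i u (y + t *\<^sub>R axis i 1)) has_real_derivative w i (y + t *\<^sub>R axis i 1)) (at t)"
proof -
  let ?v = "partial_within (interior K) i u"
  show "continuous_on K (partial_within K i u)" using u by (auto simp: S0_def C1_on_def)
  have C1: "C1_on (interior K) ?v" using u by (auto simp: S0_def C2_on_def)
  then show "continuous_on (interior K) (w i)" by (auto simp: C1_on_def w_def)
  let ?g = "\<lambda>t. y + t *\<^sub>R axis i 1 :: real^'n"
  assume t: "?g t \<in> interior K"
  have "?v differentiable (at (?g t) within interior K)"
    using C1 t unfolding C1_on_def differentiable_on_def by blast
  then have "?v differentiable (at (?g t))" by (simp only: at_within_open[OF t open_interior])
  then have D: "(?v has_derivative frechet_derivative ?v (at (?g t))) (at (?g t))" (is "(_ has_derivative ?D) _")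
    by (simp only: frechet_derivative_works)
  have wD: "w i (?g t) = ?D (axis i 1)"
    unfolding w_def partial_within_def[of _ _ ?v] at_within_open[OF t open_interior] by (rule refl)
  have "(?g has_vector_derivative axis i 1) (at t)" by (auto intro!: derivative_eq_intros)
  from vector_derivative_diff_chain_within[of ?g _ t UNIV ?v ?D] this D
  have "((\<lambda>t. ?v (?g t)) has_vector_derivative w i (?g t)) (at t)"
    unfolding wD by (auto simp: comp_def intro: has_derivative_at_withinI)
  then have v: "((\<lambda>t. ?v (?g t)) has_real_derivative w i (?g t)) (at t)"
    by (simp add: has_real_derivative_iff_has_vector_derivative)
  have "open (?g -` interior K)" by (intro open_vimage open_interior continuous_intros)
  then show "((\<lambda>t. partial_within K i u (?g t)) has_real_derivative w i (?g t)) (at t)"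
  proof (rule has_field_derivative_transform_within_open[OF v])
    show "?v (?g s) = partial_within K i u (?g s)" if "s \<in> ?g -` interior K" for s
      by (rule partial_within_interior[symmetric]) (use that in simp)
  qed (use t in simp)
qed

text \<open>
  Extending by \<open>0\<close> outside \<open>K\<close> makes the integrand measurable. Over almost every point of the hyperplane inside
  the projection, the one-dimensional inequality applies to the fibre through it, on both sides of
  the hyperplane.
\<close>

lemma projected_partial_bound:
  fixes K :: "(real^'n::finite) set"
  assumes K: "K \<in> uncond_bodies" and u: "u \<in> S0 K"
    and van: "\<And>x. x \<in> K \<Longrightarrow> x $ i = 0 \<Longrightarrow> partial_within K i u x = 0"
  defines "w \<equiv> partial_within (interior K) i (partial_within (interior K) i u)"
  shows "(\<integral>\<^sup>+ x. ennreal ((indicator K x * partial_within K i u x)\<^sup>2 / \<bar>x $ i\<bar>)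
        * ennreal \<bar>convex_body.normal K x \<bullet> axis i 1\<bar> \<partial>hausdorff_measure (CARD('n) - 1))
    \<le> (\<integral>\<^sup>+ x. indicator (interior K) x * ennreal ((w x)\<^sup>2) \<partial>lborel)"
proof -
  interpret symmetric_body K "axis i 1" by (rule uncond_symmetric_body[OF K])
  let ?b = "axis i 1 :: real^'n"
  define p where "p x = indicator K x * partial_within K i u x" for x
  define F where "F x = ennreal ((p x)\<^sup>2 / \<bar>x $ i\<bar>)" for x
  define W where "W x = indicator (interior K) x * w x" for x
  note S0 = S0_partial[OF K u, where i=i, folded w_def]
  have [measurable]: "p \<in> borel_measurable borel"
    unfolding p_def by (rule measurable_extend_zero[OF K_borel S0(1)])
  have [measurable]: "W \<in> borel_measurable borel"
    unfolding W_def by (rule measurable_extend_zero[OF _ S0(2)]) simp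
  have [measurable]: "(\<lambda>x::real^'n. x $ i) \<in> borel_measurable borel"
    by (intro borel_measurable_continuous_onI continuous_intros)
  have F [measurable]: "F \<in> borel_measurable borel" unfolding F_def by measurable
  have "(\<integral>\<^sup>+ x. F x * ennreal \<bar>normal x \<bullet> ?b\<bar> \<partial>hausdorff_measure (DIM(real^'n) - 1))
      = (\<integral>\<^sup>+ y. indicator K y * (F (top_point y) + F (reflect (top_point y))) \<partial>flat_lborel ?b)"
    by (rule boundary_projection_formula[OF F])
  also have "\<dots> \<le> (\<integral>\<^sup>+ y. (\<integral>\<^sup>+ t. ennreal ((W (y + t *\<^sub>R ?b))\<^sup>2) \<partial>lborel) \<partial>flat_lborel ?b)"
  proof (rule nn_integral_mono_AE)
    have main: "F (top_point y) + F (reflect (top_point y)) \<le> (\<integral>\<^sup>+ t. ennreal ((W (y + t *\<^sub>R ?b))\<^sup>2) \<partial>lborel)"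
      if y: "y \<in> interior K" "y \<bullet> ?b = 0" for y
    proof -
      define h where "h = height y"
      have h: "0 < h" using height_pos[OF y(1)] by (simp add: h_def)
      have yK: "y \<in> K" using y(1) interior_subset by auto
      have yi: "y $ i = 0" using y(2) by (simp add: inner_axis)
      have top: "top_point y = y + h *\<^sub>R ?b" by (simp add: top_point_def h_def)
      have bot: "reflect (top_point y) = y + (- h) *\<^sub>R ?b" using reflect_top_point[OF y(2)] by (simp add: h_def)
      have topK: "y + h *\<^sub>R ?b \<in> K" using top_point_in_K[OF yK] top by simp
      have botK: "y + (- h) *\<^sub>R ?b \<in> K" 
      proof -
        have "reflect (top_point y) \<in> K" using topK top by (simp only: reflect_in_K)
        then show ?thesis by (simp only: bot)
      qed
      have int: "y + t *\<^sub>R ?b \<in> interior K" if "\<bar>t\<bar> < h" for t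
        using fibre_interior[OF y] that by (simp add: h_def)
      define \<phi> where "\<phi> t = partial_within K i u (y + t *\<^sub>R ?b)" for t
      define \<psi> where "\<psi> t = w (y + t *\<^sub>R ?b)" for t
      have seg: "y + t *\<^sub>R ?b \<in> K" if "t \<in> {-h..h}" for t
      proof (cases "\<bar>t\<bar> < h")
        case True
        then show ?thesis using int interior_subset by auto
      next
        case False
        then have "t = h \<or> t = - h" using that by auto
        then show ?thesis using topK botK by auto
      qed
      have "ennreal ((\<phi> h)\<^sup>2 / h) + ennreal ((\<phi> (- h))\<^sup>2 / h)
          \<le> (\<integral>\<^sup>+ t. indicator {-h<..<h} t * ennreal ((\<psi> t)\<^sup>2) \<partial>lborel)"
      proof (rule square_le_derivative_integral_both[OF h])
        show "continuous_on {-h..h} \<phi>" unfolding \<phi>_def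
          by (rule continuous_on_compose2[OF S0(1)]) (auto intro!: continuous_intros seg)
        show "continuous_on {-h<..<h} \<psi>" unfolding \<psi>_def
          by (rule continuous_on_compose2[OF S0(2)]) (auto intro!: continuous_intros int)
        show "\<phi> 0 = 0" using van[OF yK yi] by (simp add: \<phi>_def)
        show "(\<phi> has_real_derivative \<psi> t) (at t)" if "\<bar>t\<bar> < h" for t
          unfolding \<phi>_def \<psi>_def by (rule S0(3)[OF int[OF that]])
      qed
      also have "\<dots> \<le> (\<integral>\<^sup>+ t. ennreal ((W (y + t *\<^sub>R ?b))\<^sup>2) \<partial>lborel)"
        by (intro nn_integral_mono) (use int in \<open>auto simp: indicator_def W_def \<psi>_def\<close>)
      finally show ?thesis
        unfolding bot unfolding top F_def p_def using topK botK h yi by (simp add: \<phi>_def)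
    qed
    show "AE y in flat_lborel ?b. indicator K y * (F (top_point y) + F (reflect (top_point y)))
        \<le> (\<integral>\<^sup>+ t. ennreal ((W (y + t *\<^sub>R ?b))\<^sup>2) \<partial>lborel)"
      using AE_hyperplane_interior AE_hyperplane[OF b]
      by eventually_elim (use main in \<open>auto simp: indicator_def\<close>)
  qed
  also have "\<dots> = (\<integral>\<^sup>+ x. ennreal ((W x)\<^sup>2) \<partial>lborel)"
    by (rule hyperplane_fubini[OF b, symmetric]) measurable
  also have "\<dots> = (\<integral>\<^sup>+ x. indicator (interior K) x * ennreal ((w x)\<^sup>2) \<partial>lborel)"
    by (intro nn_integral_cong) (auto simp: W_def indicator_def)
  finally show ?thesis by (simp add: F_def p_def)
qed

theorem boundary_le_diag:
  fixes K :: "(real^'n::finite) set"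
  assumes K: "K \<in> uncond_bodies" and u: "u \<in> S0 K"
    and van: "\<And>i x. x \<in> K \<Longrightarrow> x $ i = 0 \<Longrightarrow> partial_within K i u x = 0"
  shows "boundary_integral K u \<le> diag_hessian_integral K u"
proof -
  interpret convex_body K using uncond_symmetric_body[OF K] by (simp add: symmetric_body_def)
  define p where "p i x = indicator K x * partial_within K i u x" for i x
  define w where "w i = partial_within (interior K) i (partial_within (interior K) i u)" for i
  note S0 = S0_partial[OF K u, folded w_def]
  let ?H = "hausdorff_measure (CARD('n) - 1) :: (real^'n) measure"
  have [measurable]: "p i \<in> borel_measurable borel" for i
    unfolding p_def by (rule measurable_extend_zero[OF borel_compact[OF K_compact] S0(1)])
  have [measurable]: "(\<lambda>x::real^'n. x $ i) \<in> borel_measurable borel" for i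
    by (intro borel_measurable_continuous_onI continuous_intros)
  have "boundary_integral K u \<le> (\<integral>\<^sup>+ x. (\<Sum>i\<in>UNIV. ennreal ((p i x)\<^sup>2 / \<bar>x $ i\<bar>) * ennreal \<bar>normal x \<bullet> axis i 1\<bar>) \<partial>?H)"
    unfolding boundary_integral_def
  proof (rule nn_integral_mono)
    fix x
    show "ennreal ((normal_deriv K u x)\<^sup>2 / inner x (outer_unit_normal K x)) * indicator (frontier K) x
        \<le> (\<Sum>i\<in>UNIV. ennreal ((p i x)\<^sup>2 / \<bar>x $ i\<bar>) * ennreal \<bar>normal x \<bullet> axis i 1\<bar>)"
    proof (cases "x \<in> frontier K")
      case True
      then have "x \<in> K" using frontier_subset by auto
      then show ?thesis using normal_deriv_bound[OF K True van] True by (simp add: p_def)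
    qed simp
  qed
  also have "\<dots> = (\<Sum>i\<in>UNIV. \<integral>\<^sup>+ x. ennreal ((p i x)\<^sup>2 / \<bar>x $ i\<bar>) * ennreal \<bar>normal x \<bullet> axis i 1\<bar> \<partial>?H)"
    by (rule nn_integral_sum) auto
  also have "\<dots> \<le> (\<Sum>i\<in>UNIV. \<integral>\<^sup>+ x. indicator (interior K) x * ennreal ((w i x)\<^sup>2) \<partial>lborel)"
    unfolding p_def w_def by (intro sum_mono projected_partial_bound K u van)
  also have "\<dots> = (\<Sum>i\<in>UNIV. \<integral>\<^sup>+ x. ennreal ((indicator (interior K) x * w i x)\<^sup>2) \<partial>lborel)"
    by (intro sum.cong nn_integral_cong) (auto simp: indicator_def)
  also have "\<dots> = (\<integral>\<^sup>+ x. (\<Sum>i\<in>UNIV. ennreal ((indicator (interior K) x * w i x)\<^sup>2)) \<partial>lborel)"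
  proof (rule nn_integral_sum[symmetric])
    fix i
    have [measurable]: "(\<lambda>x. indicator (interior K) x * w i x) \<in> borel_measurable borel"
      by (rule measurable_extend_zero[OF _ S0(2)]) simp
    show "(\<lambda>x. ennreal ((indicator (interior K) x * w i x)\<^sup>2)) \<in> borel_measurable lborel" by measurable
  qed
  also have "\<dots> = diag_hessian_integral K u"
    unfolding diag_hessian_integral_def
    by (intro nn_integral_cong) (auto simp: indicator_def hessian_within_def w_def)
  finally show ?thesis .
qed

lemma diag_le_hessian:
  "diag_hessian_integral K u \<le> hessian_integral K u"
  unfolding diag_hessian_integral_def hessian_integral_def
proof (intro nn_integral_mono mult_right_mono ennreal_leI)
  fix x
  let ?M = "hessian_within (interior K) u x"
  have "(?M $ i $ i)\<^sup>2 \<le> ?M $ i \<bullet> ?M $ i" for i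
    using power_mono[OF component_le_norm_cart[of "?M $ i" i], of 2] by (simp add: power2_norm_eq_inner)
  then have "(\<Sum>i\<in>UNIV. (?M $ i $ i)\<^sup>2) \<le> (\<Sum>i\<in>UNIV. ?M $ i \<bullet> ?M $ i)" by (rule sum_mono)
  also have "\<dots> = (norm ?M)\<^sup>2" unfolding power2_norm_eq_inner by (rule inner_vec_def[symmetric])
  finally show "(\<Sum>i\<in>UNIV. (?M $ i $ i)\<^sup>2) \<le> (norm ?M)\<^sup>2" .
qed simp

text \<open>
  At an interior point the derivative is invariant under the reflection, which changes the sign of its
  \<open>i\<close>-th entry. A boundary point is approached along the segment from the origin.
\<close>

lemma S0_uncond_partial_zero:
  fixes K :: "(real^'n::finite) set"
  assumes K: "K \<in> uncond_bodies" and u: "u \<in> S0_uncond K" and x: "x \<in> K" "x $ i = 0"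
  shows "partial_within K i u x = 0"
proof -
  interpret symmetric_body K "axis i 1" by (rule uncond_symmetric_body[OF K])
  have refl: "coord_reflect i = reflect"
    by (auto simp: coord_reflect_eq reflect_def inner_axis)
  have inv: "u (reflect z) = u z" if "z \<in> K" for z
    using u that by (auto simp: S0_uncond_def refl[symmetric])
  have C1: "C1_on K u" using u by (auto simp: S0_uncond_def S0_def)
  have int: "partial_within K i u z = 0" if z: "z \<in> interior K" "z $ i = 0" for z
  proof -
    have zK: "z \<in> K" using z(1) interior_subset by auto
    have "u differentiable (at z)"
      using C1 zK z(1) by (metis C1_on_def differentiable_on_def at_within_interior)
    then obtain D where D: "(u has_derivative D) (at z)" by (auto simp: differentiable_def)
    have rz: "reflect z = z" using z(2) by (simp add: reflect_def inner_axis)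
    have "bounded_linear reflect"
      unfolding reflect_def by (intro bounded_linear_intros)
    then have "(reflect has_derivative reflect) (at z)" by (rule bounded_linear_imp_has_derivative)
    from diff_chain_at[OF this, of u D] D rz
    have "(u \<circ> reflect has_derivative D \<circ> reflect) (at z)" by simp
    then have "(u has_derivative D \<circ> reflect) (at z)"
      by (rule has_derivative_transform_within_open[of _ _ _ _ "interior K"])
         (use z inv interior_subset in auto)
    then have "D \<circ> reflect = D" using D by (rule has_derivative_unique)
    then have "D (reflect (axis i 1)) = D (axis i 1)" by (metis comp_apply)
    moreover have "reflect (axis i 1) = - axis i (1::real)"
      by (simp add: reflect_def inner_axis_axis scaleR_2)
    moreover have "D (- axis i 1) = - D (axis i 1)"
      using has_derivative_linear[OF D] by (simp add: linear_neg)
    ultimately have "D (axis i 1) = 0" by simp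
    moreover have "partial_within K i u z = D (axis i 1)"
      by (rule partial_within_eq[OF K_convex _ zK]) (use K_zero D in \<open>auto intro: has_derivative_at_withinI\<close>)
    ultimately show ?thesis by simp
  qed
  define z where "z n = x - (1 / real (Suc n)) *\<^sub>R x" for n
  have zint: "z n \<in> interior K" for n
    using mem_interior_convex_shrink[OF K_convex K_zero x(1), of "1 / real (Suc n)"] by (simp add: z_def)
  then have zK: "z n \<in> K" for n using interior_subset by auto
  have "z \<longlonglongrightarrow> x - 0 *\<^sub>R x"
    unfolding z_def by (intro tendsto_intros LIMSEQ_inverse_real_of_nat[unfolded inverse_eq_divide])
  then have lim: "z \<longlonglongrightarrow> x" by simp
  have cont: "continuous_on K (partial_within K i u)" using C1 by (simp add: C1_on_def)
  have "(\<lambda>n. partial_within K i u (z n)) \<longlonglongrightarrow> partial_within K i u x"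
    by (rule continuous_on_tendsto_compose[OF cont lim x(1)]) (simp add: zK)
  moreover have "partial_within K i u (z n) = 0" for n
    by (rule int[OF zint]) (simp add: z_def x(2))
  ultimately show ?thesis by (simp add: LIMSEQ_const_iff)
qed

section \<open>Sharpness\<close>

text \<open>
  Its gradient at \<open>x\<close> is \<open>x\<close> itself, which turns the Cauchy-Schwarz inequality above into an equality.
\<close>

definition half_square :: "real^'n::finite \<Rightarrow> real" where
  "half_square x = (x \<bullet> x) / 2"

lemma partial_half_square:
  fixes S :: "(real^'n::finite) set"
  assumes S: "convex S" "interior S \<noteq> {}" "x \<in> S"
  shows "partial_within S i half_square x = x $ i"
    and "partial_within S i (partial_within S j half_square) x = (if i = j then 1 else 0)"
    and "half_square differentiable (at x within S)"
    and "partial_within S j half_square differentiable (at x within S)"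
proof -
  have d: "(half_square has_derivative (\<lambda>h. x \<bullet> h)) (at x within S)" for x :: "real^'n"
    unfolding half_square_def
    by (auto intro!: derivative_eq_intros simp: inner_commute)
  have p: "partial_within S i half_square x = x $ i" if "x \<in> S" for x i
    using partial_within_eq[OF S(1,2) that d] by (simp add: inner_axis)
  show "partial_within S i half_square x = x $ i" by (rule p[OF S(3)])
  show "half_square differentiable (at x within S)" using d by (auto simp: differentiable_def)
  have "((\<lambda>x. x $ j) has_derivative (\<lambda>h. h $ j)) (at x within S)"
    by (rule bounded_linear_imp_has_derivative) (rule bounded_linear_vec_nth)
  then have d2: "(partial_within S j half_square has_derivative (\<lambda>h. h $ j)) (at x within S)"
    by (rule has_derivative_transform[OF S(3), rotated]) (simp add: p)
  then show "partial_within S j half_square differentiable (at x within S)" by (auto simp: differentiable_def)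
  show "partial_within S i (partial_within S j half_square) x = (if i = j then 1 else 0)"
    using partial_within_eq[OF S d2] by (simp add: axis_def)
qed

lemma C_half_square:
  fixes S :: "(real^'n::finite) set"
  assumes S: "convex S" "interior S \<noteq> {}"
  shows "C1_on S half_square" "C2_on S half_square"
proof -
  note ph = partial_half_square[OF S]
  have "continuous_on S (\<lambda>x. x $ i)" for i by (intro continuous_intros)
  then have "continuous_on S (partial_within S i half_square)" for i
    by (rule continuous_on_eq) (simp add: ph)
  then show C1: "C1_on S half_square" by (auto simp: C1_on_def differentiable_on_def ph)
  have "continuous_on S (partial_within S i (partial_within S j half_square))" for i j
    by (rule continuous_on_eq[of _ "\<lambda>_. if i = j then 1 else 0"]) (auto simp: ph)
  then show "C2_on S half_square" using C1 by (auto simp: C2_on_def C1_on_def differentiable_on_def ph)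
qed

lemma half_square_S0_uncond:
  fixes K :: "(real^'n::finite) set"
  assumes K: "K \<in> uncond_bodies"
  shows "half_square \<in> S0_uncond K"
proof -
  interpret convex_body K using uncond_symmetric_body[OF K] by (simp add: symmetric_body_def)
  have i: "interior K \<noteq> {}" using K_zero by auto
  have "half_square (coord_reflect i x) = half_square x" for i and x :: "real^'n"
    by (auto simp: half_square_def inner_vec_def coord_reflect_def intro!: sum.cong)
  then show ?thesis
    using C_half_square[OF K_convex i] C_half_square[OF convex_interior[OF K_convex]] i
    by (auto simp: S0_uncond_def S0_def)
qed

text \<open>
  The integrand is \<open>\<langle>x, \<nu>\<rangle> = \<Sum> \<bar>x\<^sub>i\<bar> \<bar>\<nu>\<^sub>i\<bar>\<close>, and by the projection formula the integral of each summand is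
  the integral of the chord lengths of \<open>K\<close> in the \<open>i\<close>-th direction, which is the volume.
\<close>

lemma boundary_integral_half_square:
  fixes K :: "(real^'n::finite) set"
  assumes K: "K \<in> uncond_bodies"
  shows "of_nat CARD('n) * emeasure lborel K \<le> boundary_integral K half_square"
proof -
  interpret C: convex_body K using uncond_symmetric_body[OF K] by (simp add: symmetric_body_def)
  let ?H = "hausdorff_measure (CARD('n) - 1) :: (real^'n) measure"
  have iK: "interior K \<noteq> {}" using C.K_zero by auto
  note [measurable] = C.normal_measurable
  have [measurable]: "(\<lambda>x::real^'n. x $ i) \<in> borel_measurable borel" for i
    by (intro borel_measurable_continuous_onI continuous_intros)
  have vol: "emeasure lborel K \<le> (\<integral>\<^sup>+ x. ennreal \<bar>x $ i\<bar> * ennreal \<bar>C.normal x \<bullet> axis i 1\<bar> \<partial>?H)" for i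
  proof -
    interpret symmetric_body K "axis i 1" by (rule uncond_symmetric_body[OF K])
    let ?b = "axis i 1 :: real^'n"
    have "emeasure lborel K = (\<integral>\<^sup>+ x. indicator K x \<partial>lborel)" by simp
    also have "\<dots> = (\<integral>\<^sup>+ y. (\<integral>\<^sup>+ t. indicator K (y + t *\<^sub>R ?b) \<partial>lborel) \<partial>flat_lborel ?b)"
      by (rule hyperplane_fubini[OF b]) measurable
    also have "\<dots> \<le> (\<integral>\<^sup>+ y. indicator K y * (ennreal \<bar>top_point y $ i\<bar> + ennreal \<bar>reflect (top_point y) $ i\<bar>) \<partial>flat_lborel ?b)"
    proof (rule nn_integral_mono_AE)
      show "AE y in flat_lborel ?b. (\<integral>\<^sup>+ t. indicator K (y + t *\<^sub>R ?b) \<partial>lborel)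
          \<le> indicator K y * (ennreal \<bar>top_point y $ i\<bar> + ennreal \<bar>reflect (top_point y) $ i\<bar>)"
        using AE_hyperplane[OF b]
      proof eventually_elim
        case (elim y)
        have yi: "y $ i = 0" using elim by (simp add: inner_axis)
        have yK: "y \<in> K" if "y + t *\<^sub>R ?b \<in> K" for t
        proof -
          have "shadow (y + t *\<^sub>R ?b) = y" using elim by (simp add: shadow_eq inner_add_left inner_axis_axis)
          then show ?thesis using shadow_in_K[OF that] by simp
        qed
        show ?case
        proof (cases "y \<in> K")
          case False
          then have "indicator K (y + t *\<^sub>R ?b) = (0::ennreal)" for t using yK by (auto simp: indicator_def)
          then show ?thesis by simp
        next
          case True
          have h0: "0 \<le> height y" by (rule height_nonneg[OF True])
          have "t \<in> {- height y..height y}" if t: "y + t *\<^sub>R ?b \<in> K" for t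
          proof -
            have "reflect (y + t *\<^sub>R ?b) = y + (- t) *\<^sub>R ?b"
              using elim by (simp add: reflect_def inner_add_left inner_axis_axis algebra_simps scaleR_2 flip: scaleR_add_left)
            then have "y + (- t) *\<^sub>R ?b \<in> K" using reflect_in_K[of "y + t *\<^sub>R ?b"] t by simp
            then show ?thesis using height_upper[OF True t] height_upper[OF True, of "- t"] by simp
          qed
          then have "(\<integral>\<^sup>+ t. indicator K (y + t *\<^sub>R ?b) \<partial>lborel) \<le> (\<integral>\<^sup>+ t. indicator {- height y..height y} t \<partial>lborel)"
            by (intro nn_integral_mono) (auto simp: indicator_def)
          also have "\<dots> = ennreal (height y + height y)" using h0 by simp
          also have "\<dots> = ennreal (height y) + ennreal (height y)" by (rule ennreal_plus[OF h0 h0])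
          also have "\<dots> = indicator K y * (ennreal \<bar>top_point y $ i\<bar> + ennreal \<bar>reflect (top_point y) $ i\<bar>)"
            unfolding reflect_top_point[OF elim] unfolding top_point_def using True h0 yi by simp
          finally show ?thesis .
        qed
      qed
    qed
    also have "\<dots> = (\<integral>\<^sup>+ x. ennreal \<bar>x $ i\<bar> * ennreal \<bar>C.normal x \<bullet> axis i 1\<bar> \<partial>?H)"
      using boundary_projection_formula[of "\<lambda>x. ennreal \<bar>x $ i\<bar>"] by simp
    finally show ?thesis .
  qed
  have "of_nat CARD('n) * emeasure lborel K = (\<Sum>i\<in>(UNIV::'n set). emeasure lborel K)" by simp
  also have "\<dots> \<le> (\<Sum>i\<in>UNIV. \<integral>\<^sup>+ x. ennreal \<bar>x $ i\<bar> * ennreal \<bar>C.normal x \<bullet> axis i 1\<bar> \<partial>?H)"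
    by (intro sum_mono vol)
  also have "\<dots> = (\<integral>\<^sup>+ x. (\<Sum>i\<in>UNIV. ennreal \<bar>x $ i\<bar> * ennreal \<bar>C.normal x \<bullet> axis i 1\<bar>) \<partial>?H)"
    by (rule nn_integral_sum[symmetric]) auto
  also have "\<dots> \<le> boundary_integral K half_square"
    unfolding boundary_integral_def
  proof (rule nn_integral_mono)
    fix x
    show "(\<Sum>i\<in>UNIV. ennreal \<bar>x $ i\<bar> * ennreal \<bar>C.normal x \<bullet> axis i 1\<bar>)
        \<le> ennreal ((normal_deriv K half_square x)\<^sup>2 / inner x (outer_unit_normal K x)) * indicator (frontier K) x"
    proof (cases "x \<in> smooth_points K")
      case True
      let ?\<nu> = "outer_unit_normal K x"
      have x: "x \<in> frontier K" using True by (simp add: smooth_points_def)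
      then have xK: "x \<in> K" using C.frontier_subset by auto
      have \<nu>: "is_outer_unit_normal K x ?\<nu>" by (rule outer_unit_normal_smooth(1)[OF True])
      note sgn = uncond_normal_sign[OF K xK \<nu>]
      have pos: "0 < x \<bullet> ?\<nu>" by (rule C.normal_inner_pos[OF \<nu>])
      have "normal_deriv K half_square x = x \<bullet> ?\<nu>"
        by (simp add: normal_deriv_def grad_within_def partial_half_square(1)[OF C.K_convex iK xK])
      then have "(normal_deriv K half_square x)\<^sup>2 / (x \<bullet> ?\<nu>) = x \<bullet> ?\<nu>"
        using pos by (simp add: power2_eq_square)
      moreover have "(\<Sum>i\<in>UNIV. ennreal \<bar>x $ i\<bar> * ennreal \<bar>C.normal x \<bullet> axis i 1\<bar>) = ennreal (x \<bullet> ?\<nu>)"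
      proof -
        have "ennreal \<bar>x $ i\<bar> * ennreal \<bar>C.normal x \<bullet> axis i 1\<bar> = ennreal (x $ i * ?\<nu> $ i)" for i
          using True sgn[of i] by (simp add: C.normal_def inner_axis flip: ennreal_mult abs_mult)
        then show ?thesis using sgn by (simp add: inner_vec_def)
      qed
      ultimately show ?thesis using x by simp
    qed (simp add: C.normal_def)
  qed
  finally show ?thesis .
qed

lemma hessian_integral_half_square:
  fixes K :: "(real^'n::finite) set"
  assumes K: "K \<in> uncond_bodies"
  shows "hessian_integral K half_square = of_nat CARD('n) * emeasure lborel (interior K)"
proof -
  interpret convex_body K using uncond_symmetric_body[OF K] by (simp add: symmetric_body_def)
  have i: "interior (interior K) \<noteq> {}" using K_zero by auto
  have "ennreal ((norm (hessian_within (interior K) half_square x))\<^sup>2) = of_nat CARD('n)" if "x \<in> interior K" for x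
  proof -
    have "(norm (hessian_within (interior K) half_square x))\<^sup>2 = (\<Sum>i\<in>UNIV. \<Sum>j\<in>(UNIV::'n set). if i = j then 1 else 0)"
      unfolding power2_norm_eq_inner
      unfolding inner_vec_def hessian_within_def
      by (intro sum.cong refl) (simp add: partial_half_square(2)[OF convex_interior[OF K_convex] i that])
    also have "\<dots> = real CARD('n)" by simp
    finally show ?thesis by (simp add: ennreal_of_nat_eq_real_of_nat)
  qed
  then have "hessian_integral K half_square = (\<integral>\<^sup>+ x. of_nat CARD('n) * indicator (interior K) x \<partial>lborel)"
    unfolding hessian_integral_def by (intro nn_integral_cong) (auto simp: indicator_def)
  then show ?thesis by (simp add: nn_integral_cmult)
qed

theorem theorem8p3:
  fixes K :: "(real^'n::finite) set"
  assumes "K \<in> uncond_bodies"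
  shows "(\<forall>u\<in>S0 K.
            (\<forall>i. \<forall>x\<in>K. x $ i = 0 \<longrightarrow> partial_within K i u x = 0) \<longrightarrow>
            boundary_integral K u \<le> diag_hessian_integral K u \<and>
            diag_hessian_integral K u \<le> hessian_integral K u) \<and>
         (\<forall>u\<in>S0_uncond K.
            boundary_integral K u \<le> diag_hessian_integral K u \<and>
            diag_hessian_integral K u \<le> hessian_integral K u) \<and>
         B_uncond K = 1"
proof (intro conjI ballI impI)
  note K = assms
  show "boundary_integral K u \<le> diag_hessian_integral K u"
    if "u \<in> S0 K" "\<forall>i. \<forall>x\<in>K. x $ i = 0 \<longrightarrow> partial_within K i u x = 0" for u
    using that by (intro boundary_le_diag K) auto
  show uncond: "boundary_integral K u \<le> diag_hessian_integral K u" if "u \<in> S0_uncond K" for u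
    using that by (intro boundary_le_diag K S0_uncond_partial_zero) (auto simp: S0_uncond_def)
  show "diag_hessian_integral K u \<le> hessian_integral K u" for u by (rule diag_le_hessian)
  show "diag_hessian_integral K u \<le> hessian_integral K u" for u by (rule diag_le_hessian)
  interpret convex_body K using uncond_symmetric_body[OF K] by (simp add: symmetric_body_def)
  show "B_uncond K = 1"
  proof (rule antisym)
    have "boundary_integral K u \<le> 1 * hessian_integral K u" if "u \<in> S0_uncond K" for u
      using order_trans[OF uncond[OF that] diag_le_hessian] by simp
    then show "B_uncond K \<le> 1" unfolding B_uncond_def by (intro Inf_lower) auto
    show "1 \<le> B_uncond K" unfolding B_uncond_def
    proof (rule Inf_greatest)
      fix B assume "B \<in> {B. \<forall>u\<in>S0_uncond K. boundary_integral K u \<le> B * hessian_integral K u}"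
      then have B: "boundary_integral K half_square \<le> B * hessian_integral K half_square"
        using half_square_S0_uncond[OF K] by auto
      let ?V = "of_nat CARD('n) * emeasure lborel (interior K)"
      have fin: "emeasure lborel (interior K) < \<infinity>"
        by (rule emeasure_bounded_finite) (use K_compact compact_imp_bounded bounded_interior in blast)
      have "0 < emeasure lborel (interior K)"
      proof -
        have "interior K \<notin> null_sets lborel"
          using open_not_negligible[OF open_interior, of K] K_zero
          by (auto simp: negligible_iff_null_sets null_sets_completion_iff)
        then show ?thesis by (auto simp: null_sets_def zero_less_iff_neq_zero)
      qed
      then have V: "?V \<noteq> 0" "?V \<noteq> top" using fin by (auto simp: ennreal_mult_eq_top_iff of_nat_eq_0_iff)
      have "?V * 1 \<le> of_nat CARD('n) * emeasure lborel K"
        using K_closed by (auto intro!: mult_left_mono emeasure_mono interior_subset)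
      also have "\<dots> \<le> boundary_integral K half_square" by (rule boundary_integral_half_square[OF K])
      also have "\<dots> \<le> ?V * B" using B by (simp add: hessian_integral_half_square[OF K] mult.commute)
      finally show "1 \<le> B" using ennreal_mult_le_mult_iff[OF V] by blast
    qed
  qed
qed

end
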